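(* Greatest common divisors exist in the ring $\mathcal{E}$ of entire functions on $\mathbf{F}^m$: for any $f_1,\dots,f_k\in\mathcal{E}$ there is $G\in\mathcal{E}$ which is a greatest common divisor of $f_1,\dots,f_k$ in $\mathcal{E}$. Moreover, if $G$ is a greatest common divisor of $f_1,\dots,f_k$ in $\mathcal{E}$, then (restricted to $\mathbf{B}^m(r)$) $G$ is also a greatest common divisor of $f_1,\dots,f_k$ in the ring $\mathcal{A}^m(r)$ for every $r\in|\mathbf{F}^\times|$.
   Context: $\mathbf{F}$ is an algebraically closed field complete with respect to a non-trivial non-Archimedean absolute value $|\cdot|$; $|\mathbf{F}^\times|=\{|a|:a\in\mathbf{F}\setminus\{0\}\}$ is its value group. For $r\in|\mathbf{F}^\times|$, $\mathbf{B}^m(r)=\{z\in\mathbf{F}^m:\max_i|z_i|\le r\}$, and $\mathcal{A}^m(r)$ is the ring of formal power series $\sum_\gamma a_\gamma z^\gamma$ (multi-index notation, $z=(z_1,\dots,z_m)$, $|\gamma|=\gamma_1+\dots+\gamma_m$) with coefficients in $\mathbf{F}$ such that $|a_\gamma|r^{|\gamma|}\to0$ as $|\gamma|\to\infty$ (analytic functions on $\mathbf{B}^m(r)$). An entire function on $\mathbf{F}^m$ is a power series lying in $\mathcal{A}^m(r)$ for every $r\in|\mathbf{F}^\times|$; these form an integral domain $\mathcal{E}$, which is a subring of each $\mathcal{A}^m(r)$ (by restriction). Divisibility, units and greatest common divisors are taken in the indicated ring. *)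

theory Defs
  imports "HOL-Computational_Algebra.Polynomial"
begin

definition nonarch_abs :: "('a::field \<Rightarrow> real) \<Rightarrow> bool" where
  "nonarch_abs absv \<longleftrightarrow>
     (\<forall>x. 0 \<le> absv x) \<and>
     (\<forall>x. absv x = 0 \<longleftrightarrow> x = 0) \<and>
     (\<forall>x y. absv (x * y) = absv x * absv y) \<and>
     (\<forall>x y. absv (x + y) \<le> max (absv x) (absv y))"

definition nontrivial_abs :: "('a::field \<Rightarrow> real) \<Rightarrow> bool" where
  "nontrivial_abs absv \<longleftrightarrow> (\<exists>x. x \<noteq> 0 \<and> absv x \<noteq> 1)"

definition complete_abs :: "('a::field \<Rightarrow> real) \<Rightarrow> bool" where
  "complete_abs absv \<longleftrightarrow>
     (\<forall>s :: nat \<Rightarrow> 'a.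
        (\<forall>e>0. \<exists>N. \<forall>n\<ge>N. \<forall>p\<ge>N. absv (s n - s p) < e) \<longrightarrow>
        (\<exists>L. \<forall>e>0. \<exists>N. \<forall>n\<ge>N. absv (s n - L) < e))"

definition alg_closed_field :: "'a::field itself \<Rightarrow> bool" where
  "alg_closed_field _ \<longleftrightarrow> (\<forall>p :: 'a poly. 0 < degree p \<longrightarrow> (\<exists>x. poly p x = 0))"

definition nonarch_field :: "('a::field \<Rightarrow> real) \<Rightarrow> bool" where
  "nonarch_field absv \<longleftrightarrow> nonarch_abs absv \<and> nontrivial_abs absv \<and> complete_abs absv
     \<and> alg_closed_field TYPE('a)"

definition value_group :: "('a::field \<Rightarrow> real) \<Rightarrow> real set" where
  "value_group absv = {absv a | a. a \<noteq> 0}"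

text \<open>Multi-indices in m variables: gamma :: nat => nat with gamma i = 0 for i >= m.
  A formal power series in m variables is a coefficient function on multi-indices
  vanishing off the valid multi-indices.\<close>
definition multi_idx :: "nat \<Rightarrow> (nat \<Rightarrow> nat) set" where
  "multi_idx m = {\<gamma>. \<forall>i\<ge>m. \<gamma> i = 0}"

definition mdeg :: "nat \<Rightarrow> (nat \<Rightarrow> nat) \<Rightarrow> nat" where
  "mdeg m \<gamma> = (\<Sum>i<m. \<gamma> i)"

definition fps_m :: "nat \<Rightarrow> ((nat \<Rightarrow> nat) \<Rightarrow> 'a::field) set" where
  "fps_m m = {f. \<forall>\<gamma>. \<gamma> \<notin> multi_idx m \<longrightarrow> f \<gamma> = 0}"

definition ps_mult :: "((nat \<Rightarrow> nat) \<Rightarrow> 'a::field) \<Rightarrow> ((nat \<Rightarrow> nat) \<Rightarrow> 'a) \<Rightarrow> (nat \<Rightarrow> nat) \<Rightarrow> 'a" where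
  "ps_mult f g \<gamma> = (\<Sum>\<alpha>\<in>{\<alpha>. \<forall>i. \<alpha> i \<le> \<gamma> i}. f \<alpha> * g (\<lambda>i. \<gamma> i - \<alpha> i))"

definition analytic_ring :: "('a::field \<Rightarrow> real) \<Rightarrow> nat \<Rightarrow> real \<Rightarrow> ((nat \<Rightarrow> nat) \<Rightarrow> 'a) set" where
  "analytic_ring absv m r = {f \<in> fps_m m.
     \<forall>e>0. \<exists>N. \<forall>\<gamma>\<in>multi_idx m. N \<le> mdeg m \<gamma> \<longrightarrow> absv (f \<gamma>) * r ^ mdeg m \<gamma> < e}"

definition entire_ring :: "('a::field \<Rightarrow> real) \<Rightarrow> nat \<Rightarrow> ((nat \<Rightarrow> nat) \<Rightarrow> 'a) set" where
  "entire_ring absv m = {f \<in> fps_m m. \<forall>r\<in>value_group absv. f \<in> analytic_ring absv m r}"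

definition dvd_in :: "((nat \<Rightarrow> nat) \<Rightarrow> 'a::field) set \<Rightarrow> ((nat \<Rightarrow> nat) \<Rightarrow> 'a) \<Rightarrow> ((nat \<Rightarrow> nat) \<Rightarrow> 'a) \<Rightarrow> bool" where
  "dvd_in R f g \<longleftrightarrow> (\<exists>h\<in>R. g = ps_mult f h)"

definition is_gcd_in :: "((nat \<Rightarrow> nat) \<Rightarrow> 'a::field) set \<Rightarrow> ((nat \<Rightarrow> nat) \<Rightarrow> 'a) list \<Rightarrow> ((nat \<Rightarrow> nat) \<Rightarrow> 'a) \<Rightarrow> bool" where
  "is_gcd_in R fs G \<longleftrightarrow> G \<in> R \<and> (\<forall>f\<in>set fs. dvd_in R G f) \<and>
     (\<forall>D\<in>R. (\<forall>f\<in>set fs. dvd_in R D f) \<longrightarrow> dvd_in R D G)"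

end

theory Submission
  imports Defs "HOL-Library.Poly_Mapping"
begin

text \<open>
  For every real \<open>r > 0\<close> the Tate algebra of series converging on the polydisc of radius \<open>r\<close> is factorial.
  The total degree \<open>\<delta> f\<close> of the highest monomial at which the Gauss norm of \<open>f\<close> is attained is additive on
  products and vanishes exactly on units, so factorizations exist. To see that an irreducible \<open>f\<close> is prime,
  shear the coordinates so that \<open>f\<close> is distinguished in the last variable. By Weierstrass preparation \<open>f\<close> is then
  associated to a monic polynomial over the Tate algebra \<open>R\<close> in one variable less, and if \<open>f\<close> does not
  divide \<open>g\<close>, pseudo-division together with factoriality of \<open>R\<close> produces a nonzero \<open>\<rho> \<in> R\<close> in the ideal
  \<open>(f, g)\<close>. The same \<open>\<rho>\<close> shows that \<open>f\<close> and \<open>g\<close> stay coprime on every smaller polydisc: a common prime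
  divisor there would divide \<open>\<rho>\<close>, hence come from \<open>R\<close>, and could not divide a monic polynomial. So a greatest common
  divisor on one polydisc remains one on all smaller polydiscs. Finally, greatest common divisors \<open>G\<^sub>k\<close> on the
  polydiscs of radius \<open>2\<^sup>k\<close> can be scaled such that \<open>G\<^sub>k\<^sub>+\<^sub>1 = u\<^sub>k G\<^sub>k\<close> with units \<open>u\<^sub>k\<close> of constant term \<open>1\<close>.
  All other terms of \<open>u\<^sub>k\<close> have Gauss norm below \<open>1\<close> at radius \<open>2\<^sup>k\<close>, hence tend to \<open>0\<close> at any fixed radius, and
  the \<open>G\<^sub>k\<close> converge to an entire function.
\<close>

subsection \<open>Multivariate power series\<close>

text \<open>Radii are arbitrary positive reals, so a polydisc cannot in general be rescaled to the
  unit polydisc. Everything is therefore phrased through the weights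
  \<open>absv (coef f \<gamma>) * r ^ deg \<gamma>\<close>, and leading monomials replace reduction
  modulo the maximal ideal. Because all variables share one radius, a shear with
  \<open>absv c \<le> 1\<close> is an isometry for every r at once; this allows one change of
  coordinates to serve both polydiscs when radii are compared. Algebraic closedness enters in the
  choice of the shear constants, completeness in summing the corrections of approximate divisions
  and in the final limit. The obstacle to arguing inside the ring of entire functions is that an
  entire function may have infinitely many irreducible factors, so no degree can drive a
  factorization. On a fixed polydisc there are finitely many up to units, but an irreducible element
  may split or become a unit when the radius shrinks. Hence coprimality and gcds, not
  factorizations, are carried from one radius to another.\<close>

abbreviation "lookup \<equiv> Poly_Mapping.lookup"
abbreviation "keys \<equiv> Poly_Mapping.keys"
abbreviation "single \<equiv> Poly_Mapping.single"

type_synonym mono = "nat \<Rightarrow>\<^sub>0 nat"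

definition deg :: "mono \<Rightarrow> nat" where
  "deg \<gamma> = (\<Sum>i\<in>keys \<gamma>. lookup \<gamma> i)"

lemma deg_eq_sum: "finite S \<Longrightarrow> keys \<gamma> \<subseteq> S \<Longrightarrow> deg \<gamma> = (\<Sum>i\<in>S. lookup \<gamma> i)"
  unfolding deg_def by (rule sum.mono_neutral_left) (auto simp: in_keys_iff)

lemma deg_add [simp]: "deg (\<alpha> + \<beta>) = deg \<alpha> + deg \<beta>"
proof -
  let ?S = "keys \<alpha> \<union> keys \<beta>"
  have "deg (\<alpha> + \<beta>) = (\<Sum>i\<in>?S. lookup (\<alpha> + \<beta>) i)"
    by (rule deg_eq_sum) (auto simp: in_keys_iff lookup_add)
  also have "\<dots> = (\<Sum>i\<in>?S. lookup \<alpha> i) + (\<Sum>i\<in>?S. lookup \<beta> i)"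
    by (simp add: lookup_add sum.distrib)
  also have "\<dots> = deg \<alpha> + deg \<beta>"
    using deg_eq_sum[of ?S \<alpha>] deg_eq_sum[of ?S \<beta>] by simp
  finally show ?thesis .
qed

lemma deg_zero [simp]: "deg 0 = 0"
  by (simp add: deg_def)

lemma deg_single [simp]: "deg (single i k) = k"
  by (simp add: deg_def)

lemma lookup_le_deg: "lookup \<gamma> i \<le> deg \<gamma>"
  using member_le_sum[of i "keys \<gamma>" "lookup \<gamma>"]
  by (cases "i \<in> keys \<gamma>") (auto simp: deg_def in_keys_iff)

lemma deg_eq_0_iff [simp]: "deg \<gamma> = 0 \<longleftrightarrow> \<gamma> = 0"
  by (auto simp: deg_def in_keys_iff intro: poly_mapping_eqI)

lemma lookup_eq_deg_imp_single:
  assumes "lookup \<gamma> n = deg \<gamma>" shows "\<gamma> = single n (deg \<gamma>)"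
proof (rule poly_mapping_eqI)
  fix k
  show "lookup \<gamma> k = lookup (single n (deg \<gamma>)) k"
  proof (cases "k = n")
    case False
    have "deg \<gamma> = (\<Sum>i\<in>insert n (insert k (keys \<gamma>)). lookup \<gamma> i)"
      by (rule deg_eq_sum) auto
    also have "\<dots> \<ge> (\<Sum>i\<in>{n,k}. lookup \<gamma> i)"
      by (rule sum_mono2) auto
    finally show ?thesis using assms False by (simp add: lookup_single)
  qed (use assms in simp)
qed

text \<open>Keeping both summands, rather than one of them and a difference, turns commutativity and
  associativity of the product into plain bijections between index sets.\<close>

definition dec :: "mono \<Rightarrow> (mono \<times> mono) set" where
  "dec \<gamma> = {(\<alpha>, \<beta>). \<alpha> + \<beta> = \<gamma>}"

lemma mem_dec [simp]: "(\<alpha>, \<beta>) \<in> dec \<gamma> \<longleftrightarrow> \<alpha> + \<beta> = \<gamma>"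
  by (simp add: dec_def)

lemma finite_mono_bounded: "finite {\<alpha>::mono. \<forall>i. lookup \<alpha> i \<le> lookup \<gamma> i}" (is "finite ?A")
proof -
  let ?F = "{g. \<forall>i. (i \<in> keys \<gamma> \<longrightarrow> g i \<in> {..deg \<gamma>}) \<and> (i \<notin> keys \<gamma> \<longrightarrow> g i = (0::nat))}"
  have "finite ?F"
    by (rule finite_set_of_finite_funs) auto
  moreover have "lookup ` ?A \<subseteq> ?F"
    using lookup_le_deg[of \<gamma>] by (auto simp: in_keys_iff intro: le_trans) (metis le_zero_eq)
  ultimately have "finite (lookup ` ?A)" by (rule finite_subset[rotated])
  then show ?thesis
    by (rule finite_imageD) (simp add: inj_on_def lookup_inject)
qed

lemma finite_dec [simp]: "finite (dec \<gamma>)"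
proof (rule finite_subset)
  let ?A = "{\<alpha>::mono. \<forall>i. lookup \<alpha> i \<le> lookup \<gamma> i}"
  show "dec \<gamma> \<subseteq> ?A \<times> ?A"
    by (auto simp: lookup_add)
  show "finite (?A \<times> ?A)"
    using finite_mono_bounded by blast
qed

text \<open>A separate type carries the Cauchy product as a type class ring. The number of variables
  is not part of the type: exponents have finite support, so series in different numbers of
  variables live in one ring, and induction on that number needs no embeddings.\<close>

typedef 'a mps = "UNIV :: (mono \<Rightarrow> 'a) set"
  morphisms coef mps ..

lemma mps_eqI: "(\<And>\<gamma>. coef f \<gamma> = coef g \<gamma>) \<Longrightarrow> f = g"
  by (simp add: coef_inject[symmetric] fun_eq_iff)

lemma coef_mps [simp]: "coef (mps F) = F"
  by (simp add: mps_inverse)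

instantiation mps :: (comm_ring_1) comm_ring_1
begin

definition "0 = mps (\<lambda>_. 0)"
definition "1 = mps (\<lambda>\<gamma>. if \<gamma> = 0 then 1 else 0)"
definition "f + g = mps (\<lambda>\<gamma>. coef f \<gamma> + coef g \<gamma>)"
definition "f - g = mps (\<lambda>\<gamma>. coef f \<gamma> - coef g \<gamma>)"
definition "- f = mps (\<lambda>\<gamma>. - coef f \<gamma>)"
definition "f * g = mps (\<lambda>\<gamma>. \<Sum>(\<alpha>, \<beta>)\<in>dec \<gamma>. coef f \<alpha> * coef g \<beta>)"

instance
proof
  fix a b c :: "'a mps"
  show "a * b * c = a * (b * c)"
  proof (rule mps_eqI)
    fix \<gamma>
    have "coef (a * b * c) \<gamma> = (\<Sum>(x, z)\<in>dec \<gamma>. \<Sum>(u, v)\<in>dec x. coef a u * coef b v * coef c z)"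
      by (simp add: times_mps_def sum_distrib_right case_prod_unfold)
    also have "\<dots> = (\<Sum>((x, z), (u, v))\<in>(SIGMA p:dec \<gamma>. dec (fst p)). coef a u * coef b v * coef c z)"
      by (subst sum.Sigma[symmetric]) (auto simp: case_prod_unfold)
    also have "\<dots> = (\<Sum>((u, y), (v, z))\<in>(SIGMA p:dec \<gamma>. dec (snd p)). coef a u * (coef b v * coef c z))"
      by (rule sum.reindex_bij_witness
          [where i = "\<lambda>((u, y), (v, z)). ((u + v, z), (u, v))" and j = "\<lambda>((x, z), (u, v)). ((u, v + z), (v, z))"])
         (auto simp: add.assoc mult.assoc)
    also have "\<dots> = (\<Sum>(u, y)\<in>dec \<gamma>. \<Sum>(v, z)\<in>dec y. coef a u * (coef b v * coef c z))"
      by (subst sum.Sigma[symmetric]) (auto simp: case_prod_unfold)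
    also have "\<dots> = coef (a * (b * c)) \<gamma>"
      by (simp add: times_mps_def sum_distrib_left case_prod_unfold)
    finally show "coef (a * b * c) \<gamma> = coef (a * (b * c)) \<gamma>" .
  qed
  show "a * b = b * a"
  proof (rule mps_eqI)
    fix \<gamma>
    show "coef (a * b) \<gamma> = coef (b * a) \<gamma>"
      unfolding times_mps_def coef_mps
      by (rule sum.reindex_bij_witness[where i = "\<lambda>(x, y). (y, x)" and j = "\<lambda>(x, y). (y, x)"])
         (auto simp: ac_simps)
  qed
  show "1 * a = a"
  proof (rule mps_eqI)
    fix \<gamma>
    have "coef (1 * a) \<gamma> = (\<Sum>p\<in>{(0, \<gamma>)}. coef 1 (fst p) * coef a (snd p))"
      unfolding times_mps_def coef_mps case_prod_unfold
      by (rule sum.mono_neutral_right) (auto simp: one_mps_def)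
    then show "coef (1 * a) \<gamma> = coef a \<gamma>" by (simp add: one_mps_def)
  qed
  show "(a + b) * c = a * c + b * c"
    by (rule mps_eqI) (simp add: times_mps_def plus_mps_def case_prod_unfold distrib_right sum.distrib)
  have "coef (0::'a mps) 0 \<noteq> coef 1 0" by (simp add: zero_mps_def one_mps_def)
  then show "(0::'a mps) \<noteq> 1" by metis
qed (auto intro!: mps_eqI simp: plus_mps_def minus_mps_def uminus_mps_def zero_mps_def algebra_simps)

end

lemma coef_zero [simp]: "coef 0 \<gamma> = 0"
  and coef_one: "coef 1 \<gamma> = (if \<gamma> = 0 then 1 else 0)"
  and coef_add [simp]: "coef (f + g) \<gamma> = coef f \<gamma> + coef g \<gamma>"
  and coef_diff [simp]: "coef (f - g) \<gamma> = coef f \<gamma> - coef g \<gamma>"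
  and coef_uminus [simp]: "coef (- f) \<gamma> = - coef f \<gamma>"
  and coef_mult: "coef (f * g) \<gamma> = (\<Sum>(\<alpha>, \<beta>)\<in>dec \<gamma>. coef f \<alpha> * coef g \<beta>)"
  by (simp_all add: zero_mps_def one_mps_def plus_mps_def minus_mps_def uminus_mps_def times_mps_def)

lemma coef_sum: "coef (\<Sum>x\<in>S. f x) \<gamma> = (\<Sum>x\<in>S. coef (f x) \<gamma>)"
  by (induction S rule: infinite_finite_induct) auto

definition term_mps :: "mono \<Rightarrow> 'a::comm_ring_1 \<Rightarrow> 'a mps" where
  "term_mps \<alpha> c = mps (\<lambda>\<gamma>. if \<gamma> = \<alpha> then c else 0)"

lemma coef_term: "coef (term_mps \<alpha> c) \<gamma> = (if \<gamma> = \<alpha> then c else 0)"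
  by (simp add: term_mps_def)

lemma coef_term_mult_add [simp]: "coef (term_mps \<alpha> c * f) (\<alpha> + \<beta>) = c * coef f \<beta>"
proof -
  have "coef (term_mps \<alpha> c * f) (\<alpha> + \<beta>) = (\<Sum>p\<in>{(\<alpha>, \<beta>)}. coef (term_mps \<alpha> c) (fst p) * coef f (snd p))"
    unfolding coef_mult case_prod_unfold by (rule sum.mono_neutral_right) (auto simp: coef_term)
  then show ?thesis by (simp add: coef_term)
qed

abbreviation cst :: "'a::comm_ring_1 \<Rightarrow> 'a mps" where "cst \<equiv> term_mps 0"

lemma coef_cst_mult [simp]: "coef (cst c * f) \<gamma> = c * coef f \<gamma>"
  using coef_term_mult_add[of 0 c f \<gamma>] by simp

lemma cst_mult: "cst a * cst b = cst (a * b)"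
  by (rule mps_eqI) (auto simp: coef_term)

lemma cst_one [simp]: "cst 1 = 1"
  by (rule mps_eqI) (auto simp: coef_term coef_one)

subsection \<open>Gauss norms and Tate algebras\<close>

locale nonarch =
  fixes absv :: "'a::field \<Rightarrow> real"
  assumes nonarch_field: "nonarch_field absv"
begin

lemma absv_nonneg [simp]: "0 \<le> absv x"
  and absv_eq_0 [simp]: "absv x = 0 \<longleftrightarrow> x = 0"
  and absv_mult: "absv (x * y) = absv x * absv y"
  and absv_add: "absv (x + y) \<le> max (absv x) (absv y)"
  using nonarch_field by (auto simp: nonarch_field_def nonarch_abs_def)

lemma absv_zero [simp]: "absv 0 = 0"
  by simp

lemma absv_pos [simp]: "0 < absv x \<longleftrightarrow> x \<noteq> 0"
  using absv_nonneg[of x] absv_eq_0[of x] by linarith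

lemma absv_one [simp]: "absv 1 = 1"
proof -
  have "absv 1 * absv 1 = absv 1 * 1" using absv_mult[of 1 1] by simp
  then show ?thesis by (simp del: mult_1_right)
qed

lemma absv_uminus [simp]: "absv (- x) = absv x"
proof -
  have "(absv (- 1))\<^sup>2 = 1" using absv_mult[of "- 1" "- 1"] by (simp add: power2_eq_square)
  then have "absv (- 1) = 1" using absv_nonneg[of "- 1"] by (simp add: power2_eq_1_iff)
  then show ?thesis using absv_mult[of "- 1" x] by simp
qed

lemma absv_diff: "absv (x - y) \<le> max (absv x) (absv y)"
  using absv_add[of x "- y"] by simp

lemma absv_add_eq: "absv y < absv x \<Longrightarrow> absv (x + y) = absv x"
  using absv_add[of x y] absv_diff[of "x + y" y] by auto

lemma absv_power: "absv (x ^ k) = absv x ^ k"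
  by (induction k) (auto simp: absv_mult)

lemma absv_inverse: "absv (inverse x) = inverse (absv x)"
proof (cases "x = 0")
  case False
  then have "absv x * absv (inverse x) = 1" by (simp flip: absv_mult)
  then show ?thesis by (metis inverse_unique)
qed simp

lemma absv_sum_le:
  assumes "\<And>x. x \<in> S \<Longrightarrow> absv (f x) \<le> c" "0 \<le> c"
  shows "absv (\<Sum>x\<in>S. f x) \<le> c"
  using assms
proof (induction S rule: infinite_finite_induct)
  case (insert x S)
  then have "absv (f x) \<le> c" "absv (\<Sum>x\<in>S. f x) \<le> c" by auto
  then show ?case using absv_add[of "f x" "\<Sum>x\<in>S. f x"] insert(1,2) by simp
qed auto

lemma absv_sum_less:
  assumes "\<And>x. x \<in> S \<Longrightarrow> absv (f x) < c" "0 < c"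
  shows "absv (\<Sum>x\<in>S. f x) < c"
  using assms
proof (induction S rule: infinite_finite_induct)
  case (insert x S)
  then have "absv (f x) < c" "absv (\<Sum>x\<in>S. f x) < c" by auto
  then show ?case using absv_add[of "f x" "\<Sum>x\<in>S. f x"] insert(1,2) by simp
qed auto

lemma absv_of_nat: "absv (of_nat k) \<le> 1"
  using absv_sum_le[of "{..<k}" "\<lambda>_. 1" 1] by simp

definition wt :: "real \<Rightarrow> 'a mps \<Rightarrow> mono \<Rightarrow> real" where
  "wt r f \<gamma> = absv (coef f \<gamma>) * r ^ deg \<gamma>"

text \<open>Convergence is expressed as finiteness of the set of monomials of weight at least e.
  This hands out finite sets directly; agreement with the limit along the degree is shown in
  \<open>analytic_ring_eq\<close>.\<close>

definition tate :: "nat \<Rightarrow> real \<Rightarrow> 'a mps set" where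
  "tate m r = {f. (\<forall>\<gamma>. coef f \<gamma> \<noteq> 0 \<longrightarrow> keys \<gamma> \<subseteq> {..<m}) \<and> (\<forall>e>0. finite {\<gamma>. e \<le> wt r f \<gamma>})}"

definition gn :: "real \<Rightarrow> 'a mps \<Rightarrow> real" where
  "gn r f = (SUP \<gamma>. wt r f \<gamma>)"

lemma tate_keys: "f \<in> tate m r \<Longrightarrow> coef f \<gamma> \<noteq> 0 \<Longrightarrow> keys \<gamma> \<subseteq> {..<m}"
  and tate_finite: "f \<in> tate m r \<Longrightarrow> e > 0 \<Longrightarrow> finite {\<gamma>. e \<le> wt r f \<gamma>}"
  by (auto simp: tate_def)

lemma wt_nonneg [simp]: "0 < r \<Longrightarrow> 0 \<le> wt r f \<gamma>"
  by (simp add: wt_def)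

lemma wt_eq_0 [simp]: "0 < r \<Longrightarrow> wt r f \<gamma> = 0 \<longleftrightarrow> coef f \<gamma> = 0"
  by (simp add: wt_def)

lemma wt_zero [simp]: "wt r 0 \<gamma> = 0"
  by (simp add: wt_def)

lemma wt_add: "0 < r \<Longrightarrow> wt r (f + g) \<gamma> \<le> max (wt r f \<gamma>) (wt r g \<gamma>)"
  using absv_add[of "coef f \<gamma>" "coef g \<gamma>"]
  by (auto simp: wt_def max_def intro: mult_right_mono split: if_splits)

lemma wt_uminus [simp]: "wt r (- f) \<gamma> = wt r f \<gamma>"
  by (simp add: wt_def)

text \<open>The ultrametric inequality bounds a coefficient of the product by its largest summand,
  and additivity of \<open>deg\<close> turns that summand into a product of two weights.\<close>

lemma wt_mult_le:
  assumes r: "0 < r" and c: "0 \<le> c" and le: "\<And>\<alpha> \<beta>. \<alpha> + \<beta> = \<gamma> \<Longrightarrow> wt r f \<alpha> * wt r g \<beta> \<le> c"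
  shows "wt r (f * g) \<gamma> \<le> c"
proof -
  have "absv (coef (f * g) \<gamma>) \<le> c / r ^ deg \<gamma>"
    unfolding coef_mult
  proof (rule absv_sum_le)
    fix p assume "p \<in> dec \<gamma>"
    then obtain \<alpha> \<beta> where p: "p = (\<alpha>, \<beta>)" "\<alpha> + \<beta> = \<gamma>" by (cases p) auto
    from le[OF p(2)] p r show "absv (case p of (\<alpha>, \<beta>) \<Rightarrow> coef f \<alpha> * coef g \<beta>) \<le> c / r ^ deg \<gamma>"
      by (auto simp: wt_def absv_mult power_add field_simps)
  qed (use r c in simp)
  then show ?thesis using r by (simp add: wt_def field_simps)
qed

lemma tate_mono_var: "m \<le> m' \<Longrightarrow> tate m r \<subseteq> tate m' r"
  unfolding tate_def by (auto dest: less_le_trans)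

lemma tate_mono_radius: assumes "0 < r" "r \<le> r'" shows "tate m r' \<subseteq> tate m r"
proof -
  have "wt r f \<gamma> \<le> wt r' f \<gamma>" for f \<gamma>
    using assms by (auto simp: wt_def intro!: mult_left_mono power_mono)
  then have "{\<gamma>. e \<le> wt r f \<gamma>} \<subseteq> {\<gamma>. e \<le> wt r' f \<gamma>}" for e f
    by (auto intro: order_trans)
  then have "finite {\<gamma>. e \<le> wt r f \<gamma>}" if "finite {\<gamma>. e \<le> wt r' f \<gamma>}" for e f
    using that finite_subset by blast
  then show ?thesis unfolding tate_def by blast
qed

text \<open>Applied to truncated series in Weierstrass division: deleting coefficients raises no
  weight.\<close>

lemma tate_subset_wt:
  assumes "g \<in> tate m r" "\<And>\<gamma>. wt r f \<gamma> \<le> wt r g \<gamma>" "0 < r"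
  shows "f \<in> tate m r"
proof -
  have "keys \<gamma> \<subseteq> {..<m}" if "coef f \<gamma> \<noteq> 0" for \<gamma>
  proof (rule tate_keys[OF assms(1)])
    have "wt r f \<gamma> \<noteq> 0" using that assms(3) by simp
    then have "wt r f \<gamma> > 0" using wt_nonneg[OF assms(3)] by (simp add: less_le)
    then show "coef g \<gamma> \<noteq> 0"
      using assms(2)[of \<gamma>] wt_eq_0[OF assms(3), of g \<gamma>] by linarith
  qed
  moreover have "finite {\<gamma>. e \<le> wt r f \<gamma>}" if "e > 0" for e
    by (rule finite_subset[OF _ tate_finite[OF assms(1) that]]) (auto intro: order_trans[OF _ assms(2)])
  ultimately show ?thesis by (auto simp: tate_def)
qed

end

locale nonarch_disc = nonarch absv for absv :: "'a::field \<Rightarrow> real" +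
  fixes r :: real
  assumes r_pos [simp]: "0 < r"
begin

lemma r_nonneg [simp]: "0 \<le> r"
  by (rule less_imp_le[OF r_pos])

lemma tate_bounded: assumes "f \<in> tate m r" obtains M where "M > 0" "\<And>\<gamma>. wt r f \<gamma> \<le> M"
proof
  let ?A = "insert 1 (wt r f ` {\<gamma>. 1 \<le> wt r f \<gamma>})"
  have fin: "finite ?A" using tate_finite[OF assms, of 1] by simp
  have ge: "1 \<le> Max ?A" by (rule Max_ge[OF fin]) simp
  then show "Max ?A > 0" by linarith
  fix \<gamma> show "wt r f \<gamma> \<le> Max ?A"
  proof (cases "1 \<le> wt r f \<gamma>")
    case True then show ?thesis by (intro Max_ge fin) auto
  next
    case False then show ?thesis using ge by linarith
  qed
qed

lemma wt_le_gn: assumes "f \<in> tate m r" shows "wt r f \<gamma> \<le> gn r f"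
proof -
  obtain M where "\<And>\<gamma>. wt r f \<gamma> \<le> M" using tate_bounded[OF assms] by metis
  then have "bdd_above (range (wt r f))" by (auto simp: bdd_above_def)
  then show ?thesis unfolding gn_def by (rule cSUP_upper[OF UNIV_I])
qed

lemma gn_le: "(\<And>\<gamma>. wt r f \<gamma> \<le> c) \<Longrightarrow> gn r f \<le> c"
  unfolding gn_def by (rule cSUP_least) auto

lemma gn_nonneg [simp]: "f \<in> tate m r \<Longrightarrow> 0 \<le> gn r f"
  using wt_le_gn[of f m 0] wt_nonneg[OF r_pos, of f 0] by linarith

lemma gn_zero [simp]: "gn r 0 = 0"
  by (simp add: gn_def)

lemma gn_eq_0_iff: assumes "f \<in> tate m r" shows "gn r f = 0 \<longleftrightarrow> f = 0"
proof
  assume "gn r f = 0"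
  then have "wt r f \<gamma> = 0" for \<gamma> using wt_le_gn[OF assms, of \<gamma>] wt_nonneg[OF r_pos, of f \<gamma>] by simp
  then show "f = 0" by (intro mps_eqI) simp
qed simp

lemma gn_pos: "f \<in> tate m r \<Longrightarrow> f \<noteq> 0 \<Longrightarrow> 0 < gn r f"
  using gn_nonneg[of f m] gn_eq_0_iff[of f m] by (simp add: less_le)

text \<open>The supremum over infinitely many monomials is a maximum because only finitely many
  weights reach half of it.\<close>

lemma gn_attained: assumes "f \<in> tate m r" obtains \<gamma> where "wt r f \<gamma> = gn r f"
proof (cases "f = 0")
  case False
  let ?e = "gn r f / 2"
  let ?A = "{\<gamma>. ?e \<le> wt r f \<gamma>}"
  have pos: "gn r f > 0" using gn_pos[OF assms False] .
  have fin: "finite ?A" by (rule tate_finite[OF assms]) (simp add: pos)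
  have "\<not> (\<forall>\<gamma>. wt r f \<gamma> \<le> ?e)" using gn_le[of f ?e] pos by auto
  then obtain \<gamma> where "?e < wt r f \<gamma>" by (auto simp: not_le)
  then have "\<gamma> \<in> ?A" by simp
  then have ne: "?A \<noteq> {}" by blast
  obtain \<gamma> where \<gamma>: "\<gamma> \<in> ?A" "wt r f \<gamma> = Max (wt r f ` ?A)"
    using Max_in[of "wt r f ` ?A"] fin ne by (metis (no_types, lifting) finite_imageI image_iff image_is_empty)
  have "wt r f \<beta> \<le> wt r f \<gamma>" for \<beta>
  proof (cases "\<beta> \<in> ?A")
    case True then show ?thesis unfolding \<gamma>(2) using fin by (intro Max_ge) auto
  next
    case False then show ?thesis using \<gamma>(1) by auto
  qed
  then have "gn r f = wt r f \<gamma>" using wt_le_gn[OF assms, of \<gamma>] gn_le[of f "wt r f \<gamma>"] by force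
  then show ?thesis using that by simp
qed (use that in simp)

lemma gn_less: "f \<in> tate m r \<Longrightarrow> (\<And>\<gamma>. wt r f \<gamma> < c) \<Longrightarrow> gn r f < c"
  by (metis gn_attained)

lemma tate_zero [simp]: "0 \<in> tate m r"
  by (auto simp: tate_def)

lemma tate_term: assumes "keys \<alpha> \<subseteq> {..<m}" shows "term_mps \<alpha> c \<in> tate m r"
proof -
  have "{\<gamma>. e \<le> wt r (term_mps \<alpha> c) \<gamma>} \<subseteq> {\<alpha>}" if "e > 0" for e
    using that by (auto simp: wt_def coef_term split: if_splits)
  then show ?thesis using assms unfolding tate_def by (auto simp: coef_term intro: finite_subset)
qed

lemma tate_cst [simp]: "cst c \<in> tate m r"
  by (rule tate_term) simp

lemma tate_one [simp]: "1 \<in> tate m r"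
  using tate_cst[of 1] by simp

lemma tate_uminus [simp]: "f \<in> tate m r \<Longrightarrow> - f \<in> tate m r"
  by (auto simp: tate_def)

lemma tate_add [simp]: assumes f: "f \<in> tate m r" and g: "g \<in> tate m r" shows "f + g \<in> tate m r"
proof -
  have "{\<gamma>. e \<le> wt r (f + g) \<gamma>} \<subseteq> {\<gamma>. e \<le> wt r f \<gamma>} \<union> {\<gamma>. e \<le> wt r g \<gamma>}" for e
  proof
    fix \<gamma> assume "\<gamma> \<in> {\<gamma>. e \<le> wt r (f + g) \<gamma>}"
    then have "e \<le> max (wt r f \<gamma>) (wt r g \<gamma>)" using wt_add[OF r_pos, of f g \<gamma>] by simp
    then show "\<gamma> \<in> {\<gamma>. e \<le> wt r f \<gamma>} \<union> {\<gamma>. e \<le> wt r g \<gamma>}" by (simp add: le_max_iff_disj)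
  qed
  then have "finite {\<gamma>. e \<le> wt r (f + g) \<gamma>}" if "e > 0" for e
    using tate_finite[OF f that] tate_finite[OF g that] by (meson finite_UnI finite_subset)
  moreover have "keys \<gamma> \<subseteq> {..<m}" if "coef (f + g) \<gamma> \<noteq> 0" for \<gamma>
    using that tate_keys[OF f] tate_keys[OF g] by (metis add.right_neutral coef_add)
  ultimately show ?thesis by (auto simp: tate_def)
qed

lemma tate_diff [simp]: "f \<in> tate m r \<Longrightarrow> g \<in> tate m r \<Longrightarrow> f - g \<in> tate m r"
  using tate_add[of f m "- g"] by simp

lemma tate_mult [simp]: assumes f: "f \<in> tate m r" and g: "g \<in> tate m r" shows "f * g \<in> tate m r"
proof -
  have "keys \<gamma> \<subseteq> {..<m}" if nz: "coef (f * g) \<gamma> \<noteq> 0" for \<gamma>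
  proof -
    obtain p where "p \<in> dec \<gamma>" "(case p of (\<alpha>, \<beta>) \<Rightarrow> coef f \<alpha> * coef g \<beta>) \<noteq> 0"
      using sum.not_neutral_contains_not_neutral[OF nz[unfolded coef_mult]] by blast
    then obtain \<alpha> \<beta> where "\<alpha> + \<beta> = \<gamma>" "coef f \<alpha> \<noteq> 0" "coef g \<beta> \<noteq> 0"
      by (cases p) auto
    then show ?thesis using tate_keys[OF f] tate_keys[OF g] Poly_Mapping.keys_add[of \<alpha> \<beta>] by blast
  qed
  moreover have "finite {\<gamma>. e \<le> wt r (f * g) \<gamma>}" if e: "e > 0" for e
  proof -
    obtain M where M: "M > 0" "\<And>\<gamma>. wt r f \<gamma> \<le> M" using tate_bounded[OF f] by metis
    obtain M' where M': "M' > 0" "\<And>\<gamma>. wt r g \<gamma> \<le> M'" using tate_bounded[OF g] by metis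
    define A where "A = {\<gamma>. e / 2 / M' \<le> wt r f \<gamma>}"
    define B where "B = {\<gamma>. e / 2 / M \<le> wt r g \<gamma>}"
    have sub: "\<gamma> \<in> (\<lambda>(\<alpha>, \<beta>). \<alpha> + \<beta>) ` (A \<times> B)" if \<gamma>: "e \<le> wt r (f * g) \<gamma>" for \<gamma>
    proof (rule ccontr)
      assume neg: "\<not> ?thesis"
      have "wt r (f * g) \<gamma> \<le> e / 2"
      proof (rule wt_mult_le)
        fix \<alpha> \<beta> assume ab: "\<alpha> + \<beta> = \<gamma>"
        then have "\<alpha> \<notin> A \<or> \<beta> \<notin> B" using neg by blast
        then show "wt r f \<alpha> * wt r g \<beta> \<le> e / 2"
        proof
          assume "\<alpha> \<notin> A"
          then have "wt r f \<alpha> * wt r g \<beta> \<le> e / 2 / M' * M'"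
            using M' e by (intro mult_mono) (auto simp: A_def)
          then show ?thesis using M' by simp
        next
          assume "\<beta> \<notin> B"
          then have "wt r f \<alpha> * wt r g \<beta> \<le> M * (e / 2 / M)"
            using M e by (intro mult_mono) (auto simp: B_def)
          then show ?thesis using M by simp
        qed
      qed (use e in auto)
      then show False using \<gamma> e by simp
    qed
    have "finite A" "finite B"
      unfolding A_def B_def using tate_finite[OF f] tate_finite[OF g] e M(1) M'(1) by simp_all
    then have "finite ((\<lambda>(\<alpha>, \<beta>). \<alpha> + \<beta>) ` (A \<times> B))" by simp
    then show ?thesis
    proof (rule finite_subset[rotated], intro subsetI sub)
      fix \<gamma> assume "\<gamma> \<in> {\<gamma>. e \<le> wt r (f * g) \<gamma>}"
      then show "e \<le> wt r (f * g) \<gamma>" by simp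
    qed
  qed
  ultimately show ?thesis by (auto simp: tate_def)
qed

lemma tate_power [simp]: "f \<in> tate m r \<Longrightarrow> f ^ k \<in> tate m r"
  by (induction k) auto

lemma tate_sum: "(\<And>x. x \<in> S \<Longrightarrow> f x \<in> tate m r) \<Longrightarrow> (\<Sum>x\<in>S. f x) \<in> tate m r"
  by (induction S rule: infinite_finite_induct) auto

lemma gn_uminus [simp]: "gn r (- f) = gn r f"
  by (simp add: gn_def)

lemma gn_add: assumes "f \<in> tate m r" "g \<in> tate m r" shows "gn r (f + g) \<le> max (gn r f) (gn r g)"
proof (rule gn_le)
  fix \<gamma> show "wt r (f + g) \<gamma> \<le> max (gn r f) (gn r g)"
    using wt_add[OF r_pos, of f g \<gamma>] wt_le_gn[OF assms(1), of \<gamma>] wt_le_gn[OF assms(2), of \<gamma>] by auto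
qed

lemma gn_diff: "f \<in> tate m r \<Longrightarrow> g \<in> tate m r \<Longrightarrow> gn r (f - g) \<le> max (gn r f) (gn r g)"
  using gn_add[of f m "- g"] by simp

lemma gn_term [simp]: "gn r (term_mps \<alpha> c) = absv c * r ^ deg \<alpha>"
proof (rule antisym)
  show "gn r (term_mps \<alpha> c) \<le> absv c * r ^ deg \<alpha>"
    by (rule gn_le) (auto simp: wt_def coef_term)
  obtain m where "keys \<alpha> \<subseteq> {..<m}" using finite_nat_iff_bounded[of "keys \<alpha>"] by auto
  then show "absv c * r ^ deg \<alpha> \<le> gn r (term_mps \<alpha> c)"
    using wt_le_gn[OF tate_term, of \<alpha> m c \<alpha>] by (simp add: wt_def coef_term)
qed

lemma gn_one [simp]: "gn r 1 = 1"
  using gn_term[of 0 1] by simp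

text \<open>The monomials at which the Gauss norm is attained; for \<open>f = 0\<close> these are all monomials.\<close>
definition peak :: "'a mps \<Rightarrow> mono set" where
  "peak f = {\<gamma>. wt r f \<gamma> = gn r f}"

text \<open>The weight \<open>\<phi>\<close> is a parameter because several are used: the total
  degree detects units, and preparation needs a weight that favours the last variable.\<close>

definition peak_deg :: "(mono \<Rightarrow> nat) \<Rightarrow> 'a mps \<Rightarrow> nat" where
  "peak_deg \<phi> f = Max (\<phi> ` peak f)"

lemma finite_peak: assumes "f \<in> tate m r" "f \<noteq> 0" shows "finite (peak f)"
  by (rule finite_subset[OF _ tate_finite[OF assms(1) gn_pos[OF assms]]]) (simp add: peak_def Collect_mono)

lemma peak_nonempty: "f \<in> tate m r \<Longrightarrow> peak f \<noteq> {}"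
  using gn_attained[of f m] by (auto simp: peak_def)

lemma le_peak_deg: "f \<in> tate m r \<Longrightarrow> f \<noteq> 0 \<Longrightarrow> \<gamma> \<in> peak f \<Longrightarrow> \<phi> \<gamma> \<le> peak_deg \<phi> f"
  unfolding peak_deg_def using finite_peak by (intro Max_ge) auto

lemma peak_deg_attained: assumes "f \<in> tate m r" "f \<noteq> 0" obtains \<gamma> where "\<gamma> \<in> peak f" "\<phi> \<gamma> = peak_deg \<phi> f"
proof -
  have "peak_deg \<phi> f \<in> \<phi> ` peak f"
    unfolding peak_deg_def by (rule Max_in) (use finite_peak[OF assms] peak_nonempty[OF assms(1)] in auto)
  then show ?thesis using that by auto
qed

lemma peak_deg_eqI:
  assumes "f \<in> tate m r" "f \<noteq> 0" "\<gamma> \<in> peak f" "\<phi> \<gamma> = d" "\<And>\<gamma>. \<gamma> \<in> peak f \<Longrightarrow> \<phi> \<gamma> \<le> d"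
  shows "peak_deg \<phi> f = d"
  unfolding peak_deg_def using assms finite_peak[OF assms(1,2)] by (intro Max_eqI) auto

text \<open>The leading term argument. In each factor, among the peaks of maximal
  \<open>\<phi>\<close>, the largest in the linear order of monomials is taken. This order is
  compatible with addition, so the sum of the two splits into a pair of peaks in only one way: one
  summand of the coefficient strictly dominates and nothing cancels.\<close>

lemma mult_peak:
  assumes f: "f \<in> tate m r" "f \<noteq> 0" and g: "g \<in> tate m r" "g \<noteq> 0"
    and \<phi>: "\<And>\<alpha> \<beta>. \<phi> (\<alpha> + \<beta>) = \<phi> \<alpha> + \<phi> \<beta>"
  shows "gn r (f * g) = gn r f * gn r g \<and> f * g \<noteq> 0 \<and> peak_deg \<phi> (f * g) = peak_deg \<phi> f + peak_deg \<phi> g"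
proof -
  define A where "A = {\<alpha> \<in> peak f. \<phi> \<alpha> = peak_deg \<phi> f}"
  define B where "B = {\<alpha> \<in> peak g. \<phi> \<alpha> = peak_deg \<phi> g}"
  have "finite A" "finite B"
    unfolding A_def B_def using finite_peak[OF f] finite_peak[OF g] by simp_all
  have "A \<noteq> {}" unfolding A_def by (rule peak_deg_attained[OF f, of \<phi>]) blast
  have "B \<noteq> {}" unfolding B_def by (rule peak_deg_attained[OF g, of \<phi>]) blast
  define \<gamma> where "\<gamma> = Max A"
  define \<gamma>' where "\<gamma>' = Max B"
  have \<gamma>: "\<gamma> \<in> A" "\<And>\<alpha>. \<alpha> \<in> A \<Longrightarrow> \<alpha> \<le> \<gamma>" and \<gamma>': "\<gamma>' \<in> B" "\<And>\<alpha>. \<alpha> \<in> B \<Longrightarrow> \<alpha> \<le> \<gamma>'"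
    unfolding \<gamma>_def \<gamma>'_def using \<open>finite A\<close> \<open>A \<noteq> {}\<close> \<open>finite B\<close> \<open>B \<noteq> {}\<close> by (auto intro: Max_in)
  have pos: "gn r f > 0" "gn r g > 0" using gn_pos[OF f] gn_pos[OF g] .
  have le: "wt r f \<alpha> * wt r g \<beta> \<le> gn r f * gn r g" for \<alpha> \<beta>
    using wt_le_gn[OF f(1)] wt_le_gn[OF g(1)] pos by (intro mult_mono) auto
  have lt: "wt r f \<alpha> * wt r g \<beta> < gn r f * gn r g" if "\<alpha> \<notin> peak f \<or> \<beta> \<notin> peak g" for \<alpha> \<beta>
  proof -
    have "wt r f \<alpha> < gn r f \<or> wt r g \<beta> < gn r g"
      using that wt_le_gn[OF f(1), of \<alpha>] wt_le_gn[OF g(1), of \<beta>] unfolding peak_def by force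
    then show ?thesis
    proof
      assume "wt r f \<alpha> < gn r f"
      then have "wt r f \<alpha> * gn r g < gn r f * gn r g" using pos by simp
      moreover have "wt r f \<alpha> * wt r g \<beta> \<le> wt r f \<alpha> * gn r g"
        using wt_le_gn[OF g(1), of \<beta>] by (intro mult_left_mono) auto
      ultimately show ?thesis by simp
    next
      assume "wt r g \<beta> < gn r g"
      then have "gn r f * wt r g \<beta> < gn r f * gn r g" using pos by simp
      moreover have "wt r f \<alpha> * wt r g \<beta> \<le> gn r f * wt r g \<beta>"
        using wt_le_gn[OF f(1), of \<alpha>] by (intro mult_right_mono) auto
      ultimately show ?thesis by simp
    qed
  qed
  have uniq: "\<alpha> = \<gamma> \<and> \<beta> = \<gamma>'" if "\<alpha> + \<beta> = \<gamma> + \<gamma>'" "\<alpha> \<in> peak f" "\<beta> \<in> peak g" for \<alpha> \<beta>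
  proof -
    have "\<phi> \<alpha> + \<phi> \<beta> = peak_deg \<phi> f + peak_deg \<phi> g"
      using \<phi>[of \<alpha> \<beta>] \<phi>[of \<gamma> \<gamma>'] that(1) \<gamma>(1) \<gamma>'(1) by (simp add: A_def B_def)
    then have "\<alpha> \<in> A" "\<beta> \<in> B"
      using le_peak_deg[OF f that(2), of \<phi>] le_peak_deg[OF g that(3), of \<phi>] that by (auto simp: A_def B_def)
    then have "\<alpha> \<le> \<gamma>" "\<beta> \<le> \<gamma>'" using \<gamma> \<gamma>' by auto
    then show ?thesis using that(1)
      by (metis add_le_cancel_left add_le_cancel_right add_mono antisym order_refl)
  qed
  let ?s = "\<Sum>(\<alpha>, \<beta>)\<in>dec (\<gamma> + \<gamma>') - {(\<gamma>, \<gamma>')}. coef f \<alpha> * coef g \<beta>"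
  have split: "coef (f * g) (\<gamma> + \<gamma>') = coef f \<gamma> * coef g \<gamma>' + ?s"
    unfolding coef_mult by (subst sum.remove[of _ "(\<gamma>, \<gamma>')"]) auto
  have wt\<gamma>: "wt r f \<gamma> * wt r g \<gamma>' = gn r f * gn r g"
    using \<gamma>(1) \<gamma>'(1) by (simp add: A_def B_def peak_def)
  have "absv ?s < absv (coef f \<gamma> * coef g \<gamma>')"
  proof (rule absv_sum_less)
    fix p assume p: "p \<in> dec (\<gamma> + \<gamma>') - {(\<gamma>, \<gamma>')}"
    obtain \<alpha> \<beta> where [simp]: "p = (\<alpha>, \<beta>)" by (cases p)
    have ab: "\<alpha> + \<beta> = \<gamma> + \<gamma>'" "\<not> (\<alpha> = \<gamma> \<and> \<beta> = \<gamma>')" using p by auto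
    then have "wt r f \<alpha> * wt r g \<beta> < wt r f \<gamma> * wt r g \<gamma>'"
      unfolding wt\<gamma> using uniq by (intro lt) blast
    moreover have "wt r f \<alpha> * wt r g \<beta> = absv (coef f \<alpha> * coef g \<beta>) * r ^ deg (\<gamma> + \<gamma>')"
      by (simp add: wt_def absv_mult ab(1)[symmetric] power_add)
    moreover have "wt r f \<gamma> * wt r g \<gamma>' = absv (coef f \<gamma> * coef g \<gamma>') * r ^ deg (\<gamma> + \<gamma>')"
      by (simp add: wt_def absv_mult power_add)
    ultimately show "absv (case p of (\<alpha>, \<beta>) \<Rightarrow> coef f \<alpha> * coef g \<beta>) < absv (coef f \<gamma> * coef g \<gamma>')"
      by (simp del: deg_add)
  next
    have "wt r f \<gamma> * wt r g \<gamma>' > 0" unfolding wt\<gamma> using pos by simp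
    then show "0 < absv (coef f \<gamma> * coef g \<gamma>')"
      by (auto simp: wt_def)
  qed
  then have "absv (coef (f * g) (\<gamma> + \<gamma>')) = absv (coef f \<gamma> * coef g \<gamma>')"
    unfolding split by (rule absv_add_eq)
  then have at: "wt r (f * g) (\<gamma> + \<gamma>') = gn r f * gn r g"
    unfolding wt\<gamma>[symmetric] by (simp add: wt_def absv_mult power_add)
  have fg: "f * g \<in> tate m r" using f g by simp
  have gn: "gn r (f * g) = gn r f * gn r g"
  proof (rule antisym)
    show "gn r (f * g) \<le> gn r f * gn r g"
      using pos le by (intro gn_le wt_mult_le) auto
    show "gn r f * gn r g \<le> gn r (f * g)" using wt_le_gn[OF fg] at by metis
  qed
  have nz: "f * g \<noteq> 0" using gn pos by force
  moreover have "peak_deg \<phi> (f * g) = peak_deg \<phi> f + peak_deg \<phi> g"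
  proof (rule peak_deg_eqI[OF fg nz])
    show "\<gamma> + \<gamma>' \<in> peak (f * g)" by (simp add: peak_def gn at)
    show "\<phi> (\<gamma> + \<gamma>') = peak_deg \<phi> f + peak_deg \<phi> g" using \<gamma>(1) \<gamma>'(1) by (simp add: A_def B_def \<phi>)
    \<comment> \<open>A monomial with larger \<open>\<phi>\<close> is never a sum of two peaks, so
      each summand of its coefficient falls strictly short of the norm.\<close>
    fix \<xi> assume \<xi>: "\<xi> \<in> peak (f * g)"
    show "\<phi> \<xi> \<le> peak_deg \<phi> f + peak_deg \<phi> g"
    proof (rule ccontr)
      assume contr: "\<not> ?thesis"
      have ltx: "wt r f \<alpha> * wt r g \<beta> < gn r f * gn r g" if ab: "\<alpha> + \<beta> = \<xi>" for \<alpha> \<beta>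
      proof (rule lt, rule ccontr)
        assume "\<not> (\<alpha> \<notin> peak f \<or> \<beta> \<notin> peak g)"
        then have "\<phi> \<alpha> \<le> peak_deg \<phi> f" "\<phi> \<beta> \<le> peak_deg \<phi> g" using le_peak_deg[OF f] le_peak_deg[OF g] by auto
        then show False using contr \<phi>[of \<alpha> \<beta>] ab by simp
      qed
      have "absv (coef (f * g) \<xi>) < gn r f * gn r g / r ^ deg \<xi>"
        unfolding coef_mult
      proof (rule absv_sum_less)
        fix p assume "p \<in> dec \<xi>"
        then obtain \<alpha> \<beta> where p: "p = (\<alpha>, \<beta>)" "\<alpha> + \<beta> = \<xi>" by (cases p) auto
        from ltx[OF p(2)] p
        show "absv (case p of (\<alpha>, \<beta>) \<Rightarrow> coef f \<alpha> * coef g \<beta>) < gn r f * gn r g / r ^ deg \<xi>"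
          by (auto simp: wt_def absv_mult power_add field_simps)
      qed (use pos in simp)
      then have "wt r (f * g) \<xi> < gn r f * gn r g" by (simp add: wt_def field_simps)
      then show False using \<xi> gn by (simp add: peak_def)
    qed
  qed
  ultimately show ?thesis using gn by blast
qed

lemma gn_mult: assumes "f \<in> tate m r" "g \<in> tate m r" shows "gn r (f * g) = gn r f * gn r g"
  using mult_peak[OF assms(1) _ assms(2), of "\<lambda>_. 0"] by (cases "f = 0"; cases "g = 0") auto

lemma tate_mult_nonzero: "f \<in> tate m r \<Longrightarrow> f \<noteq> 0 \<Longrightarrow> g \<in> tate m r \<Longrightarrow> g \<noteq> 0 \<Longrightarrow> f * g \<noteq> 0"
  using mult_peak[of f m g "\<lambda>_. 0"] by simp

lemma peak_deg_mult:
  assumes "f \<in> tate m r" "f \<noteq> 0" "g \<in> tate m r" "g \<noteq> 0" "\<And>\<alpha> \<beta>. \<phi> (\<alpha> + \<beta>) = \<phi> \<alpha> + \<phi> \<beta>"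
  shows "peak_deg \<phi> (f * g) = peak_deg \<phi> f + peak_deg \<phi> g"
  using mult_peak[OF assms] by blast

lemma gn_cst_mult: "gn r (cst c * f) = absv c * gn r f" if "f \<in> tate m r"
  using gn_mult[OF tate_cst that, of c] by simp

end

subsection \<open>Completeness and units\<close>

definition divides_in :: "'b::comm_ring_1 set \<Rightarrow> 'b \<Rightarrow> 'b \<Rightarrow> bool" where
  "divides_in A a b \<longleftrightarrow> (\<exists>c\<in>A. b = a * c)"

definition unit_in :: "'b::comm_ring_1 set \<Rightarrow> 'b \<Rightarrow> bool" where
  "unit_in A u \<longleftrightarrow> u \<in> A \<and> divides_in A u 1"

definition irred_in :: "'b::comm_ring_1 set \<Rightarrow> 'b \<Rightarrow> bool" where
  "irred_in A p \<longleftrightarrow> p \<in> A \<and> p \<noteq> 0 \<and> \<not> unit_in A p \<and>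
     (\<forall>a\<in>A. \<forall>b\<in>A. p = a * b \<longrightarrow> unit_in A a \<or> unit_in A b)"

definition prime_in :: "'b::comm_ring_1 set \<Rightarrow> 'b \<Rightarrow> bool" where
  "prime_in A p \<longleftrightarrow> p \<in> A \<and> p \<noteq> 0 \<and> \<not> unit_in A p \<and>
     (\<forall>a\<in>A. \<forall>b\<in>A. divides_in A p (a * b) \<longrightarrow> divides_in A p a \<or> divides_in A p b)"

lemma divides_in_mono: "A \<subseteq> B \<Longrightarrow> divides_in A a b \<Longrightarrow> divides_in B a b"
  by (auto simp: divides_in_def)

lemma unit_in_mono: "A \<subseteq> B \<Longrightarrow> unit_in A a \<Longrightarrow> unit_in B a"
  by (auto simp: unit_in_def divides_in_def)

text \<open>Divisibility is relative to a subset of the type, since Tate algebras for different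
  radii and numbers of variables are compared inside one ring, often two of them in one proof. An
  additive degree that vanishes exactly on units is what makes factorization terminate.\<close>

locale graded_domain =
  fixes A :: "'b::comm_ring_1 set" and \<delta> :: "'b \<Rightarrow> nat"
  assumes one_mem [simp]: "1 \<in> A"
    and diff_mem [simp]: "a \<in> A \<Longrightarrow> b \<in> A \<Longrightarrow> a - b \<in> A"
    and mult_mem [simp]: "a \<in> A \<Longrightarrow> b \<in> A \<Longrightarrow> a * b \<in> A"
    and mult_nonzero: "a \<in> A \<Longrightarrow> b \<in> A \<Longrightarrow> a \<noteq> 0 \<Longrightarrow> b \<noteq> 0 \<Longrightarrow> a * b \<noteq> 0"
    and \<delta>_mult: "a \<in> A \<Longrightarrow> b \<in> A \<Longrightarrow> a \<noteq> 0 \<Longrightarrow> b \<noteq> 0 \<Longrightarrow> \<delta> (a * b) = \<delta> a + \<delta> b"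
    and \<delta>_eq_0: "a \<in> A \<Longrightarrow> a \<noteq> 0 \<Longrightarrow> \<delta> a = 0 \<longleftrightarrow> unit_in A a"
begin

lemma cancel: "a \<in> A \<Longrightarrow> b \<in> A \<Longrightarrow> c \<in> A \<Longrightarrow> a \<noteq> 0 \<Longrightarrow> a * b = a * c \<Longrightarrow> b = c"
  using mult_nonzero[of a "b - c"] by (auto simp: algebra_simps)

lemma divides_refl [simp]: "divides_in A a a"
  unfolding divides_in_def by (rule bexI[of _ 1]) auto

lemma divides_trans: "divides_in A a b \<Longrightarrow> divides_in A b c \<Longrightarrow> divides_in A a c"
  unfolding divides_in_def by (metis mult.assoc mult_mem)

lemma divides_mult_right: "divides_in A a b \<Longrightarrow> c \<in> A \<Longrightarrow> divides_in A a (b * c)"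
  unfolding divides_in_def by (metis mult.assoc mult_mem)

lemma divides_mult_left: "divides_in A a b \<Longrightarrow> c \<in> A \<Longrightarrow> divides_in A a (c * b)"
  using divides_mult_right[of a b c] by (simp add: mult.commute)

lemma unit_divides: "unit_in A u \<Longrightarrow> a \<in> A \<Longrightarrow> divides_in A u a"
  using divides_mult_right[of u 1 a] by (simp add: unit_in_def)

lemma unit_nonzero: "unit_in A u \<Longrightarrow> u \<noteq> 0"
  by (auto simp: unit_in_def divides_in_def)

lemma divides_unit: "a \<in> A \<Longrightarrow> divides_in A a u \<Longrightarrow> unit_in A u \<Longrightarrow> unit_in A a"
  using divides_trans by (auto simp: unit_in_def)

lemma irred_divisor_exists:
  "a \<in> A \<Longrightarrow> a \<noteq> 0 \<Longrightarrow> \<not> unit_in A a \<Longrightarrow> \<exists>p. irred_in A p \<and> divides_in A p a"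
proof (induction "\<delta> a" arbitrary: a rule: less_induct)
  case less
  show ?case
  proof (cases "irred_in A a")
    case False
    then obtain b c where bc: "b \<in> A" "c \<in> A" "a = b * c" "\<not> unit_in A b" "\<not> unit_in A c"
      using less.prems by (auto simp: irred_in_def)
    then have nz: "b \<noteq> 0" "c \<noteq> 0" using less.prems by auto
    have "\<delta> b < \<delta> a" using \<delta>_mult[OF bc(1,2) nz] \<delta>_eq_0[OF bc(2) nz(2)] bc by simp
    then obtain p where "irred_in A p" "divides_in A p b" using less.hyps bc nz by blast
    then show ?thesis using bc divides_mult_right by blast
  qed (use divides_refl in blast)
qed

text \<open>Existence of factorizations in the form in which it is used: splitting off an
  irreducible factor lowers \<open>\<delta>\<close>, so properties can be proved from units by
  multiplying with irreducibles.\<close>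

lemma factor_induct [consumes 2, case_names unit irred]:
  assumes "a \<in> A" "a \<noteq> 0"
    and unit: "\<And>u. unit_in A u \<Longrightarrow> P u"
    and irred: "\<And>p c. irred_in A p \<Longrightarrow> c \<in> A \<Longrightarrow> c \<noteq> 0 \<Longrightarrow> P c \<Longrightarrow> P (p * c)"
  shows "P a"
  using assms(1,2)
proof (induction "\<delta> a" arbitrary: a rule: less_induct)
  case less
  show ?case
  proof (cases "unit_in A a")
    case False
    then obtain p c where p: "irred_in A p" and c: "c \<in> A" "a = p * c"
      using irred_divisor_exists[OF less.prems] by (auto simp: divides_in_def)
    then have nz: "p \<in> A" "p \<noteq> 0" "c \<noteq> 0" using less.prems by (auto simp: irred_in_def)
    have "\<delta> c < \<delta> a"
      using \<delta>_mult[of p c] \<delta>_eq_0[of p] nz c p by (simp add: irred_in_def)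
    then show ?thesis using less.hyps c nz irred[OF p] by blast
  qed (use unit in blast)
qed

lemma prime_imp_irred: assumes "prime_in A p" shows "irred_in A p"
proof -
  have p: "p \<in> A" "p \<noteq> 0" "\<not> unit_in A p" using assms by (auto simp: prime_in_def)
  have aux: "unit_in A b" if ab: "a \<in> A" "b \<in> A" "p = a * b" "divides_in A p a" for a b
  proof -
    obtain c where c: "c \<in> A" "a = p * c" using ab(4) by (auto simp: divides_in_def)
    have "p * 1 = p * c * b" using ab(3) c(2) by simp
    then have "p * 1 = p * (b * c)" by (simp add: ac_simps)
    then have "1 = b * c" using p(1,2) ab(2) c(1) by (intro cancel[of p 1 "b * c"]) simp_all
    then show ?thesis unfolding unit_in_def divides_in_def using ab(2) c(1) by blast
  qed
  have "unit_in A a \<or> unit_in A b" if ab: "a \<in> A" "b \<in> A" "p = a * b" for a b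
  proof -
    have "divides_in A p (a * b)" using ab(3) divides_refl by simp
    then have "divides_in A p a \<or> divides_in A p b" using assms ab by (auto simp: prime_in_def)
    then show ?thesis using aux[OF ab] aux[of b a] ab by (auto simp: mult.commute)
  qed
  then show ?thesis using p by (auto simp: irred_in_def)
qed

end

section \<open>Limits of sequences of series\<close>

context nonarch
begin

text \<open>Coefficientwise convergence mentions no radius, so in the gluing argument a single limit
  serves every polydisc. Closeness in the Gauss norm is recovered by
  \<open>coef_lim_tate\<close>.\<close>

definition coef_lim :: "(nat \<Rightarrow> 'a mps) \<Rightarrow> 'a mps \<Rightarrow> bool" where
  "coef_lim S L \<longleftrightarrow> (\<forall>\<gamma>. \<forall>e>0. \<exists>N. \<forall>k\<ge>N. absv (coef (S k) \<gamma> - coef L \<gamma>) < e)"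

lemma coef_lim_shift: "coef_lim S L \<Longrightarrow> coef_lim (\<lambda>k. S (n + k)) L"
  unfolding coef_lim_def by (meson trans_le_add2)

lemma coef_lim_zero:
  assumes "coef_lim S L" "\<And>k. coef (S k) \<gamma> = 0" shows "coef L \<gamma> = 0"
proof (rule ccontr)
  assume "coef L \<gamma> \<noteq> 0"
  then obtain N where "\<forall>k\<ge>N. absv (coef (S k) \<gamma> - coef L \<gamma>) < absv (coef L \<gamma>)"
    using assms(1) unfolding coef_lim_def by (meson absv_pos)
  then show False using assms(2) by auto
qed

end

context nonarch_disc
begin

text \<open>By the ultrametric inequality a difference of distant members is as small as the largest
  consecutive difference in between. A null sequence b thus suffices where an archimedean norm would
  ask for a summable one.\<close>

lemma cauchy_diff:
  assumes S: "\<And>k. S k \<in> tate m r" and b: "\<And>k. gn r (S (Suc k) - S k) \<le> b k" "decseq b"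
  shows "k \<le> j \<Longrightarrow> gn r (S j - S k) \<le> b k"
proof (induction j rule: dec_induct)
  case base
  show ?case using b(1)[of k] gn_nonneg[of "S (Suc k) - S k" m] S by simp
next
  case (step j)
  have "gn r (S (Suc j) - S k) \<le> max (gn r (S (Suc j) - S j)) (gn r (S j - S k))"
    using gn_add[of "S (Suc j) - S j" m "S j - S k"] S by simp
  also have "\<dots> \<le> b k"
    using b(1)[of j] step decseqD[OF b(2), of k j] by simp
  finally show ?case .
qed

lemma coef_lim_exists:
  assumes S: "\<And>k. S k \<in> tate m r" and b: "\<And>k. gn r (S (Suc k) - S k) \<le> b k" "decseq b" "b \<longlonglongrightarrow> 0"
  shows "\<exists>L. coef_lim S L"
proof -
  have "\<exists>L. \<forall>e>0. \<exists>N. \<forall>k\<ge>N. absv (coef (S k) \<gamma> - L) < e" for \<gamma>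
  proof -
    have "\<exists>N. \<forall>n\<ge>N. \<forall>p\<ge>N. absv (coef (S n) \<gamma> - coef (S p) \<gamma>) < e" if e: "e > 0" for e
    proof -
      obtain N where N: "b N < e * r ^ deg \<gamma>"
        using order_tendstoD(2)[OF b(3), of "e * r ^ deg \<gamma>"] e by (auto simp: eventually_sequentially)
      have near: "absv (coef (S n) \<gamma> - coef (S N) \<gamma>) < e" if "n \<ge> N" for n
      proof -
        have "wt r (S n - S N) \<gamma> \<le> b N"
          using wt_le_gn[of "S n - S N" m \<gamma>] cauchy_diff[OF S b(1,2) that] S by simp
        then have "absv (coef (S n) \<gamma> - coef (S N) \<gamma>) * r ^ deg \<gamma> < e * r ^ deg \<gamma>"
          using N unfolding wt_def coef_diff by linarith
        then show ?thesis by simp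
      qed
      have "absv (coef (S n) \<gamma> - coef (S p) \<gamma>) < e" if "n \<ge> N" "p \<ge> N" for n p
        using absv_diff[of "coef (S n) \<gamma> - coef (S N) \<gamma>" "coef (S p) \<gamma> - coef (S N) \<gamma>"]
          near[OF that(1)] near[OF that(2)] by simp
      then show ?thesis by blast
    qed
    moreover have "complete_abs absv" using nonarch_field by (simp add: nonarch_field_def)
    ultimately show ?thesis
      unfolding complete_abs_def by (elim allE[where x = "\<lambda>k. coef (S k) \<gamma>"]) blast
  qed
  then obtain L where "\<And>\<gamma>. \<forall>e>0. \<exists>N. \<forall>k\<ge>N. absv (coef (S k) \<gamma> - L \<gamma>) < e" by metis
  then have "coef_lim S (mps L)" by (simp add: coef_lim_def)
  then show ?thesis by blast
qed

lemma coef_lim_tate: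
  assumes S: "\<And>k. S k \<in> tate m r" and b: "\<And>k. gn r (S (Suc k) - S k) \<le> b k" "decseq b" "b \<longlonglongrightarrow> 0"
    and L: "coef_lim S L"
  shows "L \<in> tate m r" "gn r (L - S k) \<le> b k"
proof -
  have le: "wt r (L - S k) \<gamma> \<le> b k" for k \<gamma>
  proof (rule ccontr)
    assume neg: "\<not> ?thesis"
    have bk: "0 \<le> b k" using cauchy_diff[OF S b(1,2), of k k] gn_nonneg[of "S k - S k" m] by simp
    let ?e = "absv (coef L \<gamma> - coef (S k) \<gamma>)"
    have "?e > 0" using neg bk by (auto simp: wt_def)
    then obtain N where N: "\<And>j. j \<ge> N \<Longrightarrow> absv (coef (S j) \<gamma> - coef L \<gamma>) < ?e"
      using L unfolding coef_lim_def by meson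
    let ?j = "max N k"
    \<comment> \<open>Far out, the coefficient of \<open>S ?j\<close> is closer to the limit than
      that of \<open>S k\<close> is, so both have the same distance to the coefficient of
      \<open>S k\<close>.\<close>
    have "absv (coef (S ?j) \<gamma> - coef (S k) \<gamma>) = ?e"
      using absv_add_eq[of "coef (S ?j) \<gamma> - coef L \<gamma>" "coef L \<gamma> - coef (S k) \<gamma>"] N[of ?j] by simp
    then have "wt r (S ?j - S k) \<gamma> = wt r (L - S k) \<gamma>" by (simp add: wt_def)
    then show False
      using neg wt_le_gn[of "S ?j - S k" m \<gamma>] cauchy_diff[OF S b(1,2), of k ?j] S by simp
  qed
  then show "gn r (L - S k) \<le> b k" by (rule gn_le)
  have "keys \<gamma> \<subseteq> {..<m}" if "coef L \<gamma> \<noteq> 0" for \<gamma>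
    using coef_lim_zero[OF L, of \<gamma>] that tate_keys[OF S] by blast
  moreover have "finite {\<gamma>. e \<le> wt r L \<gamma>}" if e: "e > 0" for e
  proof -
    \<comment> \<open>Since L differs from \<open>S k\<close> by less than e, a weight of L that
      reaches e forces the same for \<open>S k\<close>, which happens only finitely often.\<close>
    obtain k where k: "b k < e"
      using order_tendstoD(2)[OF b(3) e] by (auto simp: eventually_sequentially)
    have "e \<le> wt r (S k) \<gamma>" if "e \<le> wt r L \<gamma>" for \<gamma>
      using that wt_add[OF r_pos, of "L - S k" "S k" \<gamma>] le[of k \<gamma>] k by simp
    then have "{\<gamma>. e \<le> wt r L \<gamma>} \<subseteq> {\<gamma>. e \<le> wt r (S k) \<gamma>}" by (rule Collect_mono[OF impI])
    then show ?thesis using tate_finite[OF S e] finite_subset by blast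
  qed
  ultimately show "L \<in> tate m r" by (simp add: tate_def)
qed

text \<open>Successive approximation: dividing the error again shrinks it by
  \<open>\<epsilon>\<close> each time, so quotients and remainders sum up to convergent series. Z is
  the set of monomials forbidden in the remainder: all of them for inverting a series, those with
  exponent at least d in the last variable for Weierstrass division.\<close>

lemma approx_division_imp_division:
  assumes f: "f \<in> tate m r" and \<epsilon>: "0 \<le> \<epsilon>" "\<epsilon> < 1" and C: "0 \<le> C"
    and approx: "\<And>g. g \<in> tate m r \<Longrightarrow> \<exists>q\<in>tate m r. \<exists>s\<in>tate m r. (\<forall>\<gamma>\<in>Z. coef s \<gamma> = 0) \<and>
        gn r q \<le> C * gn r g \<and> gn r s \<le> gn r g \<and> gn r (g - q * f - s) \<le> \<epsilon> * gn r g"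
    and g: "g \<in> tate m r"
  shows "\<exists>q\<in>tate m r. \<exists>s\<in>tate m r. (\<forall>\<gamma>\<in>Z. coef s \<gamma> = 0) \<and> gn r s \<le> gn r g \<and> g = q * f + s"
proof -
  obtain Q R where QR: "\<And>g. g \<in> tate m r \<Longrightarrow> Q g \<in> tate m r \<and> R g \<in> tate m r \<and> (\<forall>\<gamma>\<in>Z. coef (R g) \<gamma> = 0) \<and>
        gn r (Q g) \<le> C * gn r g \<and> gn r (R g) \<le> gn r g \<and> gn r (g - Q g * f - R g) \<le> \<epsilon> * gn r g"
    using approx by metis
  define G where "G = rec_nat g (\<lambda>_ h. h - Q h * f - R h)"
  have G0: "G 0 = g" and GS: "G (Suc k) = G k - Q (G k) * f - R (G k)" for k
    by (simp_all add: G_def)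
  have GT: "G k \<in> tate m r" for k
    by (induction k) (use g f QR in \<open>auto simp: G0 GS\<close>)
  have Gn: "gn r (G k) \<le> \<epsilon> ^ k * gn r g" for k
  proof (induction k)
    case (Suc k)
    have "gn r (G (Suc k)) \<le> \<epsilon> * gn r (G k)" using QR[OF GT[of k]] by (simp add: GS)
    also have "\<dots> \<le> \<epsilon> * (\<epsilon> ^ k * gn r g)" using Suc \<epsilon> by (intro mult_left_mono) auto
    finally show ?case by (simp add: mult.assoc)
  qed (simp add: G0)
  define SQ where "SQ k = (\<Sum>i<k. Q (G i))" for k
  define SR where "SR k = (\<Sum>i<k. R (G i))" for k
  have SQT: "SQ k \<in> tate m r" and SRT: "SR k \<in> tate m r" for k
    unfolding SQ_def SR_def using QR[OF GT] by (auto intro!: tate_sum)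
  have G_eq: "G k = g - SQ k * f - SR k" for k
    by (induction k) (auto simp: G0 GS SQ_def SR_def algebra_simps)
  have gn0: "0 \<le> gn r g" using gn_nonneg[OF g] .
  define b where "b k = \<epsilon> ^ k * gn r g" for k
  have b: "decseq b" "b \<longlonglongrightarrow> 0"
  proof -
    show "decseq b" unfolding b_def decseq_Suc_iff
      using \<epsilon> gn0 by (auto intro!: mult_right_mono mult_left_le_one_le)
    show "b \<longlonglongrightarrow> 0" unfolding b_def
      using tendsto_mult[OF LIMSEQ_power_zero[of \<epsilon>] tendsto_const[of "gn r g"]] \<epsilon> by simp
  qed
  define c where "c k = C * b k" for k
  have c: "decseq c" "c \<longlonglongrightarrow> 0"
  proof -
    show "decseq c" using b(1) C unfolding c_def decseq_def by (auto intro: mult_left_mono)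
    show "c \<longlonglongrightarrow> 0" unfolding c_def
      using tendsto_mult[OF tendsto_const[of C] b(2)] by simp
  qed
  have dQ: "gn r (SQ (Suc k) - SQ k) \<le> c k" for k
  proof -
    have "gn r (Q (G k)) \<le> C * gn r (G k)" using QR[OF GT[of k]] by blast
    also have "\<dots> \<le> c k" unfolding c_def b_def using Gn[of k] C by (intro mult_left_mono) auto
    finally show ?thesis by (simp add: SQ_def)
  qed
  have dR: "gn r (SR (Suc k) - SR k) \<le> b k" for k
  proof -
    have "gn r (R (G k)) \<le> gn r (G k)" using QR[OF GT[of k]] by blast
    also have "\<dots> \<le> b k" unfolding b_def by (rule Gn)
    finally show ?thesis by (simp add: SR_def)
  qed
  obtain q where q: "coef_lim SQ q" using coef_lim_exists[of SQ, OF SQT dQ c] by blast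
  obtain s where s: "coef_lim SR s" using coef_lim_exists[of SR, OF SRT dR b] by blast
  have qT: "q \<in> tate m r" and qn: "gn r (q - SQ k) \<le> c k" for k
    using coef_lim_tate[of SQ, OF SQT dQ c q] by auto
  have sT: "s \<in> tate m r" and sn: "gn r (s - SR k) \<le> b k" for k
    using coef_lim_tate[of SR, OF SRT dR b s] by auto
  have Z: "coef s \<gamma> = 0" if "\<gamma> \<in> Z" for \<gamma>
    by (rule coef_lim_zero[OF s]) (use QR[OF GT] that in \<open>simp add: SR_def coef_sum\<close>)
  have sle: "gn r s \<le> gn r g" using sn[of 0] by (simp add: SR_def b_def)
  have eT: "g - q * f - s \<in> tate m r" using g f qT sT by simp
  \<comment> \<open>After k rounds the error is of size \<open>b k\<close>; the factor in front
    absorbs the contribution of \<open>(q - SQ k) * f\<close>. The left side does not depend on k,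
    so it vanishes.\<close>
  have bound: "gn r (g - q * f - s) \<le> (1 + C * gn r f) * b k" for k
  proof -
    have gf: "0 \<le> gn r f" using gn_nonneg[OF f] .
    have bk: "0 \<le> b k" unfolding b_def using \<epsilon> gn0 by simp
    have e: "g - q * f - s = (G k - (q - SQ k) * f) - (s - SR k)" by (simp add: G_eq algebra_simps)
    have "gn r (g - q * f - s) \<le> max (gn r (G k - (q - SQ k) * f)) (gn r (s - SR k))"
      unfolding e using GT SQT SRT f qT sT by (intro gn_diff[of _ m]) simp_all
    moreover have "gn r (G k - (q - SQ k) * f) \<le> max (gn r (G k)) (gn r (q - SQ k) * gn r f)"
      using gn_diff[of "G k" m "(q - SQ k) * f"] gn_mult[of "q - SQ k" m f] GT SQT f qT by simp
    moreover have "gn r (q - SQ k) * gn r f \<le> (1 + C * gn r f) * b k"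
    proof -
      have "gn r (q - SQ k) * gn r f \<le> c k * gn r f" using qn[of k] gf by (rule mult_right_mono)
      also have "\<dots> \<le> (1 + C * gn r f) * b k" unfolding c_def using bk by (simp add: algebra_simps)
      finally show ?thesis .
    qed
    moreover have "gn r (G k) \<le> (1 + C * gn r f) * b k"
      using Gn[of k] mult_nonneg_nonneg[OF mult_nonneg_nonneg[OF C gf] bk] unfolding b_def[symmetric]
      by (simp add: algebra_simps)
    moreover have "gn r (s - SR k) \<le> (1 + C * gn r f) * b k"
      using sn[of k] mult_nonneg_nonneg[OF mult_nonneg_nonneg[OF C gf] bk] by (simp add: algebra_simps)
    ultimately show ?thesis by linarith
  qed
  have "(\<lambda>k. (1 + C * gn r f) * b k) \<longlonglongrightarrow> 0"
    using tendsto_mult[OF tendsto_const[of "1 + C * gn r f"] b(2)] by simp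
  then have "gn r (g - q * f - s) \<le> 0"
    by (rule LIMSEQ_le_const) (use bound in blast)
  then have "g - q * f - s = 0" using gn_nonneg[OF eT] gn_eq_0_iff[OF eT] by simp
  then have "g = q * f + s" by (simp add: algebra_simps)
  then show ?thesis using qT sT Z sle by blast
qed

section \<open>Units of the Tate algebra\<close>

abbreviation \<delta> :: "'a mps \<Rightarrow> nat" where
  "\<delta> \<equiv> peak_deg deg"

lemma \<delta>_eq_0_iff: assumes "f \<in> tate m r" "f \<noteq> 0" shows "\<delta> f = 0 \<longleftrightarrow> (\<forall>\<gamma>. \<gamma> \<noteq> 0 \<longrightarrow> wt r f \<gamma> < gn r f)"
proof
  assume 0: "\<delta> f = 0"
  have "\<gamma> \<notin> peak f" if "\<gamma> \<noteq> 0" for \<gamma>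
    using le_peak_deg[OF assms, of \<gamma> deg] 0 that by auto
  then show "\<forall>\<gamma>. \<gamma> \<noteq> 0 \<longrightarrow> wt r f \<gamma> < gn r f"
    using wt_le_gn[OF assms(1)] by (auto simp: peak_def less_le)
next
  assume lt: "\<forall>\<gamma>. \<gamma> \<noteq> 0 \<longrightarrow> wt r f \<gamma> < gn r f"
  obtain \<gamma> where \<gamma>: "\<gamma> \<in> peak f" "deg \<gamma> = \<delta> f" using peak_deg_attained[OF assms] by blast
  then have "\<gamma> = 0" using lt by (force simp: peak_def)
  then show "\<delta> f = 0" using \<gamma> by simp
qed

text \<open>Division of 1 by f with no monomial allowed in the remainder. The approximate quotient
  of g is \<open>g / c\<close> for the constant term c of f; its relative error is the norm of
  \<open>f - cst c\<close> over \<open>absv c\<close>, which is below 1.\<close>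

lemma dominant_const_unit:
  assumes f: "f \<in> tate m r" and f0: "coef f 0 \<noteq> 0" and lt: "\<And>\<gamma>. \<gamma> \<noteq> 0 \<Longrightarrow> wt r f \<gamma> < absv (coef f 0)"
  shows "unit_in (tate m r) f"
proof -
  define c where "c = coef f 0"
  define h where "h = f - cst c"
  have hT: "h \<in> tate m r" using f by (simp add: h_def)
  have c: "absv c > 0" using f0 by (simp add: c_def)
  have "gn r h < absv c"
  proof (rule gn_less[OF hT])
    fix \<gamma> show "wt r h \<gamma> < absv c"
      using lt[of \<gamma>] f0 by (cases "\<gamma> = 0") (auto simp: h_def wt_def coef_term c_def)
  qed
  define \<epsilon> where "\<epsilon> = gn r h / absv c"
  have \<epsilon>: "0 \<le> \<epsilon>" "\<epsilon> < 1" using \<open>gn r h < absv c\<close> c gn_nonneg[OF hT] by (auto simp: \<epsilon>_def)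
  have "\<exists>q\<in>tate m r. \<exists>s\<in>tate m r. (\<forall>\<gamma>\<in>UNIV. coef s \<gamma> = 0) \<and> gn r s \<le> gn r 1 \<and> 1 = q * f + s"
  proof (rule approx_division_imp_division[OF f \<epsilon>, of "1 / absv c"])
    fix g assume g: "g \<in> tate m r"
    let ?q = "cst (1 / c) * g"
    have q: "?q \<in> tate m r" using g by simp
    have e: "g - ?q * f - 0 = - (?q * h)"
    proof -
      have "?q * cst c = cst (1 / c) * cst c * g" by (simp only: ac_simps)
      also have "\<dots> = g" using c by (simp add: cst_mult)
      finally show ?thesis by (simp add: h_def right_diff_distrib)
    qed
    have qn: "gn r ?q = 1 / absv c * gn r g"
      using gn_cst_mult[OF g, of "1 / c"] absv_inverse[of c] by (simp add: inverse_eq_divide)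
    have "gn r (g - ?q * f - 0) = \<epsilon> * gn r g"
      unfolding e gn_uminus gn_mult[OF q hT] qn by (simp add: \<epsilon>_def)
    then show "\<exists>q\<in>tate m r. \<exists>s\<in>tate m r. (\<forall>\<gamma>\<in>UNIV. coef s \<gamma> = 0) \<and>
        gn r q \<le> 1 / absv c * gn r g \<and> gn r s \<le> gn r g \<and> gn r (g - q * f - s) \<le> \<epsilon> * gn r g"
      using q qn gn_nonneg[OF g] by (intro bexI[of _ ?q] bexI[of _ 0]) auto
  qed (use c in auto)
  then obtain q s where "q \<in> tate m r" "\<forall>\<gamma>. coef s \<gamma> = 0" "1 = q * f + s" by blast
  moreover from this have "s = 0" by (intro mps_eqI) simp
  ultimately have "q \<in> tate m r" "1 = f * q" by (simp_all add: mult.commute)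
  then show ?thesis unfolding unit_in_def divides_in_def using f by blast
qed

text \<open>Degree 0 means that the constant term strictly dominates, which makes f invertible.
  Conversely \<open>\<delta>\<close> is additive and vanishes at 1.\<close>

lemma unit_iff_\<delta>: assumes "f \<in> tate m r" "f \<noteq> 0" shows "\<delta> f = 0 \<longleftrightarrow> unit_in (tate m r) f"
proof
  assume 0: "\<delta> f = 0"
  then have lt: "wt r f \<gamma> < gn r f" if "\<gamma> \<noteq> 0" for \<gamma> using \<delta>_eq_0_iff[OF assms] that by blast
  obtain \<gamma> where "wt r f \<gamma> = gn r f" using gn_attained[OF assms(1)] .
  then have g: "absv (coef f 0) = gn r f" using lt[of \<gamma>] by (cases "\<gamma> = 0") (auto simp: wt_def)
  then have "absv (coef f 0) > 0" using gn_pos[OF assms] by linarith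
  then show "unit_in (tate m r) f"
    using lt g by (intro dominant_const_unit assms(1)) auto
next
  assume "unit_in (tate m r) f"
  then obtain g where g: "g \<in> tate m r" "1 = f * g" by (auto simp: unit_in_def divides_in_def)
  then have "g \<noteq> 0" by auto
  then have "\<delta> (f * g) = \<delta> f + \<delta> g" using assms g by (intro peak_deg_mult) auto
  moreover have "\<delta> 1 = 0"
  proof -
    have "\<forall>\<gamma>. \<gamma> \<noteq> 0 \<longrightarrow> wt r 1 \<gamma> < gn r 1" by (simp add: wt_def coef_one)
    then show ?thesis using \<delta>_eq_0_iff[OF tate_one] by simp
  qed
  ultimately show "\<delta> f = 0" using g by simp
qed

lemma unit_dominant_const:
  assumes "unit_in (tate m r) u"
  shows "coef u 0 \<noteq> 0" "gn r u = absv (coef u 0)" "\<gamma> \<noteq> 0 \<Longrightarrow> wt r u \<gamma> < absv (coef u 0)"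
proof -
  have u: "u \<in> tate m r" "u \<noteq> 0" using assms by (auto simp: unit_in_def divides_in_def)
  have lt: "wt r u \<gamma> < gn r u" if "\<gamma> \<noteq> 0" for \<gamma>
    using \<delta>_eq_0_iff[OF u] unit_iff_\<delta>[OF u] assms that by simp
  obtain \<beta> where "wt r u \<beta> = gn r u" using gn_attained[OF u(1)] .
  then show g: "gn r u = absv (coef u 0)" using lt[of \<beta>] by (cases "\<beta> = 0") (auto simp: wt_def)
  then show "coef u 0 \<noteq> 0" using gn_pos[OF u] by auto
  show "\<gamma> \<noteq> 0 \<Longrightarrow> wt r u \<gamma> < absv (coef u 0)" using lt g by simp
qed

lemma graded_domain_tate: "graded_domain (tate m r) \<delta>"
  by unfold_locales (auto simp: tate_mult_nonzero peak_deg_mult unit_iff_\<delta>)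

end

subsection \<open>Coefficients with respect to the last variable\<close>

text \<open>The coefficient of \<open>z_n^j\<close> when f is read as a power series in
  \<open>z_n\<close> over series in the other variables; the test on the exponent makes the result
  free of \<open>z_n\<close>.\<close>

definition slice :: "nat \<Rightarrow> nat \<Rightarrow> 'a::comm_ring_1 mps \<Rightarrow> 'a mps" where
  "slice n j f = mps (\<lambda>\<gamma>. if lookup \<gamma> n = 0 then coef f (\<gamma> + single n j) else 0)"

definition strip :: "nat \<Rightarrow> mono \<Rightarrow> mono" where
  "strip n \<gamma> = \<gamma> - single n (lookup \<gamma> n)"

lemma coef_slice: "coef (slice n j f) \<gamma> = (if lookup \<gamma> n = 0 then coef f (\<gamma> + single n j) else 0)"
  by (simp add: slice_def)

lemma lookup_strip: "lookup (strip n \<gamma>) i = (if i = n then 0 else lookup \<gamma> i)"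
  by (simp add: strip_def lookup_minus lookup_single)

lemma strip_add_single: "strip n \<gamma> + single n (lookup \<gamma> n) = \<gamma>"
  by (rule poly_mapping_eqI) (simp add: lookup_add lookup_strip lookup_single)

lemma strip_single_add: "lookup \<gamma> n = 0 \<Longrightarrow> strip n (\<gamma> + single n j) = \<gamma>"
  by (rule poly_mapping_eqI) (auto simp: lookup_add lookup_strip lookup_single)

lemma lookup_add_single: "lookup (\<gamma> + single n j) n = lookup \<gamma> n + j"
  by (simp add: lookup_add)

lemma coef_eq_coef_slice: "coef f \<gamma> = coef (slice n (lookup \<gamma> n) f) (strip n \<gamma>)"
  by (simp add: coef_slice lookup_strip strip_add_single)

lemma slice_eqI: assumes "\<And>j. slice n j f = slice n j g" shows "f = g"
proof (rule mps_eqI)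
  fix \<gamma> show "coef f \<gamma> = coef g \<gamma>"
    unfolding coef_eq_coef_slice[of f \<gamma> n] coef_eq_coef_slice[of g \<gamma> n] assms ..
qed

lemma slice_zero [simp]: "slice n j 0 = 0"
  and slice_add [simp]: "slice n j (f + g) = slice n j f + slice n j g"
  and slice_diff [simp]: "slice n j (f - g) = slice n j f - slice n j g"
  by (auto intro!: mps_eqI simp: coef_slice)

text \<open>The Cauchy product in the last variable. Where \<open>\<gamma>\<close> does not involve
  that variable, splitting \<open>\<gamma> + single n k\<close> means splitting
  \<open>\<gamma>\<close> and, independently, distributing k.\<close>

lemma slice_mult: "slice n k (f * g) = (\<Sum>j\<le>k. slice n j f * slice n (k - j) g)"
proof (rule mps_eqI)
  fix \<gamma>
  show "coef (slice n k (f * g)) \<gamma> = coef (\<Sum>j\<le>k. slice n j f * slice n (k - j) g) \<gamma>"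
  proof (cases "lookup \<gamma> n = 0")
    case True
    have "coef (\<Sum>j\<le>k. slice n j f * slice n (k - j) g) \<gamma> =
       (\<Sum>j\<le>k. \<Sum>(\<alpha>, \<beta>)\<in>dec \<gamma>. coef f (\<alpha> + single n j) * coef g (\<beta> + single n (k - j)))"
      unfolding coef_sum coef_mult
    proof (intro sum.cong refl)
      fix j p assume "p \<in> dec \<gamma>"
      then obtain \<alpha> \<beta> where p: "p = (\<alpha>, \<beta>)" "\<alpha> + \<beta> = \<gamma>" by (cases p) auto
      then have "lookup \<alpha> n + lookup \<beta> n = 0" using True by (simp flip: lookup_add)
      then show "(case p of (\<alpha>, \<beta>) \<Rightarrow> coef (slice n j f) \<alpha> * coef (slice n (k - j) g) \<beta>) =
          (case p of (\<alpha>, \<beta>) \<Rightarrow> coef f (\<alpha> + single n j) * coef g (\<beta> + single n (k - j)))"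
        using p by (simp add: coef_slice)
    qed
    also have "\<dots> = (\<Sum>(j, (\<alpha>, \<beta>))\<in>{..k} \<times> dec \<gamma>. coef f (\<alpha> + single n j) * coef g (\<beta> + single n (k - j)))"
      by (simp add: sum.cartesian_product case_prod_unfold)
    also have "\<dots> = (\<Sum>(\<alpha>, \<beta>)\<in>dec (\<gamma> + single n k). coef f \<alpha> * coef g \<beta>)"
    proof (rule sum.reindex_bij_witness[where i = "\<lambda>(\<alpha>, \<beta>). (lookup \<alpha> n, (strip n \<alpha>, strip n \<beta>))"
          and j = "\<lambda>(j, (\<alpha>, \<beta>)). (\<alpha> + single n j, \<beta> + single n (k - j))"])
      fix a assume a: "a \<in> {..k} \<times> dec \<gamma>"
      obtain j \<alpha> \<beta> where [simp]: "a = (j, (\<alpha>, \<beta>))" by (cases a) auto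
      have jk: "j \<le> k" and ab: "\<alpha> + \<beta> = \<gamma>" using a by auto
      then have "lookup \<alpha> n + lookup \<beta> n = 0" using True by (simp flip: lookup_add)
      then have l: "lookup \<alpha> n = 0" "lookup \<beta> n = 0" by auto
      show "(case (case a of (j, (\<alpha>, \<beta>)) \<Rightarrow> (\<alpha> + single n j, \<beta> + single n (k - j))) of
              (\<alpha>, \<beta>) \<Rightarrow> (lookup \<alpha> n, (strip n \<alpha>, strip n \<beta>))) = a"
        using l by (simp add: strip_single_add lookup_add_single)
      have "\<alpha> + single n j + (\<beta> + single n (k - j)) = \<gamma> + (single n j + single n (k - j))"
        unfolding ab[symmetric] by (simp only: ac_simps)
      also have "\<dots> = \<gamma> + single n k" using jk by (simp flip: single_add)
      finally show "(case a of (j, (\<alpha>, \<beta>)) \<Rightarrow> (\<alpha> + single n j, \<beta> + single n (k - j))) \<in> dec (\<gamma> + single n k)"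
        by simp
      show "(case (case a of (j, (\<alpha>, \<beta>)) \<Rightarrow> (\<alpha> + single n j, \<beta> + single n (k - j))) of
          (\<alpha>, \<beta>) \<Rightarrow> coef f \<alpha> * coef g \<beta>) =
          (case a of (j, (\<alpha>, \<beta>)) \<Rightarrow> coef f (\<alpha> + single n j) * coef g (\<beta> + single n (k - j)))"
        by simp
    next
      fix b assume b: "b \<in> dec (\<gamma> + single n k)"
      obtain \<alpha> \<beta> where [simp]: "b = (\<alpha>, \<beta>)" by (cases b)
      have ab: "\<alpha> + \<beta> = \<gamma> + single n k" using b by simp
      have l: "lookup \<alpha> n + lookup \<beta> n = k" using True arg_cong[OF ab, of "\<lambda>x. lookup x n"]
        by (simp add: lookup_add)
      have "strip n \<alpha> + strip n \<beta> = \<gamma>"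
      proof (rule poly_mapping_eqI)
        fix i
        show "lookup (strip n \<alpha> + strip n \<beta>) i = lookup \<gamma> i"
          using True arg_cong[OF ab, of "\<lambda>x. lookup x i"]
          by (cases "i = n") (simp_all add: lookup_add lookup_strip lookup_single)
      qed
      then show "(case b of (\<alpha>, \<beta>) \<Rightarrow> (lookup \<alpha> n, (strip n \<alpha>, strip n \<beta>))) \<in> {..k} \<times> dec \<gamma>"
        using l by simp
      have "k - lookup \<alpha> n = lookup \<beta> n" using l by simp
      then show "(case (case b of (\<alpha>, \<beta>) \<Rightarrow> (lookup \<alpha> n, (strip n \<alpha>, strip n \<beta>))) of
          (j, (\<alpha>, \<beta>)) \<Rightarrow> (\<alpha> + single n j, \<beta> + single n (k - j))) = b"
        by (simp add: strip_add_single)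
    qed
    finally show ?thesis using True by (simp add: coef_slice coef_mult)
  next
    case False
    have "coef (slice n j f * slice n (k - j) g) \<gamma> = 0" for j
      unfolding coef_mult
    proof (rule sum.neutral, clarify)
      fix \<alpha> \<beta> assume "(\<alpha>, \<beta>) \<in> dec \<gamma>"
      then have "\<alpha> + \<beta> = \<gamma>" by simp
      then have "lookup \<alpha> n \<noteq> 0 \<or> lookup \<beta> n \<noteq> 0" using False by (auto simp: lookup_add)
      then show "coef (slice n j f) \<alpha> * coef (slice n (k - j) g) \<beta> = 0" by (auto simp: coef_slice)
    qed
    then show ?thesis using False by (simp add: coef_slice coef_sum)
  qed
qed

definition var_pow :: "nat \<Rightarrow> nat \<Rightarrow> 'a::comm_ring_1 mps" where
  "var_pow n j = term_mps (single n j) 1"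

lemma slice_var_pow: "slice n k (var_pow n j) = (if k = j then 1 else 0)"
proof (rule mps_eqI)
  fix \<gamma>
  have "\<gamma> + single n k = single n j \<longleftrightarrow> \<gamma> = 0 \<and> k = j" if l: "lookup \<gamma> n = 0"
  proof
    assume e: "\<gamma> + single n k = single n j"
    have "k = j" using l arg_cong[OF e, of "\<lambda>x. lookup x n"] by (simp add: lookup_add)
    then show "\<gamma> = 0 \<and> k = j" using e by simp
  qed simp
  then show "coef (slice n k (var_pow n j)) \<gamma> = coef (if k = j then 1 else 0 :: 'a mps) \<gamma>"
    by (auto simp: coef_slice var_pow_def coef_term coef_one)
qed

lemma slice_var_pow_mult: "slice n k (var_pow n j * f) = (if j \<le> k then slice n (k - j) f else 0)"
proof -
  have "slice n k (var_pow n j * f) = (\<Sum>i\<le>k. if i = j then slice n (k - i) f else 0)"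
    unfolding slice_mult by (intro sum.cong) (auto simp: slice_var_pow)
  then show ?thesis by simp
qed

text \<open>Leading coefficients in the last variable multiply. The numbers a and b only bound the
  degrees, so the slices at a and b may vanish.\<close>

lemma slice_mult_top:
  assumes "\<And>j. j > a \<Longrightarrow> slice n j f = 0" "\<And>j. j > b \<Longrightarrow> slice n j g = 0"
  shows "slice n (a + b) (f * g) = slice n a f * slice n b g"
    and "k > a + b \<Longrightarrow> slice n k (f * g) = 0"
proof -
  have "slice n (a + b) (f * g) = (\<Sum>j\<in>{a}. slice n j f * slice n (a + b - j) g)"
    unfolding slice_mult
  proof (rule sum.mono_neutral_right)
    show "\<forall>i\<in>{..a + b} - {a}. slice n i f * slice n (a + b - i) g = 0"
    proof
      fix i assume "i \<in> {..a + b} - {a}"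
      then have "i > a \<or> a + b - i > b" by auto
      then show "slice n i f * slice n (a + b - i) g = 0" using assms by auto
    qed
  qed auto
  then show "slice n (a + b) (f * g) = slice n a f * slice n b g" by simp
  assume k: "k > a + b"
  show "slice n k (f * g) = 0"
    unfolding slice_mult
  proof (rule sum.neutral, rule ballI)
    fix i assume "i \<in> {..k}"
    then have "i > a \<or> k - i > b" using k by auto
    then show "slice n i f * slice n (k - i) g = 0" using assms by auto
  qed
qed

context nonarch_disc
begin

lemma coef_tate_eq_0: "f \<in> tate n r \<Longrightarrow> lookup \<gamma> n \<noteq> 0 \<Longrightarrow> coef f \<gamma> = 0"
  using tate_keys[of f n r \<gamma>] in_keys_iff[of n \<gamma>] by fastforce

lemma slice_tate: assumes "f \<in> tate n r" shows "slice n j f = (if j = 0 then f else 0)"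
proof (rule mps_eqI)
  fix \<gamma>
  show "coef (slice n j f) \<gamma> = coef (if j = 0 then f else 0) \<gamma>"
    using coef_tate_eq_0[OF assms, of \<gamma>] coef_tate_eq_0[OF assms, of "\<gamma> + single n j"]
    by (auto simp: coef_slice lookup_add)
qed

lemma slice_one: "slice n j (1 :: 'a mps) = (if j = 0 then 1 else 0)"
  by (rule slice_tate[OF tate_one])

lemma slice_tate_mult: assumes "a \<in> tate n r" shows "slice n k (a * f) = a * slice n k f"
proof -
  have "slice n k (a * f) = (\<Sum>i\<in>{0}. slice n i a * slice n (k - i) f)"
    unfolding slice_mult by (rule sum.mono_neutral_right) (auto simp: slice_tate[OF assms])
  then show ?thesis by (simp add: slice_tate[OF assms])
qed

lemma wt_slice: "wt r (slice n j f) \<gamma> * r ^ j = (if lookup \<gamma> n = 0 then wt r f (\<gamma> + single n j) else 0)"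
  by (simp add: wt_def coef_slice power_add)

lemma wt_eq_wt_slice: "wt r f \<gamma> = wt r (slice n (lookup \<gamma> n) f) (strip n \<gamma>) * r ^ lookup \<gamma> n"
  by (simp add: wt_slice lookup_strip strip_add_single)

lemma slice_mem [simp]: assumes f: "f \<in> tate (Suc n) r" shows "slice n j f \<in> tate n r"
proof -
  have "keys \<gamma> \<subseteq> {..<n}" if nz: "coef (slice n j f) \<gamma> \<noteq> 0" for \<gamma>
  proof
    fix i assume i: "i \<in> keys \<gamma>"
    have l: "lookup \<gamma> n = 0" and "coef f (\<gamma> + single n j) \<noteq> 0"
      using nz by (auto simp: coef_slice split: if_splits)
    then have "keys (\<gamma> + single n j) \<subseteq> {..<Suc n}" using tate_keys[OF f] by blast
    moreover have "i \<in> keys (\<gamma> + single n j)" using i by (simp add: in_keys_iff lookup_add)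
    moreover have "i \<noteq> n" using i l by (auto simp: in_keys_iff)
    ultimately show "i \<in> {..<n}" by auto
  qed
  moreover have "finite {\<gamma>. e \<le> wt r (slice n j f) \<gamma>}" if e: "e > 0" for e
  proof -
    have "(\<lambda>\<gamma>. \<gamma> + single n j) ` {\<gamma>. e \<le> wt r (slice n j f) \<gamma>} \<subseteq> {\<gamma>. e * r ^ j \<le> wt r f \<gamma>}"
    proof (rule image_subsetI)
      fix \<gamma> assume "\<gamma> \<in> {\<gamma>. e \<le> wt r (slice n j f) \<gamma>}"
      then have le: "e \<le> wt r (slice n j f) \<gamma>" by simp
      then have "e * r ^ j \<le> wt r (slice n j f) \<gamma> * r ^ j" by simp
      moreover have "e * r ^ j > 0" using e by simp
      ultimately show "\<gamma> + single n j \<in> {\<gamma>. e * r ^ j \<le> wt r f \<gamma>}"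
        unfolding wt_slice by (auto split: if_splits)
    qed
    moreover have "finite {\<gamma>. e * r ^ j \<le> wt r f \<gamma>}" using tate_finite[OF f] e by simp
    ultimately have "finite ((\<lambda>\<gamma>. \<gamma> + single n j) ` {\<gamma>. e \<le> wt r (slice n j f) \<gamma>})"
      by (rule finite_subset)
    then show ?thesis by (rule finite_imageD) (simp add: inj_on_def)
  qed
  ultimately show ?thesis by (simp add: tate_def)
qed

lemma gn_slice: assumes "f \<in> tate (Suc n) r" shows "gn r (slice n j f) * r ^ j \<le> gn r f"
proof -
  obtain \<gamma> where "wt r (slice n j f) \<gamma> = gn r (slice n j f)" using gn_attained[OF slice_mem[OF assms]] .
  then have "gn r (slice n j f) * r ^ j = (if lookup \<gamma> n = 0 then wt r f (\<gamma> + single n j) else 0)"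
    using wt_slice[of n j f \<gamma>] by simp
  then show ?thesis using wt_le_gn[OF assms] gn_nonneg[OF assms] by auto
qed

text \<open>In a unit the constant term strictly dominates, so no positive power of the last
  variable can carry the norm. In \<open>irred_bezout\<close> this forces a degree to be 0.\<close>

lemma gn_slice_unit_less:
  assumes "unit_in (tate (Suc n) r) u" "j > 0" shows "gn r (slice n j u) * r ^ j < gn r u"
proof -
  have u: "u \<in> tate (Suc n) r" using assms by (simp add: unit_in_def)
  obtain \<gamma> where "wt r (slice n j u) \<gamma> = gn r (slice n j u)" using gn_attained[OF slice_mem[OF u]] .
  then have e: "gn r (slice n j u) * r ^ j = (if lookup \<gamma> n = 0 then wt r u (\<gamma> + single n j) else 0)"
    using wt_slice[of n j u \<gamma>] by simp
  have "lookup (\<gamma> + single n j) n \<noteq> 0" using assms(2) by (simp add: lookup_add)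
  then have "\<gamma> + single n j \<noteq> 0" by (metis lookup_zero)
  then have "wt r u (\<gamma> + single n j) < gn r u" using unit_dominant_const[OF assms(1)] by simp
  moreover have "0 < gn r u" using unit_dominant_const(1,2)[OF assms(1)] by simp
  ultimately show ?thesis using e by simp
qed

lemma tate_Suc_mem [simp]: "f \<in> tate n r \<Longrightarrow> f \<in> tate (Suc n) r"
  using tate_mono_var[of n "Suc n" r] by auto

lemma var_pow_mem [simp]: "var_pow n j \<in> tate (Suc n) r"
  unfolding var_pow_def by (rule tate_term) (auto simp: in_keys_iff lookup_single when_def)

lemma gn_var_pow [simp]: "gn r (var_pow n j) = r ^ j"
  by (simp add: var_pow_def)

text \<open>Only convergence of the assembled quotient h is at stake. By multiplicativity of the
  norm its slices have the norms of the slices of f divided by the fixed number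
  \<open>gn r p\<close>, so they decay equally fast.\<close>

lemma divides_iff_slices:
  assumes p: "p \<in> tate n r" "p \<noteq> 0" and f: "f \<in> tate (Suc n) r"
  shows "divides_in (tate (Suc n) r) p f \<longleftrightarrow> (\<forall>j. divides_in (tate n r) p (slice n j f))"
proof
  assume "divides_in (tate (Suc n) r) p f"
  then obtain h where h: "h \<in> tate (Suc n) r" "f = p * h" by (auto simp: divides_in_def)
  then have "slice n j f = p * slice n j h" for j by (simp add: slice_tate_mult[OF p(1)])
  then show "\<forall>j. divides_in (tate n r) p (slice n j f)" unfolding divides_in_def using h slice_mem by blast
next
  assume "\<forall>j. divides_in (tate n r) p (slice n j f)"
  then obtain H where H: "\<And>j. H j \<in> tate n r" "\<And>j. slice n j f = p * H j"
    unfolding divides_in_def by metis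
  define h where "h = mps (\<lambda>\<gamma>. coef (H (lookup \<gamma> n)) (strip n \<gamma>))"
  have slice_h: "slice n j h = H j" for j
  proof (rule mps_eqI)
    fix \<gamma> show "coef (slice n j h) \<gamma> = coef (H j) \<gamma>"
      using coef_tate_eq_0[OF H(1), of \<gamma> j]
      by (auto simp: coef_slice h_def lookup_add strip_single_add)
  qed
  have fh: "f = p * h" by (rule slice_eqI[of n]) (simp add: slice_tate_mult[OF p(1)] H(2) slice_h)
  have "keys \<gamma> \<subseteq> {..<Suc n}" if "coef h \<gamma> \<noteq> 0" for \<gamma>
  proof
    fix i assume i: "i \<in> keys \<gamma>"
    have k: "keys (strip n \<gamma>) \<subseteq> {..<n}" using that tate_keys[OF H(1)] by (simp add: h_def)
    show "i \<in> {..<Suc n}"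
    proof (cases "i = n")
      case False
      then have "i \<in> keys (strip n \<gamma>)" using i by (simp add: in_keys_iff lookup_strip)
      then show ?thesis using k by auto
    qed simp
  qed
  moreover have "finite {\<gamma>. e \<le> wt r h \<gamma>}" if e: "e > 0" for e
  proof -
    let ?F = "{\<gamma>. e * gn r p \<le> wt r f \<gamma>}"
    have gp: "gn r p > 0" using gn_pos[OF p] .
    have finF: "finite ?F" using tate_finite[OF f] e gp by simp
    \<comment> \<open>J collects the exponents of the last variable at which f still has weight
      \<open>e * gn r p\<close>. For other exponents h stays below e, and K gathers the finitely
      many large monomials of the remaining slices.\<close>
    define J where "J = (\<lambda>\<gamma>. lookup \<gamma> n) ` ?F"
    define K where "K = (\<Union>j\<in>J. (\<lambda>\<gamma>. \<gamma> + single n j) ` {\<gamma>. e / r ^ j \<le> wt r (H j) \<gamma>})"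
    have "finite K" unfolding K_def J_def
      using finF tate_finite[OF H(1)] e by (intro finite_UN_I finite_imageI) auto
    moreover have "\<gamma> \<in> K" if le: "e \<le> wt r h \<gamma>" for \<gamma>
    proof -
      let ?j = "lookup \<gamma> n"
      have w: "wt r h \<gamma> = wt r (H ?j) (strip n \<gamma>) * r ^ ?j"
        unfolding wt_eq_wt_slice[of h \<gamma> n] slice_h ..
      have 1: "e / r ^ ?j \<le> wt r (H ?j) (strip n \<gamma>)" using le w by (simp add: field_simps)
      also have "\<dots> \<le> gn r (H ?j)" using wt_le_gn[OF H(1)] .
      finally have "e * gn r p \<le> gn r (H ?j) * r ^ ?j * gn r p" using gp by (simp add: field_simps)
      also have "\<dots> = gn r (slice n ?j f) * r ^ ?j" unfolding H(2) gn_mult[OF p(1) H(1)] by simp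
      finally have ge: "e * gn r p \<le> gn r (slice n ?j f) * r ^ ?j" .
      obtain \<beta> where "wt r (slice n ?j f) \<beta> = gn r (slice n ?j f)" using gn_attained[OF slice_mem[OF f]] .
      then have "gn r (slice n ?j f) * r ^ ?j = (if lookup \<beta> n = 0 then wt r f (\<beta> + single n ?j) else 0)"
        using wt_slice[of n ?j f \<beta>] by simp
      moreover have "e * gn r p > 0" using e gp by simp
      ultimately have "lookup \<beta> n = 0" "\<beta> + single n ?j \<in> ?F" using ge by (auto split: if_splits)
      then have "?j \<in> J" unfolding J_def
        by (intro image_eqI[of _ _ "\<beta> + single n ?j"]) (simp_all add: lookup_add)
      moreover have "\<gamma> \<in> (\<lambda>\<gamma>. \<gamma> + single n ?j) ` {\<gamma>. e / r ^ ?j \<le> wt r (H ?j) \<gamma>}"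
        using 1 by (intro image_eqI[of _ _ "strip n \<gamma>"]) (simp_all add: strip_add_single)
      ultimately show ?thesis unfolding K_def by (rule UN_I)
    qed
    ultimately show ?thesis by (metis (no_types, lifting) finite_subset mem_Collect_eq subsetI)
  qed
  ultimately have "h \<in> tate (Suc n) r" by (simp add: tate_def)
  then show "divides_in (tate (Suc n) r) p f" using fh by (auto simp: divides_in_def)
qed

text \<open>The argument of Gauss's lemma: if p divides neither factor, take in each the first slice
  not divisible by p. In the slice of the product at the sum of the two indices, every other summand
  is divisible by p.\<close>

lemma prime_tate_Suc:
  assumes "prime_in (tate n r) p" shows "prime_in (tate (Suc n) r) p"
proof -
  let ?R = "tate n r" and ?T = "tate (Suc n) r"
  have p: "p \<in> ?R" "p \<noteq> 0" "\<not> unit_in ?R p"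
    and pr: "\<And>a b. a \<in> ?R \<Longrightarrow> b \<in> ?R \<Longrightarrow> divides_in ?R p (a * b) \<Longrightarrow> divides_in ?R p a \<or> divides_in ?R p b"
    using assms by (auto simp: prime_in_def)
  have dsum: "divides_in ?R p (\<Sum>x\<in>X. h x)" if "\<And>x. x \<in> X \<Longrightarrow> divides_in ?R p (h x)" for X :: "nat set" and h
    using that
  proof (induction X rule: infinite_finite_induct)
    case (insert x X)
    then obtain a b where "a \<in> ?R" "b \<in> ?R" "h x = p * a" "(\<Sum>x\<in>X. h x) = p * b"
      unfolding divides_in_def by (metis insertCI)
    then show ?case using insert.hyps unfolding divides_in_def
      by (intro bexI[of _ "a + b"]) (auto simp: distrib_left)
  qed (auto simp: divides_in_def intro!: bexI[of _ 0])
  have "\<not> unit_in ?T p"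
  proof
    assume "unit_in ?T p"
    then have "divides_in ?R p (slice n 0 1)"
      using divides_iff_slices[OF p(1,2), of 1] by (simp add: unit_in_def)
    then show False using p by (simp add: unit_in_def slice_one)
  qed
  moreover have "divides_in ?T p f \<or> divides_in ?T p g"
    if fg: "f \<in> ?T" "g \<in> ?T" "divides_in ?T p (f * g)" for f g
  proof (rule ccontr)
    assume "\<not> ?thesis"
    then have "\<exists>j. \<not> divides_in ?R p (slice n j f)" "\<exists>j. \<not> divides_in ?R p (slice n j g)"
      using divides_iff_slices[OF p(1,2)] fg by auto
    define j where "j = (LEAST j. \<not> divides_in ?R p (slice n j f))"
    define k where "k = (LEAST j. \<not> divides_in ?R p (slice n j g))"
    have j: "\<not> divides_in ?R p (slice n j f)" "\<And>i. i < j \<Longrightarrow> divides_in ?R p (slice n i f)"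
      unfolding j_def using \<open>\<exists>j. \<not> divides_in ?R p (slice n j f)\<close> by (metis LeastI, metis not_less_Least)
    have k: "\<not> divides_in ?R p (slice n k g)" "\<And>i. i < k \<Longrightarrow> divides_in ?R p (slice n i g)"
      unfolding k_def using \<open>\<exists>j. \<not> divides_in ?R p (slice n j g)\<close> by (metis LeastI, metis not_less_Least)
    let ?h = "\<lambda>i. slice n i f * slice n (j + k - i) g"
    interpret gd: graded_domain ?R \<delta> by (rule graded_domain_tate)
    have rest: "divides_in ?R p (\<Sum>i\<in>{..j + k} - {j}. ?h i)"
    proof (rule dsum)
      fix i assume "i \<in> {..j + k} - {j}"
      then have "i < j \<or> j + k - i < k" by auto
      then show "divides_in ?R p (?h i)"
        using j(2) k(2) gd.divides_mult_left gd.divides_mult_right slice_mem fg by blast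
    qed
    have "slice n (j + k) (f * g) = ?h j + (\<Sum>i\<in>{..j + k} - {j}. ?h i)"
      unfolding slice_mult by (subst sum.remove[of _ j]) auto
    moreover have "divides_in ?R p (slice n (j + k) (f * g))"
      using divides_iff_slices[OF p(1,2), of "f * g"] fg by simp
    ultimately obtain a b where ab: "a \<in> ?R" "b \<in> ?R" "?h j + p * a = p * b"
      using rest unfolding divides_in_def by metis
    then have "?h j = p * (b - a)" by (simp add: algebra_simps)
    then have "divides_in ?R p (?h j)" unfolding divides_in_def using ab by (meson tate_diff)
    then show False using pr[of "slice n j f" "slice n k g"] fg j(1) k(1) by simp
  qed
  ultimately show ?thesis using p by (simp add: prime_in_def)
qed

end

subsection \<open>Weierstrass division\<close>

context nonarch_disc
begin

text \<open>Long division by a monic polynomial in the last variable. As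
  \<open>gn r P = r ^ d\<close>, the leading term carries the norm of P, and subtracting the
  multiples of P chosen here never raises the norm of g. The induction is on the degree bound k of
  g.\<close>

lemma monic_division:
  assumes P: "P \<in> tate (Suc n) r" "slice n d P = 1" "\<And>j. j > d \<Longrightarrow> slice n j P = 0" "gn r P = r ^ d"
  shows "g \<in> tate (Suc n) r \<Longrightarrow> (\<And>j. j \<ge> k \<Longrightarrow> slice n j g = 0) \<Longrightarrow>
    \<exists>q\<in>tate (Suc n) r. \<exists>s\<in>tate (Suc n) r. (\<forall>j\<ge>d. slice n j s = 0) \<and> g = q * P + s \<and>
      gn r q * r ^ d \<le> gn r g \<and> gn r s \<le> gn r g"
proof (induction k arbitrary: g)
  case 0
  then show ?case by (intro bexI[of _ 0] bexI[of _ g]) auto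
next
  case (Suc k)
  show ?case
  proof (cases "k < d")
    case True
    then show ?thesis using Suc.prems by (intro bexI[of _ 0] bexI[of _ g]) auto
  next
    case False
    define t where "t = slice n k g * var_pow n (k - d)"
    have t: "t \<in> tate (Suc n) r" using Suc.prems(1) by (simp add: t_def)
    have tn: "gn r t * r ^ d \<le> gn r g"
    proof -
      have "gn r t * r ^ d = gn r (slice n k g) * (r ^ (k - d) * r ^ d)"
        using gn_mult[of "slice n k g" "Suc n" "var_pow n (k - d)"] Suc.prems(1) by (simp add: t_def)
      also have "\<dots> = gn r (slice n k g) * r ^ k" using False by (simp flip: power_add)
      also have "\<dots> \<le> gn r g" using gn_slice[OF Suc.prems(1)] .
      finally show ?thesis .
    qed
    define g' where "g' = g - t * P"
    have g'T: "g' \<in> tate (Suc n) r" using Suc.prems(1) t P(1) by (simp add: g'_def)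
    have slt: "slice n j (t * P) = slice n k g * (if k - d \<le> j then slice n (j - (k - d)) P else 0)" for j
      unfolding t_def mult.assoc using Suc.prems(1) by (simp add: slice_tate_mult slice_var_pow_mult)
    have "slice n j g' = 0" if "j \<ge> k" for j
    proof (cases "j = k")
      case True
      then show ?thesis using False P(2) by (simp add: g'_def slt)
    next
      case False
      then have "j > k" using that by simp
      then have "j - (k - d) > d" using \<open>\<not> k < d\<close> by arith
      then show ?thesis using \<open>j > k\<close> Suc.prems(2)[of j] P(3) by (simp add: g'_def slt)
    qed
    then obtain q s where qs: "q \<in> tate (Suc n) r" "s \<in> tate (Suc n) r" "\<forall>j\<ge>d. slice n j s = 0"
      "g' = q * P + s" "gn r q * r ^ d \<le> gn r g'" "gn r s \<le> gn r g'"
      using Suc.IH[OF g'T] by blast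
    have g'n: "gn r g' \<le> gn r g"
      using gn_diff[of g "Suc n" "t * P"] gn_mult[OF t P(1)] Suc.prems(1) t P tn by (simp add: g'_def)
    have "gn r (q + t) * r ^ d \<le> max (gn r q) (gn r t) * r ^ d"
      using gn_add[OF qs(1) t] by (intro mult_right_mono) auto
    also have "\<dots> \<le> gn r g" using qs(5) g'n tn by (auto simp: max_def)
    finally have "gn r (q + t) * r ^ d \<le> gn r g" .
    moreover have "g = (q + t) * P + s" using qs(4) by (simp add: g'_def algebra_simps)
    ultimately show ?thesis using qs g'n t by (intro bexI[of _ "q + t"] bexI[of _ s]) auto
  qed
qed

text \<open>The leading coefficient of H need not be invertible, so g is multiplied by it before
  each cancellation. That the quotient is again a polynomial in the last variable is recorded
  because \<open>irred_bezout\<close> uses its leading coefficient.\<close>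

lemma pseudo_division:
  assumes H: "H \<in> tate (Suc n) r" "\<And>j. j > e \<Longrightarrow> slice n j H = 0"
  shows "g \<in> tate (Suc n) r \<Longrightarrow> (\<And>j. j \<ge> k \<Longrightarrow> slice n j g = 0) \<Longrightarrow>
    \<exists>i. \<exists>q\<in>tate (Suc n) r. \<exists>s\<in>tate (Suc n) r. (\<forall>j\<ge>e. slice n j s = 0) \<and> (\<exists>K. \<forall>j\<ge>K. slice n j q = 0) \<and>
      slice n e H ^ i * g = q * H + s"
proof (induction k arbitrary: g)
  case 0
  then show ?case by (intro exI[of _ 0] bexI[of _ 0] bexI[of _ g]) auto
next
  case (Suc k)
  show ?case
  proof (cases "k < e")
    case True
    then show ?thesis using Suc.prems by (intro exI[of _ 0] bexI[of _ 0] bexI[of _ g]) auto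
  next
    case False
    let ?l = "slice n e H"
    have l: "?l \<in> tate n r" using H by simp
    define t where "t = slice n k g * var_pow n (k - e)"
    have t: "t \<in> tate (Suc n) r" using Suc.prems(1) by (simp add: t_def)
    define g' where "g' = ?l * g - t * H"
    have g'T: "g' \<in> tate (Suc n) r" using Suc.prems(1) t H(1) by (simp add: g'_def)
    have slt: "slice n j (t * H) = slice n k g * (if k - e \<le> j then slice n (j - (k - e)) H else 0)" for j
      unfolding t_def mult.assoc using Suc.prems(1) by (simp add: slice_tate_mult slice_var_pow_mult)
    have "slice n j g' = 0" if "j \<ge> k" for j
    proof (cases "j = k")
      case True
      then show ?thesis using False by (simp add: g'_def slt slice_tate_mult[OF l])
    next
      case False
      then have "j > k" using that by simp
      then have "j - (k - e) > e" using \<open>\<not> k < e\<close> by arith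
      then show ?thesis using \<open>j > k\<close> Suc.prems(2)[of j] H(2) by (simp add: g'_def slt slice_tate_mult[OF l])
    qed
    then obtain i q s K where qs: "q \<in> tate (Suc n) r" "s \<in> tate (Suc n) r" "\<forall>j\<ge>e. slice n j s = 0"
      "\<forall>j\<ge>K. slice n j q = 0" "?l ^ i * g' = q * H + s"
      using Suc.IH[OF g'T] by blast
    let ?q = "?l ^ i * t + q"
    have "?l ^ Suc i * g = ?q * H + s" using qs(5) by (simp add: g'_def algebra_simps)
    moreover have "slice n j ?q = 0" if "j \<ge> max K (Suc (k - e))" for j
      using that qs(4) l Suc.prems(1)
      by (simp add: t_def slice_tate_mult slice_var_pow)
    ultimately show ?thesis using qs t l
      by (intro exI[of _ "Suc i"] bexI[of _ ?q] bexI[of _ s] conjI exI[of _ "max K (Suc (k - e))"]) auto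
  qed
qed

text \<open>With \<open>d = \<delta> f\<close> this implies the usual notion: the slice at d has a
  strictly dominant constant term, and no higher slice contributes a peak. A pure power at the top
  total degree is what shears can achieve.\<close>

definition distinguished :: "nat \<Rightarrow> 'a mps \<Rightarrow> bool" where
  "distinguished n f \<longleftrightarrow> f \<in> tate (Suc n) r \<and> f \<noteq> 0 \<and> single n (\<delta> f) \<in> peak f"

text \<open>The total degree of a peak is at most \<open>\<delta> f\<close>, so an exponent that
  large in the last variable leaves nothing for the others.\<close>

lemma distinguished_peak:
  assumes "distinguished n f" "\<gamma> \<in> peak f" "\<delta> f \<le> lookup \<gamma> n" shows "\<gamma> = single n (\<delta> f)"
proof -
  have "deg \<gamma> \<le> \<delta> f" using assms le_peak_deg by (auto simp: distinguished_def)
  then have "lookup \<gamma> n = deg \<gamma>" "deg \<gamma> = \<delta> f" using assms(3) lookup_le_deg[of \<gamma> n] by auto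
  then show ?thesis using lookup_eq_deg_imp_single by metis
qed

text \<open>After scaling, f is a monic polynomial P in the last variable plus an error E of smaller
  norm. Long division by P is therefore division by f up to a relative error below 1, which
  successive approximation removes.\<close>

lemma weierstrass_division:
  assumes dist: "distinguished n f" and g: "g \<in> tate (Suc n) r"
  shows "\<exists>q\<in>tate (Suc n) r. \<exists>s\<in>tate (Suc n) r. (\<forall>j\<ge>\<delta> f. slice n j s = 0) \<and> gn r s \<le> gn r g \<and> g = q * f + s"
proof -
  let ?T = "tate (Suc n) r"
  define d where "d = \<delta> f"
  define a where "a = coef f (single n d)"
  have f: "f \<in> ?T" "f \<noteq> 0" and pk: "single n d \<in> peak f"
    using dist by (auto simp: distinguished_def d_def)
  have gf: "gn r f = absv a * r ^ d" using pk by (simp add: peak_def wt_def a_def)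
  then have a: "absv a > 0" using gn_pos[OF f] by (auto intro: ccontr)
  define f1 where "f1 = cst (1 / a) * f"
  have f1T: "f1 \<in> ?T" using f by (simp add: f1_def)
  have absa: "absv (1 / a) = 1 / absv a" using absv_inverse[of a] by (simp add: inverse_eq_divide)
  have wt1: "wt r f1 \<gamma> = wt r f \<gamma> / absv a" for \<gamma>
    using absv_mult[of "1 / a" "coef f \<gamma>"] by (simp add: f1_def wt_def absa)
  have gn1: "gn r f1 = r ^ d" using gn_cst_mult[OF f(1), of "1 / a"] a by (simp add: f1_def absa gf)
  \<comment> \<open>From the slice at d only the pure power is kept, so that P is monic. The rest of
    that slice and all higher slices contain no peak and go into E.\<close>
  define P where "P = mps (\<lambda>\<gamma>. if \<gamma> = single n d then 1 else if lookup \<gamma> n < d then coef f1 \<gamma> else 0)"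
  have c1: "coef f1 (single n d) = 1" using a by (simp add: f1_def a_def)
  have PT: "P \<in> ?T"
    by (rule tate_subset_wt[OF f1T]) (auto simp: P_def wt_def c1)
  have Pd: "slice n d P = 1"
  proof (rule mps_eqI)
    fix \<gamma> show "coef (slice n d P) \<gamma> = coef 1 \<gamma>"
      by (auto simp: coef_slice P_def coef_one lookup_add)
  qed
  have Pj: "slice n j P = 0" if "j > d" for j
  proof (rule mps_eqI)
    fix \<gamma>
    have "lookup (\<gamma> + single n j) n \<noteq> lookup (single n d) n" using that by (simp add: lookup_add)
    then have "\<gamma> + single n j \<noteq> single n d" by metis
    then show "coef (slice n j P) \<gamma> = coef 0 \<gamma>" using that by (auto simp: coef_slice P_def lookup_add)
  qed
  have Pn: "gn r P = r ^ d"
  proof (rule antisym)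
    show "gn r P \<le> r ^ d"
    proof (rule gn_le)
      fix \<gamma>
      have "wt r P \<gamma> \<le> wt r f1 \<gamma>" by (auto simp: P_def wt_def c1)
      then show "wt r P \<gamma> \<le> r ^ d" using wt_le_gn[OF f1T, of \<gamma>] gn1 by simp
    qed
    show "r ^ d \<le> gn r P" using wt_le_gn[OF PT, of "single n d"] by (simp add: wt_def P_def)
  qed
  define E where "E = f1 - P"
  have ET: "E \<in> ?T" using f1T PT by (simp add: E_def)
  have En: "gn r E < r ^ d"
  proof (rule gn_less[OF ET])
    fix \<gamma>
    show "wt r E \<gamma> < r ^ d"
    proof (cases "\<gamma> = single n d \<or> lookup \<gamma> n < d")
      case True
      then have "coef E \<gamma> = 0" by (auto simp: E_def P_def c1)
      then show ?thesis by (simp add: wt_def)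
    next
      case False
      then have "\<gamma> \<notin> peak f" using distinguished_peak[OF dist, of \<gamma>] by (auto simp: d_def)
      then have "wt r f \<gamma> < gn r f" using wt_le_gn[OF f(1), of \<gamma>] by (simp add: peak_def less_le)
      then have "wt r f1 \<gamma> < r ^ d" using a by (simp add: wt1 gf field_simps)
      moreover have "wt r E \<gamma> = wt r f1 \<gamma>" using False by (simp add: E_def P_def wt_def)
      ultimately show ?thesis by simp
    qed
  qed
  \<comment> \<open>The lower bound \<open>1 / 2\<close> keeps \<open>\<epsilon>\<close> positive
    even if E vanishes, so that only finitely many monomials of g exceed the permitted
    error.\<close>
  define \<epsilon> where "\<epsilon> = max (gn r E / r ^ d) (1 / 2)"
  have \<epsilon>: "0 < \<epsilon>" "\<epsilon> < 1" "gn r E / r ^ d \<le> \<epsilon>" using En by (auto simp: \<epsilon>_def less_max_iff_disj)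
  define Z where "Z = {\<gamma>. d \<le> lookup \<gamma> n}"
  have Z: "(\<forall>\<gamma>\<in>Z. coef s \<gamma> = 0) \<longleftrightarrow> (\<forall>j\<ge>d. slice n j s = 0)" for s :: "'a mps"
  proof
    assume "\<forall>\<gamma>\<in>Z. coef s \<gamma> = 0"
    then show "\<forall>j\<ge>d. slice n j s = 0"
      by (auto intro!: mps_eqI simp: coef_slice Z_def lookup_add)
  next
    assume z: "\<forall>j\<ge>d. slice n j s = 0"
    show "\<forall>\<gamma>\<in>Z. coef s \<gamma> = 0"
    proof
      fix \<gamma> assume "\<gamma> \<in> Z"
      then have "slice n (lookup \<gamma> n) s = 0" using z by (simp add: Z_def)
      then show "coef s \<gamma> = 0" unfolding coef_eq_coef_slice[of s \<gamma> n] by simp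
    qed
  qed
  have "\<exists>q\<in>?T. \<exists>s\<in>?T. (\<forall>\<gamma>\<in>Z. coef s \<gamma> = 0) \<and> gn r s \<le> gn r g \<and> g = q * f + s"
  proof (rule approx_division_imp_division[OF f(1) less_imp_le[OF \<epsilon>(1)] \<epsilon>(2) _ _ g, of "1 / gn r f"])
    show "0 \<le> 1 / gn r f" using gn_pos[OF f] by simp
    fix g assume g: "g \<in> ?T"
    show "\<exists>q\<in>?T. \<exists>s\<in>?T. (\<forall>\<gamma>\<in>Z. coef s \<gamma> = 0) \<and> gn r q \<le> 1 / gn r f * gn r g \<and>
        gn r s \<le> gn r g \<and> gn r (g - q * f - s) \<le> \<epsilon> * gn r g"
    proof (cases "g = 0")
      case True
      then show ?thesis by (intro bexI[of _ 0]) auto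
    next
      case False
      have "\<epsilon> * gn r g > 0" using \<epsilon> gn_pos[OF g False] by simp
      then have fin: "finite {\<gamma>. \<epsilon> * gn r g \<le> wt r g \<gamma>}" by (rule tate_finite[OF g])
      obtain N where N: "\<And>\<gamma>. \<epsilon> * gn r g \<le> wt r g \<gamma> \<Longrightarrow> lookup \<gamma> n < N"
      proof -
        have "finite ((\<lambda>\<gamma>. lookup \<gamma> n) ` {\<gamma>. \<epsilon> * gn r g \<le> wt r g \<gamma>})" using fin by simp
        then obtain N where "(\<lambda>\<gamma>. lookup \<gamma> n) ` {\<gamma>. \<epsilon> * gn r g \<le> wt r g \<gamma>} \<subseteq> {..<N}"
          unfolding finite_nat_iff_bounded by blast
        then show ?thesis using that by blast
      qed
      \<comment> \<open>Long division needs a polynomial in the last variable; the tail cut off from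
        g fits into the permitted error.\<close>
      define g1 where "g1 = mps (\<lambda>\<gamma>. if lookup \<gamma> n < N then coef g \<gamma> else 0)"
      have g1T: "g1 \<in> ?T" by (rule tate_subset_wt[OF g]) (auto simp: g1_def wt_def)
      have g1n: "gn r g1 \<le> gn r g"
      proof (rule gn_le)
        fix \<gamma> show "wt r g1 \<gamma> \<le> gn r g"
          using wt_le_gn[OF g, of \<gamma>] gn_nonneg[OF g] by (simp add: g1_def wt_def)
      qed
      have "slice n j g1 = 0" if "j \<ge> N" for j
        using that by (auto intro!: mps_eqI simp: coef_slice g1_def lookup_add)
      then obtain q s where qs: "q \<in> ?T" "s \<in> ?T" "\<forall>j\<ge>d. slice n j s = 0" "g1 = q * P + s"
         "gn r q * r ^ d \<le> gn r g1" "gn r s \<le> gn r g1"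
        using monic_division[OF PT Pd Pj Pn g1T] by blast
      let ?q = "cst (1 / a) * q"
      have qT: "?q \<in> ?T" using qs by simp
      have qf: "?q * f = q * f1" by (simp add: f1_def ac_simps)
      have e: "g - ?q * f - s = (g - g1) - q * E"
        unfolding qf E_def qs(4) by (simp add: algebra_simps)
      have n1: "gn r (g - g1) \<le> \<epsilon> * gn r g"
      proof (rule gn_le)
        fix \<gamma> show "wt r (g - g1) \<gamma> \<le> \<epsilon> * gn r g"
        proof (cases "lookup \<gamma> n < N")
          case True
          then show ?thesis using \<open>\<epsilon> * gn r g > 0\<close> by (simp add: g1_def wt_def)
        next
          case False
          then have "wt r (g - g1) \<gamma> = wt r g \<gamma>" by (simp add: g1_def wt_def)
          then show ?thesis using N[of \<gamma>] False by linarith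
        qed
      qed
      have qr: "gn r q \<le> gn r g / r ^ d" using qs(5) g1n by (simp add: field_simps)
      have n2: "gn r (q * E) \<le> \<epsilon> * gn r g"
      proof -
        have "gn r (q * E) = gn r q * gn r E" using gn_mult[OF qs(1) ET] .
        also have "\<dots> \<le> gn r g / r ^ d * gn r E" using qr gn_nonneg[OF ET] by (rule mult_right_mono)
        also have "\<dots> = gn r E / r ^ d * gn r g" by simp
        also have "\<dots> \<le> \<epsilon> * gn r g" using \<epsilon>(3) gn_nonneg[OF g] by (rule mult_right_mono)
        finally show ?thesis .
      qed
      have "gn r (g - ?q * f - s) \<le> \<epsilon> * gn r g"
        unfolding e using gn_diff[of "g - g1" "Suc n" "q * E"] g g1T qs ET n1 n2 by simp
      moreover have "gn r ?q \<le> 1 / gn r f * gn r g"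
      proof -
        have "gn r ?q = 1 / absv a * gn r q" using gn_cst_mult[OF qs(1), of "1 / a"] absa by simp
        also have "\<dots> \<le> 1 / absv a * (gn r g / r ^ d)" using qr a by (intro mult_left_mono) auto
        also have "\<dots> = 1 / gn r f * gn r g" by (simp add: gf)
        finally show ?thesis .
      qed
      moreover have "gn r s \<le> gn r g" using qs(6) g1n by simp
      ultimately show ?thesis using qT qs(2,3) Z[of s] by blast
    qed
  qed
  then show ?thesis unfolding Z d_def[symmetric] by blast
qed

text \<open>Dividing \<open>z_n^d\<close> by f leaves a remainder s of degree below d and norm at
  most \<open>r ^ d\<close>, so \<open>q * f = z_n^d - s\<close> is monic of norm
  \<open>r ^ d\<close>. What remains is that q is a unit.\<close>

lemma weierstrass_preparation:
  assumes dist: "distinguished n f"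
  shows "\<exists>u. unit_in (tate (Suc n) r) u \<and> slice n (\<delta> f) (u * f) = 1 \<and>
    (\<forall>j>\<delta> f. slice n j (u * f) = 0) \<and> gn r (u * f) = r ^ \<delta> f"
proof -
  let ?T = "tate (Suc n) r"
  define d where "d = \<delta> f"
  have f: "f \<in> ?T" "f \<noteq> 0" and pk: "single n d \<in> peak f"
    using dist by (auto simp: distinguished_def d_def)
  obtain q s where qs: "q \<in> ?T" "s \<in> ?T" "\<forall>j\<ge>d. slice n j s = 0" "gn r s \<le> r ^ d" "var_pow n d = q * f + s"
    using weierstrass_division[OF dist var_pow_mem, of d] unfolding d_def[symmetric] by auto
  define P where "P = q * f"
  have P: "P = var_pow n d - s" using qs(5) by (simp add: P_def)
  have PT: "P \<in> ?T" using qs f by (simp add: P_def)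
  have Pd: "slice n d P = 1" using qs(3) by (simp add: P slice_var_pow)
  have Pj: "slice n j P = 0" if "j > d" for j using that qs(3) by (simp add: P slice_var_pow)
  have cP: "coef P (single n d) = 1" using arg_cong[OF Pd, of "\<lambda>h. coef h 0"] by (simp add: coef_slice coef_one)
  have Pn: "gn r P = r ^ d"
  proof (rule antisym)
    show "gn r P \<le> r ^ d" unfolding P using gn_diff[OF var_pow_mem qs(2), of d] qs(4) by simp
    show "r ^ d \<le> gn r P" using wt_le_gn[OF PT, of "single n d"] cP by (simp add: wt_def)
  qed
  have P0: "P \<noteq> 0" using cP by auto
  have q0: "q \<noteq> 0" using P0 by (auto simp: P_def)
  define N where "N = \<delta> P"
  \<comment> \<open>The quotient \<open>q\<close> is a unit: \<open>f\<close> and \<open>P\<close> have the same leading degree for a weight that puts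
    the last variable first, so this degree vanishes for \<open>q\<close>.\<close>
  define \<phi> where "\<phi> \<gamma> = N * lookup \<gamma> n + deg \<gamma>" for \<gamma>
  have \<phi>add: "\<phi> (\<alpha> + \<beta>) = \<phi> \<alpha> + \<phi> \<beta>" for \<alpha> \<beta> by (simp add: \<phi>_def lookup_add algebra_simps)
  have "peak_deg \<phi> P = N * d + d"
  proof (rule peak_deg_eqI[OF PT P0])
    show "single n d \<in> peak P" by (simp add: peak_def wt_def cP Pn)
    show "\<phi> (single n d) = N * d + d" by (simp add: \<phi>_def)
    fix \<gamma> assume \<gamma>: "\<gamma> \<in> peak P"
    have "coef P \<gamma> \<noteq> 0" using \<gamma> gn_pos[OF PT P0] by (auto simp: peak_def wt_def)
    then have nz: "coef (slice n (lookup \<gamma> n) P) (strip n \<gamma>) \<noteq> 0" by (simp flip: coef_eq_coef_slice)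
    then have le: "lookup \<gamma> n \<le> d" using Pj[of "lookup \<gamma> n"] by (cases "lookup \<gamma> n > d") auto
    show "\<phi> \<gamma> \<le> N * d + d"
    proof (cases "lookup \<gamma> n = d")
      case True
      then have "strip n \<gamma> = 0" using nz Pd by (simp add: coef_one split: if_splits)
      then have "\<gamma> = single n d" using strip_add_single[of n \<gamma>] True by simp
      then show ?thesis by (simp add: \<phi>_def)
    next
      case False
      \<comment> \<open>Giving up one power of the last variable costs N, and
        \<open>deg \<gamma> \<le> N\<close> cannot more than make up for it.\<close>
      then have "Suc (lookup \<gamma> n) \<le> d" using le by simp
      then have "N * Suc (lookup \<gamma> n) \<le> N * d" by (rule mult_le_mono2)
      moreover have "deg \<gamma> \<le> N" unfolding N_def using le_peak_deg[OF PT P0 \<gamma>] .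
      ultimately show ?thesis by (simp add: \<phi>_def)
    qed
  qed
  moreover have "peak_deg \<phi> f = N * d + d"
  proof (rule peak_deg_eqI[OF f pk])
    show "\<phi> (single n d) = N * d + d" by (simp add: \<phi>_def)
    fix \<gamma> assume "\<gamma> \<in> peak f"
    then have "deg \<gamma> \<le> d" unfolding d_def using le_peak_deg[OF f] by blast
    then have "lookup \<gamma> n \<le> d" using lookup_le_deg[of \<gamma> n] by simp
    then show "\<phi> \<gamma> \<le> N * d + d" unfolding \<phi>_def using \<open>deg \<gamma> \<le> d\<close> by (intro add_mono mult_le_mono2)
  qed
  moreover have "peak_deg \<phi> P = peak_deg \<phi> q + peak_deg \<phi> f"
    unfolding P_def by (rule peak_deg_mult[OF qs(1) q0 f \<phi>add])
  ultimately have q\<phi>: "peak_deg \<phi> q = 0" by simp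
  obtain \<gamma> where \<gamma>: "\<gamma> \<in> peak q" "deg \<gamma> = \<delta> q" using peak_deg_attained[OF qs(1) q0] by blast
  have "deg \<gamma> \<le> \<phi> \<gamma>" by (simp add: \<phi>_def)
  also have "\<dots> \<le> 0" using le_peak_deg[OF qs(1) q0 \<gamma>(1), of \<phi>] q\<phi> by simp
  finally have "\<delta> q = 0" using \<gamma>(2) by simp
  then have "unit_in ?T q" using unit_iff_\<delta>[OF qs(1) q0] by simp
  then show ?thesis using Pd Pj Pn unfolding P_def d_def by blast
qed

text \<open>Here factoriality in one variable less enters. Every irreducible factor of c is prime in
  n variables by assumption and stays prime with one more variable, so it can be cancelled from q or
  from H; what is removed is collected in b and a.\<close>

lemma cancel_primes:
  assumes prime: "\<And>p. irred_in (tate n r) p \<Longrightarrow> prime_in (tate n r) p"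
    and c: "c \<in> tate n r" "c \<noteq> 0" and P: "P \<in> tate (Suc n) r"
  shows "q \<in> tate (Suc n) r \<Longrightarrow> H \<in> tate (Suc n) r \<Longrightarrow> c * P = q * H \<Longrightarrow>
    \<exists>a\<in>tate n r. \<exists>b\<in>tate n r. \<exists>H'\<in>tate (Suc n) r. \<exists>q'\<in>tate (Suc n) r.
      a \<noteq> 0 \<and> b \<noteq> 0 \<and> H = a * H' \<and> q = b * q' \<and> P = q' * H'"
proof -
  let ?R = "tate n r" and ?T = "tate (Suc n) r"
  interpret R: graded_domain ?R \<delta> by (rule graded_domain_tate)
  interpret T: graded_domain ?T \<delta> by (rule graded_domain_tate)
  show "q \<in> ?T \<Longrightarrow> H \<in> ?T \<Longrightarrow> c * P = q * H \<Longrightarrow> \<exists>a\<in>?R. \<exists>b\<in>?R. \<exists>H'\<in>?T. \<exists>q'\<in>?T.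
      a \<noteq> 0 \<and> b \<noteq> 0 \<and> H = a * H' \<and> q = b * q' \<and> P = q' * H'"
    using c
  proof (induction arbitrary: q H rule: R.factor_induct)
    case (unit u)
    then obtain v where v: "v \<in> ?R" "1 = u * v" by (auto simp: unit_in_def divides_in_def)
    have "P = v * (u * P)" using v(2) by (metis mult.assoc mult.commute mult_1)
    also have "\<dots> = v * q * H" using unit.prems by (simp add: mult.assoc)
    finally have 1: "P = v * q * H" .
    have 2: "q = u * (v * q)" using v(2) by (metis mult.assoc mult_1)
    show ?case
      using unit v 1 2 R.unit_nonzero
      by (intro bexI[of _ 1] bexI[of _ u] bexI[of _ H] bexI[of _ "v * q"]) (auto simp: unit_in_def)
  next
    case (irred p c)
    then have pR: "p \<in> ?R" "p \<noteq> 0" by (auto simp: irred_in_def)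
    have pT: "prime_in ?T p" using prime_tate_Suc[OF prime[OF irred.hyps(1)]] .
    have "p * (c * P) = q * H" using irred.prems by (simp add: mult.assoc)
    then have "divides_in ?T p (q * H)"
      using irred.hyps P by (auto simp: divides_in_def intro!: bexI[of _ "c * P"])
    then have "divides_in ?T p q \<or> divides_in ?T p H" using pT irred.prems by (auto simp: prime_in_def)
    then show ?case
    proof
      assume "divides_in ?T p q"
      then obtain q1 where q1: "q1 \<in> ?T" "q = p * q1" by (auto simp: divides_in_def)
      have "p * (c * P) = p * (q1 * H)" using irred.prems q1 by (simp add: mult.assoc)
      then have "c * P = q1 * H" using T.cancel[of p "c * P" "q1 * H"] pR q1 irred.hyps irred.prems P by simp
      then obtain a b H' q' where *: "a \<in> ?R" "b \<in> ?R" "H' \<in> ?T" "q' \<in> ?T" "a \<noteq> 0" "b \<noteq> 0" "H = a * H'"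
        "q1 = b * q'" "P = q' * H'" using irred.IH[OF q1(1) irred.prems(2)] by blast
      then have "p * b \<noteq> 0" "q = p * b * q'" using tate_mult_nonzero[of p n b] pR q1 by (auto simp: mult.assoc)
      then show ?thesis using * pR by (intro bexI[of _ a] bexI[of _ "p * b"] bexI[of _ H'] bexI[of _ q']) auto
    next
      assume "divides_in ?T p H"
      then obtain H1 where H1: "H1 \<in> ?T" "H = p * H1" by (auto simp: divides_in_def)
      have "p * (c * P) = p * (q * H1)" using irred.prems H1 by (simp add: ac_simps)
      then have "c * P = q * H1" using T.cancel[of p "c * P" "q * H1"] pR H1 irred.hyps irred.prems P by simp
      then obtain a b H' q' where *: "a \<in> ?R" "b \<in> ?R" "H' \<in> ?T" "q' \<in> ?T" "a \<noteq> 0" "b \<noteq> 0" "H1 = a * H'"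
        "q = b * q'" "P = q' * H'" using irred.IH[OF irred.prems(1) H1(1)] by blast
      then have "p * a \<noteq> 0" "H = p * a * H'" using tate_mult_nonzero[of p n a] pR H1 by (auto simp: mult.assoc)
      then show ?thesis using * pR by (intro bexI[of _ "p * a"] bexI[of _ b] bexI[of _ H'] bexI[of _ q']) auto
    qed
  qed
qed

text \<open>The candidate is an element H of least degree e in the last variable among the nonzero
  elements of the ideal generated by f and g. Pseudo-division of the prepared polynomial P by H
  leaves remainder 0 by minimality, and cancelling the primes of the multiplier makes P a multiple
  of \<open>H'\<close>, which is H up to a factor from the smaller ring. Irreducibility of f then
  forces \<open>e = 0\<close>, so H itself lies in the smaller ring.\<close>

lemma irred_bezout:
  assumes prime: "\<And>p. irred_in (tate n r) p \<Longrightarrow> prime_in (tate n r) p"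
    and f: "irred_in (tate (Suc n) r) f" and dist: "distinguished n f"
    and g: "g \<in> tate (Suc n) r" and ndvd: "\<not> divides_in (tate (Suc n) r) f g"
  shows "\<exists>\<rho>\<in>tate n r. \<rho> \<noteq> 0 \<and> (\<exists>\<alpha>\<in>tate (Suc n) r. \<exists>\<beta>\<in>tate (Suc n) r. \<rho> = \<alpha> * f + \<beta> * g)"
proof -
  let ?R = "tate n r" and ?T = "tate (Suc n) r"
  interpret T: graded_domain ?T \<delta> by (rule graded_domain_tate)
  have fT: "f \<in> ?T" using f by (simp add: irred_in_def)
  define d where "d = \<delta> f"
  obtain u where u: "unit_in ?T u" "slice n d (u * f) = 1" "\<forall>j>d. slice n j (u * f) = 0" "gn r (u * f) = r ^ d"
    using weierstrass_preparation[OF dist] unfolding d_def by blast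
  have uT: "u \<in> ?T" using u(1) by (simp add: unit_in_def)
  define P where "P = u * f"
  have PT: "P \<in> ?T" using uT fT by (simp add: P_def)
  define I where "I = {x \<in> ?T. \<exists>\<alpha>\<in>?T. \<exists>\<beta>\<in>?T. x = \<alpha> * f + \<beta> * g}"
  have I_comb: "a * x + b * y \<in> I" if x: "x \<in> I" and y: "y \<in> I" and a: "a \<in> ?T" and b: "b \<in> ?T" for a b x y
  proof -
    obtain \<alpha> \<beta> where 1: "\<alpha> \<in> ?T" "\<beta> \<in> ?T" "x = \<alpha> * f + \<beta> * g" using x by (auto simp: I_def)
    obtain \<alpha>' \<beta>' where 2: "\<alpha>' \<in> ?T" "\<beta>' \<in> ?T" "y = \<alpha>' * f + \<beta>' * g" using y by (auto simp: I_def)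
    have "a * x + b * y = (a * \<alpha> + b * \<alpha>') * f + (a * \<beta> + b * \<beta>') * g"
      unfolding 1 2 by (simp add: algebra_simps)
    moreover have "a * x + b * y \<in> ?T" using 1 2 a b fT g by simp
    moreover have "a * \<alpha> + b * \<alpha>' \<in> ?T" "a * \<beta> + b * \<beta>' \<in> ?T" using 1 2 a b by simp_all
    ultimately show ?thesis unfolding I_def by blast
  qed
  have "f = 1 * f + 0 * g" "g = 0 * f + 1 * g" by simp_all
  then have fI: "f \<in> I" and gI: "g \<in> I"
    unfolding I_def using fT g tate_one tate_zero by blast+
  \<comment> \<open>The remainder of g is a nonzero element of the ideal of degree below d, whence
    \<open>e < d\<close> for the minimal degree e.\<close>
  obtain q0 s0 where s0: "q0 \<in> ?T" "s0 \<in> ?T" "\<forall>j\<ge>d. slice n j s0 = 0" "g = q0 * f + s0"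
    using weierstrass_division[OF dist g] unfolding d_def by blast
  have s0I: "s0 \<in> I" using I_comb[OF gI fI, of 1 "- q0"] s0 by simp
  have s0nz: "s0 \<noteq> 0"
  proof
    assume "s0 = 0"
    then have "g = f * q0" using s0(4) by (simp add: mult.commute)
    then show False using ndvd s0(1) unfolding divides_in_def by blast
  qed
  define Q where "Q e \<longleftrightarrow> (\<exists>H\<in>I. H \<noteq> 0 \<and> (\<forall>j>e. slice n j H = 0))" for e
  have dpos: "d > 0"
  proof (rule ccontr)
    assume "\<not> d > 0"
    then have "slice n j s0 = slice n j 0" for j using s0(3) by simp
    then have "s0 = 0" by (rule slice_eqI)
    then show False using s0nz by simp
  qed
  have Qd: "Q (d - 1)" unfolding Q_def using s0I s0nz s0(3) dpos by (intro bexI[of _ s0]) auto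
  define e where "e = (LEAST e. Q e)"
  have Qe: "Q e" unfolding e_def by (rule LeastI[of Q, OF Qd])
  have emin: "\<not> Q k" if "k < e" for k using that not_less_Least unfolding e_def by blast
  have ed: "e < d" using Least_le[of Q, OF Qd] dpos unfolding e_def by linarith
  have small: "x = 0" if x: "x \<in> I" "\<And>j. j \<ge> e \<Longrightarrow> slice n j x = 0" for x
  proof (rule ccontr)
    assume nz: "x \<noteq> 0"
    show False
    proof (cases e)
      case 0
      then have "slice n j x = slice n j 0" for j using x(2) by simp
      then have "x = 0" by (rule slice_eqI)
      then show False using nz by simp
    next
      case (Suc k)
      then have "Q k" unfolding Q_def using x nz by (intro bexI[of _ x]) auto
      then show False using emin[of k] Suc by simp
    qed
  qed
  obtain H where H: "H \<in> I" "H \<noteq> 0" "\<And>j. j > e \<Longrightarrow> slice n j H = 0" using Qe unfolding Q_def by blast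
  have HT: "H \<in> ?T" using H(1) by (simp add: I_def)
  define l where "l = slice n e H"
  have lR: "l \<in> ?R" using HT by (simp add: l_def)
  have lnz: "l \<noteq> 0"
  proof
    assume "l = 0"
    then have "slice n j H = 0" if "j \<ge> e" for j
      using that H(3)[of j] by (cases "j = e") (simp_all add: l_def)
    then have "H = 0" by (rule small[OF H(1)])
    then show False using H by simp
  qed
  have Pz: "slice n j P = 0" if "j \<ge> Suc d" for j using that u(3) by (simp add: P_def)
  obtain i q s K where qs: "q \<in> ?T" "s \<in> ?T" "\<forall>j\<ge>e. slice n j s = 0" "\<forall>j\<ge>K. slice n j q = 0"
      "l ^ i * P = q * H + s"
    using pseudo_division[OF HT H(3) PT Pz] unfolding l_def by blast
  have "l ^ i * u * f + (- q) * H \<in> I" using lR uT qs(1) by (intro I_comb fI H) simp_all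
  moreover have "s = l ^ i * u * f + (- q) * H" using qs(5) by (simp add: P_def algebra_simps)
  ultimately have "s \<in> I" by simp
  then have "s = 0" using small[of s] qs(3) by simp
  then have lP: "l ^ i * P = q * H" using qs(5) by simp
  have li: "l ^ i \<in> ?R" "l ^ i \<noteq> 0"
  proof -
    show "l ^ i \<in> ?R" using lR by simp
    show "l ^ i \<noteq> 0" by (induction i) (use lR lnz tate_mult_nonzero in auto)
  qed
  obtain a b H' q' where *: "a \<in> ?R" "b \<in> ?R" "H' \<in> ?T" "q' \<in> ?T" "a \<noteq> 0" "b \<noteq> 0" "H = a * H'"
      "q = b * q'" "P = q' * H'" using cancel_primes[OF prime li PT qs(1) HT lP] by blast
  have sH': "slice n j H' = 0" if "j > e" for j
  proof -
    have "a * slice n j H' = 0" using H(3)[OF that] *(7) slice_tate_mult[OF *(1)] by simp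
    then show ?thesis using tate_mult_nonzero[of a n "slice n j H'"] * by auto
  qed
  have sq': "slice n j q' = 0" if "j \<ge> K" for j
  proof -
    have "b * slice n j q' = 0" using qs(4) that *(8) slice_tate_mult[OF *(2)] by simp
    then show ?thesis using tate_mult_nonzero[of b n "slice n j q'"] * by auto
  qed
  have sH'e: "slice n e H' \<noteq> 0" using lnz *(7) slice_tate_mult[OF *(1), of e H'] by (auto simp: l_def)
  have P0: "slice n d P = 1" using u(2) by (simp add: P_def)
  have "q' \<noteq> 0" using P0 *(9) by auto
  define e' where "e' = (LEAST k. \<forall>j>k. slice n j q' = 0)"
  have "\<forall>j>K. slice n j q' = 0" using sq' by simp
  then have e'z: "\<forall>j>e'. slice n j q' = 0" unfolding e'_def by (rule LeastI)
  have sq'e: "slice n e' q' \<noteq> 0"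
  proof
    assume z: "slice n e' q' = 0"
    show False
    proof (cases e')
      case 0
      then have "slice n j q' = slice n j 0" for j using e'z z by (cases j) auto
      then have "q' = 0" by (rule slice_eqI)
      then show False using \<open>q' \<noteq> 0\<close> by simp
    next
      case (Suc k)
      then have "\<forall>j>k. slice n j q' = 0" using e'z z by (metis Suc_lessI)
      then have "e' \<le> k" unfolding e'_def by (rule Least_le)
      then show False using Suc by simp
    qed
  qed
  have top: "slice n (e' + e) P = slice n e' q' * slice n e H'" "\<And>k. k > e' + e \<Longrightarrow> slice n k P = 0"
    unfolding *(9) using slice_mult_top[of e' n q' e H'] e'z sH' by auto
  have "slice n (e' + e) P \<noteq> 0" unfolding top(1) using tate_mult_nonzero[of _ n] sq'e sH'e * by simp
  then have "e' + e \<le> d" using Pz[of "e' + e"] by (cases "e' + e \<le> d") auto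
  moreover have "d \<le> e' + e" using top(2)[of d] P0 by (cases "d \<le> e' + e") auto
  ultimately have ee: "e' + e = d" by simp
  then have lead: "slice n e' q' * slice n e H' = 1" using top(1) P0 by simp
  \<comment> \<open>The leading term of the monic P carries its norm, and the leading coefficients
    of \<open>q'\<close> and \<open>H'\<close> multiply to 1. Hence each factor must have its norm
    carried by its own leading term.\<close>
  have gnP: "gn r q' * gn r H' = r ^ e' * r ^ e"
    using u(4) gn_mult[OF *(4,3)] ee by (simp add: P_def[symmetric] *(9)[symmetric] power_add[symmetric])
  have gl: "gn r (slice n e' q') * gn r (slice n e H') = 1"
    using gn_mult[of "slice n e' q'" n "slice n e H'"] lead * by simp
  have lower: "gn r (slice n e' q') * r ^ e' \<le> gn r q'" "gn r (slice n e H') * r ^ e \<le> gn r H'"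
    using gn_slice *(3,4) by auto
  have prod: "(gn r (slice n e' q') * r ^ e') * (gn r (slice n e H') * r ^ e) = gn r q' * gn r H'"
    unfolding gnP using gl by (simp add: ac_simps)
  have "H' \<noteq> 0" using sH'e by auto
  have pos: "gn r q' > 0" "gn r H' > 0"
    using gn_pos[OF *(4) \<open>q' \<noteq> 0\<close>] gn_pos[OF *(3) \<open>H' \<noteq> 0\<close>] .
  have nonneg: "0 \<le> gn r (slice n e' q') * r ^ e'" "0 \<le> gn r (slice n e H') * r ^ e"
    using gn_nonneg[OF slice_mem[OF *(4)]] gn_nonneg[OF slice_mem[OF *(3)]] by simp_all
  have "f = q' * (H' * w)" if "w \<in> ?T" "1 = u * w" for w
    using that *(9) unfolding P_def by (metis mult.assoc mult.commute mult_1_right)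
  moreover obtain w where w: "w \<in> ?T" "1 = u * w" using u(1) by (auto simp: unit_in_def divides_in_def)
  ultimately have "unit_in ?T q' \<or> unit_in ?T (H' * w)" using f * unfolding irred_in_def by (metis tate_mult)
  then have "unit_in ?T q' \<or> unit_in ?T H'"
    using T.divides_unit[of H' "H' * w"] T.divides_mult_right[of H' H' w] * w by auto
  \<comment> \<open>A unit whose leading term carries the norm has degree 0. For \<open>q'\<close>
    this contradicts \<open>e' > 0\<close>, for \<open>H'\<close> it is the claim.\<close>
  then have e0: "e = 0"
  proof
    assume uq: "unit_in ?T q'"
    have "e' > 0" using ee ed by simp
    then have lt: "gn r (slice n e' q') * r ^ e' < gn r q'" using gn_slice_unit_less[OF uq] by blast
    have "(gn r (slice n e' q') * r ^ e') * (gn r (slice n e H') * r ^ e) \<le> (gn r (slice n e' q') * r ^ e') * gn r H'"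
      using lower(2) nonneg(1) by (rule mult_left_mono)
    also have "\<dots> < gn r q' * gn r H'" using lt pos by simp
    finally show ?thesis using prod by simp
  next
    assume uH: "unit_in ?T H'"
    show ?thesis
    proof (rule ccontr)
      assume "e \<noteq> 0"
      then have lt: "gn r (slice n e H') * r ^ e < gn r H'" using gn_slice_unit_less[OF uH] by blast
      have "(gn r (slice n e' q') * r ^ e') * (gn r (slice n e H') * r ^ e) \<le> gn r q' * (gn r (slice n e H') * r ^ e)"
        using lower(1) nonneg(2) by (rule mult_right_mono)
      also have "\<dots> < gn r q' * gn r H'" using lt pos by simp
      finally show False using prod by simp
    qed
  qed
  have "H = slice n 0 H"
  proof (rule slice_eqI[of n])
    fix j show "slice n j H = slice n j (slice n 0 H)"
      using H(3)[of j] e0 slice_tate[OF slice_mem[OF HT], of j 0] by (cases "j = 0") auto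
  qed
  then have "H \<in> ?R" using slice_mem[OF HT, of 0] by simp
  then show ?thesis using H(1,2) unfolding I_def by blast
qed

end

subsection \<open>Shears and distinguished series\<close>

definition move :: "nat \<Rightarrow> nat \<Rightarrow> nat \<Rightarrow> mono \<Rightarrow> mono" where
  "move i n k \<gamma> = \<gamma> - single n k + single i k"

text \<open>The substitution \<open>z\<^sub>i \<mapsto> z\<^sub>i + c z\<^sub>n\<close>: by the binomial theorem, \<open>z\<^sup>\<beta>\<close> contributes to \<open>z\<^sup>\<gamma>\<close>
  exactly when \<open>\<beta>\<close> arises from \<open>\<gamma>\<close> by moving exponent from \<open>n\<close> to \<open>i\<close>.\<close>
definition shear :: "nat \<Rightarrow> nat \<Rightarrow> 'a::comm_ring_1 \<Rightarrow> 'a mps \<Rightarrow> 'a mps" where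
  "shear i n c f = mps (\<lambda>\<gamma>. \<Sum>k\<le>lookup \<gamma> n.
     of_nat ((lookup \<gamma> i + k) choose k) * c ^ k * coef f (move i n k \<gamma>))"

lemma coef_shear: "coef (shear i n c f) \<gamma> = (\<Sum>k\<le>lookup \<gamma> n.
     of_nat ((lookup \<gamma> i + k) choose k) * c ^ k * coef f (move i n k \<gamma>))"
  by (simp add: shear_def)

lemma lookup_move:
  "i \<noteq> n \<Longrightarrow> lookup (move i n k \<gamma>) j =
    (if j = n then lookup \<gamma> n - k else if j = i then lookup \<gamma> i + k else lookup \<gamma> j)"
  by (auto simp: move_def lookup_add lookup_minus lookup_single)

lemma move_inverse: "i \<noteq> n \<Longrightarrow> k \<le> lookup \<gamma> n \<Longrightarrow> move n i k (move i n k \<gamma>) = \<gamma>"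
  by (rule poly_mapping_eqI) (simp add: lookup_move)

lemma move_move: "i \<noteq> n \<Longrightarrow> move i n l (move i n k \<gamma>) = move i n (k + l) \<gamma>"
  by (rule poly_mapping_eqI) (simp add: lookup_move)

lemma move_zero [simp]: "move i n 0 \<gamma> = \<gamma>"
  by (simp add: move_def)

lemma deg_move: assumes "i \<noteq> n" "k \<le> lookup \<gamma> n" shows "deg (move i n k \<gamma>) = deg \<gamma>"
proof -
  have "\<gamma> - single n k + single n k = \<gamma>"
    by (rule poly_mapping_eqI) (use assms(2) in \<open>auto simp: lookup_add lookup_minus lookup_single when_def\<close>)
  then have "deg (\<gamma> - single n k) + k = deg \<gamma>" by (metis deg_add deg_single)
  then show ?thesis by (simp add: move_def)
qed

lemma shear_zero [simp]: "shear i n c 0 = 0"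
  by (rule mps_eqI) (simp add: coef_shear)

lemma shear_by_zero [simp]: "shear i n 0 f = f"
proof (rule mps_eqI)
  fix \<gamma>
  have "coef (shear i n 0 f) \<gamma> = (\<Sum>k\<in>{0}. of_nat ((lookup \<gamma> i + k) choose k) * 0 ^ k * coef f (move i n k \<gamma>))"
    unfolding coef_shear by (rule sum.mono_neutral_right) (auto simp: power_0_left)
  then show "coef (shear i n 0 f) \<gamma> = coef f \<gamma>" by simp
qed

lemma shear_one: assumes "i \<noteq> n" shows "shear i n c 1 = 1"
proof (rule mps_eqI)
  fix \<gamma>
  have "coef (shear i n c 1) \<gamma> = (\<Sum>k\<in>{0}. of_nat ((lookup \<gamma> i + k) choose k) * c ^ k * coef 1 (move i n k \<gamma>))"
    unfolding coef_shear
  proof (rule sum.mono_neutral_right)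
    show "\<forall>k\<in>{..lookup \<gamma> n} - {0}. of_nat ((lookup \<gamma> i + k) choose k) * c ^ k * coef 1 (move i n k \<gamma>) = 0"
    proof
      fix k assume "k \<in> {..lookup \<gamma> n} - {0}"
      then have "lookup (move i n k \<gamma>) i \<noteq> 0" using assms by (simp add: lookup_move)
      then have "move i n k \<gamma> \<noteq> 0" by (metis lookup_zero)
      then show "of_nat ((lookup \<gamma> i + k) choose k) * c ^ k * coef 1 (move i n k \<gamma>) = 0"
        by (simp add: coef_one)
    qed
  qed auto
  then show "coef (shear i n c 1) \<gamma> = coef 1 \<gamma>" by simp
qed

text \<open>The substitutions compose additively in c; on coefficients this is the binomial theorem
  for \<open>(a + b) ^ N\<close>. In particular the shear by \<open>- c\<close> inverts the shear by
  c.\<close>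

lemma shear_shear:
  assumes "i \<noteq> n" shows "shear i n a (shear i n b f) = shear i n (a + b) f"
proof (rule mps_eqI)
  fix \<gamma> :: mono
  let ?g = "lookup \<gamma> i" and ?N = "lookup \<gamma> n"
  define F where "F N = coef f (move i n N \<gamma>)" for N
  have bin: "((?g + k) choose k) * ((?g + k + l) choose l) = ((?g + (k + l)) choose (k + l)) * ((k + l) choose k)" for k l
  proof -
    have "(?g + (k + l) choose (k + l)) * ((k + l) choose l) = (?g + (k + l) choose l) * ((?g + (k + l) - l) choose (k + l - l))"
      by (rule choose_mult) auto
    moreover have "((k + l) choose l) = ((k + l) choose k)" using binomial_symmetric[of l "k + l"] by simp
    ultimately show ?thesis by (simp add: ac_simps)
  qed
  have "coef (shear i n a (shear i n b f)) \<gamma> =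
     (\<Sum>k\<le>?N. \<Sum>l\<le>?N - k. of_nat ((?g + k) choose k) * a ^ k * (of_nat ((?g + k + l) choose l) * b ^ l * F (k + l)))"
    unfolding coef_shear[of i n a] F_def
    by (intro sum.cong refl) (simp add: coef_shear lookup_move[OF assms] move_move[OF assms] assms sum_distrib_left)
  also have "\<dots> = (\<Sum>(k, l)\<in>(SIGMA k:{..?N}. {..?N - k}).
      of_nat ((?g + k) choose k) * a ^ k * (of_nat ((?g + k + l) choose l) * b ^ l * F (k + l)))"
    by (subst sum.Sigma) auto
  also have "\<dots> = (\<Sum>(N, k)\<in>(SIGMA N:{..?N}. {..N}). of_nat ((?g + N) choose N) * (of_nat (N choose k) * a ^ k * b ^ (N - k)) * F N)"
  proof (rule sum.reindex_bij_witness[where i = "\<lambda>(N, k). (k, N - k)" and j = "\<lambda>(k, l). (k + l, k)"], goal_cases)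
    case (5 x)
    obtain k l where [simp]: "x = (k, l)" by (cases x)
    have "(of_nat ((?g + k) choose k) * of_nat ((?g + k + l) choose l) :: 'a) =
      of_nat ((?g + (k + l)) choose (k + l)) * of_nat ((k + l) choose k)"
      unfolding of_nat_mult[symmetric] bin ..
    then show ?case by (simp add: ac_simps)
  qed auto
  also have "\<dots> = (\<Sum>N\<le>?N. \<Sum>k\<le>N. of_nat ((?g + N) choose N) * (of_nat (N choose k) * a ^ k * b ^ (N - k)) * F N)"
    by (subst sum.Sigma) auto
  also have "\<dots> = coef (shear i n (a + b) f) \<gamma>"
    unfolding coef_shear F_def binomial_ring sum_distrib_left sum_distrib_right ..
  finally show "coef (shear i n a (shear i n b f)) \<gamma> = coef (shear i n (a + b) f) \<gamma>" .
qed

text \<open>Compatibility of the substitution with products, read off from coefficients: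
  Vandermonde's identity distributes the k moved exponents over the two factors.\<close>

lemma shear_mult:
  assumes ne: "i \<noteq> n" shows "shear i n c (f * g) = shear i n c f * shear i n c g"
proof (rule mps_eqI)
  fix \<gamma> :: mono
  let ?N = "lookup \<gamma> n"
  define LS where "LS = (SIGMA k:{..?N}. dec (move i n k \<gamma>) \<times> {..k})"
  define RS where "RS = (SIGMA p:dec \<gamma>. {..lookup (fst p) n} \<times> {..lookup (snd p) n})"
  define h where "h = (\<lambda>(k, (\<alpha>, \<beta>), l). of_nat (lookup \<alpha> i choose l) * of_nat (lookup \<beta> i choose (k - l)) * c ^ k * (coef f \<alpha> * coef g \<beta>))"
  define h' where "h' = (\<lambda>((\<alpha>, \<beta>), l, l'). (of_nat ((lookup \<alpha> i + l) choose l) * c ^ l * coef f (move i n l \<alpha>)) *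
      (of_nat ((lookup \<beta> i + l') choose l') * c ^ l' * coef g (move i n l' \<beta>)))"
  \<comment> \<open>An index in LS asks for l exponents of \<open>\<alpha>\<close> and
    \<open>k - l\<close> of \<open>\<beta>\<close> to be moved back from i to n. Where too few are
    available there is no partner in RS, but a binomial coefficient vanishes.\<close>
  define T' where "T' = {(k, (\<alpha>, \<beta>), l) \<in> LS. lookup \<alpha> i < l \<or> lookup \<beta> i < k - l}"
  define to_LS where "to_LS = (\<lambda>((\<alpha>, \<beta>), l, l'). (l + l', (move i n l \<alpha>, move i n l' \<beta>), l))"
  define from_LS where "from_LS = (\<lambda>(k, (\<alpha>, \<beta>), l). ((move n i l \<alpha>, move n i (k - l) \<beta>), l, k - l))"
  have finLS: "finite LS" unfolding LS_def by (intro finite_SigmaI) auto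
  have "coef (shear i n c (f * g)) \<gamma> = (\<Sum>k\<le>?N. \<Sum>p\<in>dec (move i n k \<gamma>). \<Sum>l\<le>k. h (k, p, l))"
    unfolding coef_shear
  proof (intro sum.cong refl)
    fix k assume k: "k \<in> {..?N}"
    have "of_nat ((lookup \<gamma> i + k) choose k) * c ^ k * (coef f \<alpha> * coef g \<beta>) = (\<Sum>l\<le>k. h (k, (\<alpha>, \<beta>), l))"
      if "\<alpha> + \<beta> = move i n k \<gamma>" for \<alpha> \<beta>
    proof -
      have "lookup \<alpha> i + lookup \<beta> i = lookup \<gamma> i + k"
        using arg_cong[OF that, of "\<lambda>x. lookup x i"] ne by (simp add: lookup_add lookup_move)
      then have "(lookup \<gamma> i + k) choose k = (\<Sum>l\<le>k. (lookup \<alpha> i choose l) * (lookup \<beta> i choose (k - l)))"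
        by (simp add: vandermonde)
      then show ?thesis by (simp add: h_def sum_distrib_right)
    qed
    then show "of_nat ((lookup \<gamma> i + k) choose k) * c ^ k * coef (f * g) (move i n k \<gamma>) =
        (\<Sum>p\<in>dec (move i n k \<gamma>). \<Sum>l\<le>k. h (k, p, l))"
      unfolding coef_mult sum_distrib_left by (intro sum.cong refl) auto
  qed
  also have "\<dots> = sum h LS"
    unfolding LS_def by (simp add: sum.Sigma sum.cartesian_product case_prod_unfold)
  also have "sum h LS = sum h' RS"
  proof (rule sum.reindex_bij_witness_not_neutral[symmetric, where S' = "{}" and T' = T'
        and i = from_LS and j = to_LS])
    show "finite T'" by (rule finite_subset[OF _ finLS]) (auto simp: T'_def)
    fix x assume x: "x \<in> RS - {}"
    obtain \<alpha> \<beta> l l' where [simp]: "x = ((\<alpha>, \<beta>), l, l')" by (cases x) auto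
    have ab: "\<alpha> + \<beta> = \<gamma>" "l \<le> lookup \<alpha> n" "l' \<le> lookup \<beta> n" using x by (auto simp: RS_def)
    show "from_LS (to_LS x) = x"
      using ab ne by (simp add: move_inverse to_LS_def from_LS_def)
    have "move i n l \<alpha> + move i n l' \<beta> = move i n (l + l') \<gamma>"
      by (rule poly_mapping_eqI) (use ab(2,3) ne in \<open>auto simp: lookup_add lookup_move ab(1)[symmetric]\<close>)
    moreover have "l + l' \<le> ?N" using ab by (auto simp: lookup_add)
    ultimately show "to_LS x \<in> LS - T'"
      using ne by (simp add: LS_def T'_def to_LS_def lookup_move)
  next
    fix y assume y: "y \<in> LS - T'"
    obtain k \<alpha> \<beta> l where [simp]: "y = (k, (\<alpha>, \<beta>), l)" by (cases y) auto
    have k: "k \<le> ?N" "\<alpha> + \<beta> = move i n k \<gamma>" "l \<le> k" "l \<le> lookup \<alpha> i" "k - l \<le> lookup \<beta> i"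
      using y by (auto simp: LS_def T'_def)
    show "to_LS (from_LS y) = y"
      using k ne by (simp add: move_inverse to_LS_def from_LS_def)
    have "move n i l \<alpha> + move n i (k - l) \<beta> = \<gamma>"
    proof (rule poly_mapping_eqI)
      fix x
      show "lookup (move n i l \<alpha> + move n i (k - l) \<beta>) x = lookup \<gamma> x"
        using k(1,3-5) ne arg_cong[OF k(2), of "\<lambda>y. lookup y x"]
        by (auto simp: lookup_add lookup_move split: if_splits)
    qed
    then show "from_LS y \<in> RS - {}"
      using ne by (simp add: RS_def from_LS_def lookup_move)
  next
    fix y assume "y \<in> T'"
    then show "h y = 0" by (auto simp: T'_def h_def binomial_eq_0)
  next
    fix x assume "x \<in> RS"
    obtain \<alpha> \<beta> l l' where [simp]: "x = ((\<alpha>, \<beta>), l, l')" by (cases x) auto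
    show "h (to_LS x) = h' x"
      using ne by (simp add: h_def h'_def to_LS_def lookup_move power_add ac_simps)
  qed auto
  also have "\<dots> = (\<Sum>p\<in>dec \<gamma>. \<Sum>l\<le>lookup (fst p) n. \<Sum>l'\<le>lookup (snd p) n. h' (p, l, l'))"
    unfolding RS_def by (simp add: sum.Sigma sum.cartesian_product case_prod_unfold)
  also have "\<dots> = coef (shear i n c f * shear i n c g) \<gamma>"
    unfolding coef_mult coef_shear
    by (intro sum.cong refl) (auto simp: h'_def sum_product)
  finally show "coef (shear i n c (f * g)) \<gamma> = coef (shear i n c f * shear i n c g) \<gamma>" .
qed

section \<open>Automorphisms that preserve the Tate algebras of all radii\<close>

context nonarch
begin

text \<open>The quantifier over r sits inside the definition because two radii will be compared
  under one and the same pair of maps.\<close>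

definition tate_auto :: "nat \<Rightarrow> ('a mps \<Rightarrow> 'a mps) \<Rightarrow> ('a mps \<Rightarrow> 'a mps) \<Rightarrow> bool" where
  "tate_auto m \<sigma> \<tau> \<longleftrightarrow> (\<forall>f. \<tau> (\<sigma> f) = f \<and> \<sigma> (\<tau> f) = f) \<and> (\<forall>f g. \<sigma> (f * g) = \<sigma> f * \<sigma> g) \<and>
     \<sigma> 0 = 0 \<and> \<sigma> 1 = 1 \<and> (\<forall>r>0. \<forall>f\<in>tate m r. \<sigma> f \<in> tate m r \<and> \<tau> f \<in> tate m r)"

lemma tate_auto_id: "tate_auto m (\<lambda>f. f) (\<lambda>f. f)"
  by (simp add: tate_auto_def)

lemma tate_auto_comp: "tate_auto m \<sigma> \<tau> \<Longrightarrow> tate_auto m \<sigma>' \<tau>' \<Longrightarrow> tate_auto m (\<lambda>f. \<sigma>' (\<sigma> f)) (\<lambda>f. \<tau> (\<tau>' f))"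
  by (simp add: tate_auto_def)

lemma tate_auto_divides:
  assumes "tate_auto m \<sigma> \<tau>" "0 < r"
  shows "divides_in (tate m r) (\<sigma> a) (\<sigma> b) \<longleftrightarrow> divides_in (tate m r) a b"
proof
  assume "divides_in (tate m r) (\<sigma> a) (\<sigma> b)"
  then obtain c where "c \<in> tate m r" "\<sigma> b = \<sigma> a * c" by (auto simp: divides_in_def)
  then have "\<sigma> b = \<sigma> (a * \<tau> c)" "\<tau> c \<in> tate m r" using assms by (simp_all add: tate_auto_def)
  then have "b = a * \<tau> c" using assms by (metis tate_auto_def)
  then show "divides_in (tate m r) a b" using \<open>\<tau> c \<in> tate m r\<close> by (auto simp: divides_in_def)
next
  assume "divides_in (tate m r) a b"
  then obtain c where "c \<in> tate m r" "b = a * c" by (auto simp: divides_in_def)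
  then show "divides_in (tate m r) (\<sigma> a) (\<sigma> b)"
    using assms by (auto simp: divides_in_def tate_auto_def)
qed

lemma tate_auto_mem: "tate_auto m \<sigma> \<tau> \<Longrightarrow> 0 < r \<Longrightarrow> \<sigma> a \<in> tate m r \<longleftrightarrow> a \<in> tate m r"
  unfolding tate_auto_def by metis

lemma tate_auto_unit:
  assumes "tate_auto m \<sigma> \<tau>" "0 < r" shows "unit_in (tate m r) (\<sigma> a) \<longleftrightarrow> unit_in (tate m r) a"
  using tate_auto_divides[OF assms, of a 1] tate_auto_mem[OF assms] assms
  by (simp add: unit_in_def tate_auto_def)

lemma tate_auto_eq_0: "tate_auto m \<sigma> \<tau> \<Longrightarrow> \<sigma> a = 0 \<longleftrightarrow> a = 0"
  by (metis tate_auto_def)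

lemma tate_auto_irred:
  assumes "tate_auto m \<sigma> \<tau>" "0 < r" "irred_in (tate m r) f" shows "irred_in (tate m r) (\<sigma> f)"
proof -
  have "unit_in (tate m r) a \<or> unit_in (tate m r) b" if "a \<in> tate m r" "b \<in> tate m r" "\<sigma> f = a * b" for a b
  proof -
    have "\<tau> a \<in> tate m r" "\<tau> b \<in> tate m r" using assms that by (simp_all add: tate_auto_def)
    moreover have "\<sigma> f = \<sigma> (\<tau> a * \<tau> b)" using that assms by (simp add: tate_auto_def)
    then have "f = \<tau> a * \<tau> b" using assms by (metis tate_auto_def)
    ultimately have "unit_in (tate m r) (\<tau> a) \<or> unit_in (tate m r) (\<tau> b)"
      using assms(3) by (auto simp: irred_in_def)
    then show ?thesis using tate_auto_unit[OF assms(1,2), of "\<tau> a"] tate_auto_unit[OF assms(1,2), of "\<tau> b"] assms(1)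
      by (simp add: tate_auto_def)
  qed
  then show ?thesis using assms tate_auto_mem[OF assms(1,2)] tate_auto_unit[OF assms(1,2)] tate_auto_eq_0[OF assms(1)]
    by (simp add: irred_in_def)
qed

lemma tate_auto_prime:
  assumes "tate_auto m \<sigma> \<tau>" "0 < r" "prime_in (tate m r) (\<sigma> f)" shows "prime_in (tate m r) f"
proof -
  have "divides_in (tate m r) f a \<or> divides_in (tate m r) f b"
    if "a \<in> tate m r" "b \<in> tate m r" "divides_in (tate m r) f (a * b)" for a b
  proof -
    have "divides_in (tate m r) (\<sigma> f) (\<sigma> a * \<sigma> b)"
      using that tate_auto_divides[OF assms(1,2), of f "a * b"] assms(1) by (simp add: tate_auto_def)
    then have "divides_in (tate m r) (\<sigma> f) (\<sigma> a) \<or> divides_in (tate m r) (\<sigma> f) (\<sigma> b)"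
      using assms(3) that tate_auto_mem[OF assms(1,2)] by (simp add: prime_in_def)
    then show ?thesis using tate_auto_divides[OF assms(1,2)] by simp
  qed
  then show ?thesis using assms tate_auto_mem[OF assms(1,2)] tate_auto_unit[OF assms(1,2)] tate_auto_eq_0[OF assms(1)]
    by (simp add: prime_in_def)
qed

lemma shear_term_le:
  assumes c: "absv c \<le> 1"
  shows "absv (of_nat N * c ^ k * x) \<le> absv x"
proof -
  have "absv (of_nat N) * absv c ^ k \<le> 1"
    using absv_of_nat[of N] c by (intro mult_le_one power_le_one) auto
  then show ?thesis by (simp add: absv_mult absv_power mult_left_le_one_le)
qed

text \<open>Moving exponents between variables preserves the total degree and thus the factor
  \<open>r ^ deg \<gamma>\<close>, while binomial coefficients and powers of c are integral. So a
  shear creates no weight larger than those it draws from.\<close>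

lemma wt_shear_less:
  assumes c: "absv c \<le> 1" and ne: "i \<noteq> n" and r: "0 < r" and e: "0 < e"
    and lt: "\<And>k. k \<le> lookup \<gamma> n \<Longrightarrow> wt r f (move i n k \<gamma>) < e"
  shows "wt r (shear i n c f) \<gamma> < e"
proof -
  have "absv (coef (shear i n c f) \<gamma>) < e / r ^ deg \<gamma>"
    unfolding coef_shear
  proof (rule absv_sum_less)
    fix k assume "k \<in> {..lookup \<gamma> n}"
    then have "absv (coef f (move i n k \<gamma>)) < e / r ^ deg \<gamma>"
      using lt[of k] r ne by (simp add: wt_def deg_move field_simps)
    then show "absv (of_nat ((lookup \<gamma> i + k) choose k) * c ^ k * coef f (move i n k \<gamma>)) < e / r ^ deg \<gamma>"
      using shear_term_le[OF c] by (rule order.strict_trans1[rotated])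
  qed (use r e in simp)
  then show ?thesis using r by (simp add: wt_def field_simps)
qed

lemma shear_tate:
  assumes c: "absv c \<le> 1" and ne: "i \<noteq> n" and r: "0 < r" and n: "n < m" and f: "f \<in> tate m r"
  shows "shear i n c f \<in> tate m r"
proof -
  have "keys \<gamma> \<subseteq> {..<m}" if nz: "coef (shear i n c f) \<gamma> \<noteq> 0" for \<gamma>
  proof -
    obtain k where "k \<le> lookup \<gamma> n" "coef f (move i n k \<gamma>) \<noteq> 0"
      using sum.not_neutral_contains_not_neutral[OF nz[unfolded coef_shear]] by auto
    then have sub: "keys (move i n k \<gamma>) \<subseteq> {..<m}" using tate_keys[OF f] by blast
    show ?thesis
    proof
      fix x assume "x \<in> keys \<gamma>"
      then have "x = n \<or> x \<in> keys (move i n k \<gamma>)" using ne by (auto simp: in_keys_iff lookup_move)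
      then show "x \<in> {..<m}" using sub n by auto
    qed
  qed
  moreover have "finite {\<gamma>. e \<le> wt r (shear i n c f) \<gamma>}" if e: "e > 0" for e
  proof -
    let ?F = "{\<beta>. e \<le> wt r f \<beta>}"
    let ?K = "\<Union>\<beta>\<in>?F. (\<lambda>k. move n i k \<beta>) ` {..lookup \<beta> i}"
    have "finite ?K" using tate_finite[OF f e] by (intro finite_UN_I) auto
    moreover have "\<gamma> \<in> ?K" if "e \<le> wt r (shear i n c f) \<gamma>" for \<gamma>
    proof -
      have "\<not> (\<forall>k\<le>lookup \<gamma> n. wt r f (move i n k \<gamma>) < e)"
        using wt_shear_less[OF c ne r e, of \<gamma> f] that by auto
      then obtain k where k: "k \<le> lookup \<gamma> n" "e \<le> wt r f (move i n k \<gamma>)" by (auto simp: not_less)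
      have "\<gamma> = move n i k (move i n k \<gamma>)" using k ne by (simp add: move_inverse)
      moreover have "k \<le> lookup (move i n k \<gamma>) i" using ne by (simp add: lookup_move)
      ultimately have "\<gamma> \<in> (\<lambda>k'. move n i k' (move i n k \<gamma>)) ` {..lookup (move i n k \<gamma>) i}" by blast
      then show ?thesis using k(2) by blast
    qed
    ultimately show ?thesis by (metis (no_types, lifting) finite_subset mem_Collect_eq subsetI)
  qed
  ultimately show ?thesis by (simp add: tate_def)
qed

lemma shear_auto:
  assumes "absv c \<le> 1" "i \<noteq> n" "n < m" shows "tate_auto m (shear i n c) (shear i n (- c))"
  using assms shear_tate[of c i n _ m] shear_tate[of "- c" i n _ m]
  by (simp add: tate_auto_def shear_shear shear_mult shear_one)

text \<open>Coefficients of absolute value below \<open>B\<close> do not matter on the unit disc. For the remaining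
  polynomial \<open>p'\<close> with leading coefficient \<open>b\<close>, any solution \<open>c\<close> of \<open>p' c = b\<close> is integral.\<close>
lemma exists_poly_max:
  fixes p :: "'a poly"
  assumes B: "0 < B" and le: "\<And>k. absv (coeff p k) \<le> B" and at: "absv (coeff p k0) = B"
  shows "\<exists>c. absv c \<le> 1 \<and> absv (poly p c) = B"
proof -
  define p' where "p' = (\<Sum>k\<le>degree p. monom (if absv (coeff p k) = B then coeff p k else 0) k)"
  have cp': "coeff p' k = (if absv (coeff p k) = B then coeff p k else 0)" for k
  proof -
    have "coeff p' k = (if k \<le> degree p then (if absv (coeff p k) = B then coeff p k else 0) else 0)"
      unfolding p'_def coeff_sum by simp
    then show ?thesis using B by (auto simp: coeff_eq_0)
  qed
  have "coeff p' k0 \<noteq> 0" using at B cp'[of k0] by auto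
  then have p'0: "p' \<noteq> 0" by auto
  have diff: "absv (coeff (p - p') k) < B" for k
    using le[of k] B by (simp add: cp' less_le)
  have eval: "absv (poly p c) = B" if c: "absv c \<le> 1" and p'c: "absv (poly p' c) = B" for c
  proof -
    have "absv (poly (p - p') c) < B"
      unfolding poly_altdef
    proof (rule absv_sum_less)
      fix k
      have "absv (coeff (p - p') k * c ^ k) \<le> absv (coeff (p - p') k)"
        using c by (simp add: absv_mult absv_power mult_right_le_one_le power_le_one)
      then show "absv (coeff (p - p') k * c ^ k) < B" using diff[of k] by linarith
    qed (rule B)
    then show ?thesis using absv_add_eq[of "poly (p - p') c" "poly p' c"] p'c by simp
  qed
  show ?thesis
  proof (cases "degree p' = 0")
    case True
    then have "coeff p' 0 \<noteq> 0" using p'0 by (metis leading_coeff_0_iff)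
    then have "absv (poly p' 0) = B" using cp'[of 0] by (auto simp: poly_0_coeff_0 split: if_splits)
    then show ?thesis using eval[of 0] by (intro exI[of _ 0]) simp
  next
    case False
    let ?D = "degree p'"
    define b where "b = lead_coeff p'"
    have b: "absv b = B" using cp'[of ?D] p'0 unfolding b_def by (metis leading_coeff_0_iff)
    have "degree (p' - [:b:]) = ?D"
      using False degree_add_eq_left[of "- [:b:]" p'] by (simp del: minus_pCons)
    then have "degree (p' - [:b:]) > 0" using False by simp
    then obtain c where "poly (p' - [:b:]) c = 0"
      using nonarch_field unfolding nonarch_field_def alg_closed_field_def by blast
    then have pc: "poly p' c = b" by simp
    have "absv c \<le> 1"
    proof (rule ccontr)
      assume "\<not> ?thesis"
      then have c: "absv c > 1" by simp
      let ?s = "\<Sum>k<?D. coeff p' k * c ^ k"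
      have split: "poly p' c = b * c ^ ?D + ?s"
        unfolding poly_altdef b_def by (simp add: lessThan_Suc_atMost[symmetric])
      have "absv ?s < absv (b * c ^ ?D)"
      proof (rule absv_sum_less)
        fix k assume "k \<in> {..<?D}"
        then have "absv c ^ k < absv c ^ ?D" using c by (simp add: power_strict_increasing)
        moreover have "absv (coeff p' k) \<le> B" using le[of k] B by (simp add: cp')
        then have "absv (coeff p' k) * absv c ^ k \<le> B * absv c ^ k" by (rule mult_right_mono) simp
        ultimately have "absv (coeff p' k) * absv c ^ k < B * absv c ^ ?D"
          using B by (smt (verit) mult_strict_left_mono)
        then show "absv (coeff p' k * c ^ k) < absv (b * c ^ ?D)"
          by (simp add: absv_mult absv_power b)
      qed (use B b c in auto)
      then have "absv (poly p' c) = B * absv c ^ ?D"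
        unfolding split by (simp add: absv_add_eq absv_mult absv_power b)
      moreover have "absv c ^ ?D > 1" using c False by (simp add: one_less_power)
      ultimately show False using B pc b by simp
    qed
    then show ?thesis using eval[of c] pc b by blast
  qed
qed

end

context nonarch_disc
begin

text \<open>The whole exponent of \<open>z_i\<close> in a peak \<open>\<gamma>\<close> of top degree
  is moved to \<open>z_n\<close>, giving \<open>\<gamma>'\<close>. The coefficient of the sheared
  series at \<open>\<gamma>'\<close> is a polynomial in c. Its coefficients are coefficients of f at
  the same total degree, hence bounded by B, and the one stemming from \<open>\<gamma>\<close>
  attains B; a suitable c makes the value attain B as well. As shears do not raise norms,
  \<open>\<gamma>'\<close> is a peak.\<close>

lemma shear_step:
  assumes f: "f \<in> tate (Suc n) r" "f \<noteq> 0" and i: "i < n" and \<gamma>: "\<gamma> \<in> peak f" "deg \<gamma> = \<delta> f"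
  shows "\<exists>c. absv c \<le> 1 \<and> (\<exists>\<gamma>'\<in>peak (shear i n c f). deg \<gamma>' = \<delta> (shear i n c f) \<and>
     (\<forall>j<n. lookup \<gamma>' j = (if j = i then 0 else lookup \<gamma> j)))"
proof -
  have ne: "i \<noteq> n" using i by simp
  define \<gamma>' where "\<gamma>' = move n i (lookup \<gamma> i) \<gamma>"
  have l': "lookup \<gamma>' j = (if j = i then 0 else if j = n then lookup \<gamma> n + lookup \<gamma> i else lookup \<gamma> j)" for j
    unfolding \<gamma>'_def using ne by (subst lookup_move) auto
  have dg: "deg \<gamma>' = deg \<gamma>" unfolding \<gamma>'_def using ne by (intro deg_move) auto
  have inv: "move i n (lookup \<gamma> i) \<gamma>' = \<gamma>" unfolding \<gamma>'_def using ne by (intro move_inverse) auto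
  let ?M = "lookup \<gamma>' n"
  define p where "p = (\<Sum>k\<le>?M. monom (coef f (move i n k \<gamma>')) k)"
  have cp: "coeff p k = (if k \<le> ?M then coef f (move i n k \<gamma>') else 0)" for k
    unfolding p_def coeff_sum by simp
  have pc: "coef (shear i n c f) \<gamma>' = poly p c" for c
    unfolding coef_shear p_def poly_sum using l'[of i] by (simp add: poly_monom mult.commute)
  define B where "B = absv (coef f \<gamma>)"
  have gB: "gn r f = B * r ^ deg \<gamma>" using \<gamma>(1) by (simp add: peak_def wt_def B_def)
  have B: "B > 0" using gn_pos[OF f] gB by (auto simp: B_def intro: ccontr)
  have "absv (coeff p k) \<le> B" for k
  proof (cases "k \<le> ?M")
    case True
    then have "deg (move i n k \<gamma>') = deg \<gamma>" using ne dg by (simp add: deg_move)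
    then show ?thesis using wt_le_gn[OF f(1), of "move i n k \<gamma>'"] gB True by (simp add: cp wt_def)
  qed (use B in \<open>simp add: cp\<close>)
  moreover have "absv (coeff p (lookup \<gamma> i)) = B" using ne by (simp add: cp inv l' B_def)
  ultimately obtain c where c: "absv c \<le> 1" "absv (poly p c) = B" using exists_poly_max[OF B] by blast
  let ?g = "shear i n c f"
  have gT: "?g \<in> tate (Suc n) r" using shear_tate[OF c(1) ne r_pos _ f(1)] by simp
  have w: "wt r ?g \<gamma>' = gn r f" by (simp add: wt_def pc c(2) dg gB)
  have "gn r ?g = gn r f"
  proof (rule antisym)
    show "gn r ?g \<le> gn r f"
    \<comment> \<open>The bound \<open>wt_shear_less\<close> is strict, so it is applied with a
      slack e that is then removed.\<close>
    proof (rule field_le_epsilon)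
      fix e :: real assume "e > 0"
      then have e: "gn r f + e > 0" using gn_nonneg[OF f(1)] by simp
      have "wt r ?g \<xi> < gn r f + e" for \<xi>
        by (rule wt_shear_less[OF c(1) ne r_pos e]) (use wt_le_gn[OF f(1)] \<open>e > 0\<close> in \<open>smt (verit)\<close>)
      then show "gn r ?g \<le> gn r f + e" by (intro gn_le less_imp_le)
    qed
    show "gn r f \<le> gn r ?g" using wt_le_gn[OF gT, of \<gamma>'] w by simp
  qed
  then have pk: "\<gamma>' \<in> peak ?g" using w by (simp add: peak_def)
  have g0: "?g \<noteq> 0" using \<open>gn r ?g = gn r f\<close> gn_pos[OF f] by auto
  \<comment> \<open>Beyond degree \<open>\<delta> f\<close> the shear draws only on monomials of the
    same degree, none of which is a peak of f.\<close>
  have "\<delta> ?g = deg \<gamma>'"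
  proof (rule peak_deg_eqI[OF gT g0 pk refl], rule ccontr)
    fix \<xi> assume \<xi>: "\<xi> \<in> peak ?g" "\<not> deg \<xi> \<le> deg \<gamma>'"
    have "wt r ?g \<xi> < gn r f"
    proof (rule wt_shear_less[OF c(1) ne r_pos gn_pos[OF f]])
      fix k assume "k \<le> lookup \<xi> n"
      then have "deg (move i n k \<xi>) > \<delta> f" using \<xi>(2) dg \<gamma>(2) ne by (simp add: deg_move)
      then have "move i n k \<xi> \<notin> peak f" using le_peak_deg[OF f, of "move i n k \<xi>" deg] by auto
      then show "wt r f (move i n k \<xi>) < gn r f" using wt_le_gn[OF f(1)] by (simp add: peak_def less_le)
    qed
    then show False using \<xi>(1) \<open>gn r ?g = gn r f\<close> by (simp add: peak_def)
  qed
  moreover have "\<forall>j<n. lookup \<gamma>' j = (if j = i then 0 else lookup \<gamma> j)" using l' by simp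
  ultimately show ?thesis using c(1) pk by (intro exI[of _ c] conjI bexI[of _ \<gamma>']) auto
qed

text \<open>The exponents of a top peak are cleared one variable at a time. Each shear keeps the
  other exponents below n, so cleared variables stay cleared, and finally only the last variable is
  left.\<close>

lemma exists_distinguishing_auto:
  assumes f: "f \<in> tate (Suc n) r" "f \<noteq> 0"
  shows "\<exists>\<sigma> \<tau>. tate_auto (Suc n) \<sigma> \<tau> \<and> distinguished n (\<sigma> f)"
proof -
  have "i \<le> n \<Longrightarrow> \<exists>\<sigma> \<tau>. tate_auto (Suc n) \<sigma> \<tau> \<and> (\<exists>\<gamma>\<in>peak (\<sigma> f). deg \<gamma> = \<delta> (\<sigma> f) \<and> (\<forall>j<i. lookup \<gamma> j = 0))" for i
  proof (induction i)
    case 0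
    obtain \<gamma> where "\<gamma> \<in> peak f" "deg \<gamma> = \<delta> f" using peak_deg_attained[OF f] by blast
    then show ?case using tate_auto_id by (intro exI[of _ "\<lambda>f. f"]) auto
  next
    case (Suc i)
    then obtain \<sigma> \<tau> \<gamma> where *: "tate_auto (Suc n) \<sigma> \<tau>" "\<gamma> \<in> peak (\<sigma> f)" "deg \<gamma> = \<delta> (\<sigma> f)" "\<forall>j<i. lookup \<gamma> j = 0"
      by auto
    have \<sigma>f: "\<sigma> f \<in> tate (Suc n) r" "\<sigma> f \<noteq> 0"
      using f tate_auto_mem[OF *(1) r_pos] tate_auto_eq_0[OF *(1)] by auto
    obtain c \<gamma>' where c: "absv c \<le> 1" "\<gamma>' \<in> peak (shear i n c (\<sigma> f))" "deg \<gamma>' = \<delta> (shear i n c (\<sigma> f))"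
      "\<forall>j<n. lookup \<gamma>' j = (if j = i then 0 else lookup \<gamma> j)"
      using shear_step[OF \<sigma>f _ *(2,3), of i] Suc.prems by auto
    have "tate_auto (Suc n) (\<lambda>f. shear i n c (\<sigma> f)) (\<lambda>f. \<tau> (shear i n (- c) f))"
      using tate_auto_comp[OF *(1) shear_auto[OF c(1)]] Suc.prems by simp
    moreover have "\<forall>j<Suc i. lookup \<gamma>' j = 0" using c(4) *(4) Suc.prems by (auto simp: less_Suc_eq)
    ultimately show ?case using c by blast
  qed
  from this[of n] obtain \<sigma> \<tau> \<gamma> where *: "tate_auto (Suc n) \<sigma> \<tau>" "\<gamma> \<in> peak (\<sigma> f)" "deg \<gamma> = \<delta> (\<sigma> f)" "\<forall>j<n. lookup \<gamma> j = 0"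
    by auto
  have \<sigma>f: "\<sigma> f \<in> tate (Suc n) r" "\<sigma> f \<noteq> 0"
    using f tate_auto_mem[OF *(1) r_pos] tate_auto_eq_0[OF *(1)] by auto
  have "coef (\<sigma> f) \<gamma> \<noteq> 0" using *(2) gn_pos[OF \<sigma>f] by (auto simp: peak_def wt_def)
  then have "keys \<gamma> \<subseteq> {..<Suc n}" using tate_keys[OF \<sigma>f(1)] by blast
  then have "x = n" if "x \<in> keys \<gamma>" for x
    using that *(4)[rule_format, of x] in_keys_iff[of x \<gamma>] by (cases "x < n") auto
  then have "keys \<gamma> \<subseteq> {n}" by blast
  then have "deg \<gamma> = lookup \<gamma> n" using deg_eq_sum[of "{n}" \<gamma>] by simp
  then have "\<gamma> = single n (\<delta> (\<sigma> f))" using lookup_eq_deg_imp_single[of \<gamma> n] *(3) by simp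
  then have "distinguished n (\<sigma> f)" using *(2) \<sigma>f by (simp add: distinguished_def)
  then show ?thesis using *(1) by blast
qed

end

subsection \<open>Factoriality and change of radius\<close>

context nonarch_disc
begin

text \<open>Otherwise p would divide every slice of \<open>u * f\<close>, among them 1.\<close>

lemma not_divides_monic:
  assumes p: "p \<in> tate n r" "p \<noteq> 0" "\<not> unit_in (tate n r) p"
    and f: "f \<in> tate (Suc n) r" "u \<in> tate (Suc n) r" "slice n d (u * f) = 1"
  shows "\<not> divides_in (tate (Suc n) r) p f"
proof
  interpret T: graded_domain "tate (Suc n) r" \<delta> by (rule graded_domain_tate)
  assume "divides_in (tate (Suc n) r) p f"
  then have "divides_in (tate (Suc n) r) p (u * f)" using f by (intro T.divides_mult_left)
  then have "divides_in (tate n r) p (slice n d (u * f))"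
    using divides_iff_slices[OF p(1,2), of "u * f"] tate_mult[OF f(2,1)] by blast
  then show False using p f by (simp add: unit_in_def)
qed

text \<open>If f divides \<open>a * b\<close> but not a, then f divides \<open>\<rho> * b\<close>
  for the nonzero \<open>\<rho>\<close> of \<open>irred_bezout\<close>. The irreducible factors of
  \<open>\<rho>\<close> in the smaller ring stay prime and cannot divide f, which has a monic
  multiple. Cancelling them one by one leaves f dividing b.\<close>

lemma distinguished_prime:
  assumes prime: "\<And>p. irred_in (tate n r) p \<Longrightarrow> prime_in (tate n r) p"
    and f: "irred_in (tate (Suc n) r) f" and dist: "distinguished n f"
  shows "prime_in (tate (Suc n) r) f"
proof -
  let ?R = "tate n r" and ?T = "tate (Suc n) r"
  interpret R: graded_domain ?R \<delta> by (rule graded_domain_tate)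
  interpret T: graded_domain ?T \<delta> by (rule graded_domain_tate)
  have fT: "f \<in> ?T" "f \<noteq> 0" using f by (auto simp: irred_in_def)
  obtain u where u: "unit_in ?T u" "slice n (\<delta> f) (u * f) = 1"
    using weierstrass_preparation[OF dist] by blast
  have uT: "u \<in> ?T" using u by (simp add: unit_in_def)
  have cancel: "divides_in ?T f (\<rho> * x) \<longrightarrow> divides_in ?T f x" if "\<rho> \<in> ?R" "\<rho> \<noteq> 0" "x \<in> ?T" for \<rho> x
    using that(1,2)
  proof (induction rule: R.factor_induct)
    case (unit v)
    then obtain w where w: "w \<in> ?R" "1 = v * w" by (auto simp: unit_in_def divides_in_def)
    have "x = w * (v * x)" using w(2) by (metis mult.assoc mult.commute mult_1)
    then show ?case using T.divides_mult_left[of f "v * x" w] w by auto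
  next
    case (irred p c)
    have p: "p \<in> ?R" "p \<noteq> 0" "\<not> unit_in ?R p" using irred.hyps by (auto simp: irred_in_def)
    have pT: "prime_in ?T p" using prime_tate_Suc[OF prime[OF irred.hyps(1)]] .
    show ?case
    proof
      assume "divides_in ?T f (p * c * x)"
      then obtain y where y: "y \<in> ?T" "p * (c * x) = f * y" by (auto simp: divides_in_def mult.assoc)
      have "divides_in ?T p (f * y)"
        unfolding divides_in_def using y that(3) irred.hyps(2) by (intro bexI[of _ "c * x"]) auto
      then have "divides_in ?T p f \<or> divides_in ?T p y" using pT y fT by (auto simp: prime_in_def)
      then have "divides_in ?T p y" using not_divides_monic[OF p fT(1) uT u(2)] by blast
      then obtain z where z: "z \<in> ?T" "y = p * z" by (auto simp: divides_in_def)
      have "p * (c * x) = p * (f * z)" using y z by (simp add: ac_simps)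
      then have "c * x = f * z"
        using T.cancel[of p "c * x" "f * z"] p fT z that(3) irred.hyps(2) by simp
      then have "divides_in ?T f (c * x)" using z by (auto simp: divides_in_def)
      then show "divides_in ?T f x" using irred.IH by blast
    qed
  qed
  have "divides_in ?T f b" if ab: "a \<in> ?T" "b \<in> ?T" "divides_in ?T f (a * b)" "\<not> divides_in ?T f a" for a b
  proof -
    obtain \<rho> \<alpha> \<beta> where *: "\<rho> \<in> ?R" "\<rho> \<noteq> 0" "\<alpha> \<in> ?T" "\<beta> \<in> ?T" "\<rho> = \<alpha> * f + \<beta> * a"
      using irred_bezout[OF prime f dist ab(1,4)] by blast
    obtain c where c: "c \<in> ?T" "a * b = f * c" using ab(3) by (auto simp: divides_in_def)
    have "\<rho> * b = \<alpha> * f * b + \<beta> * (a * b)" unfolding *(5) by (simp add: algebra_simps)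
    also have "\<dots> = f * (\<alpha> * b + \<beta> * c)" unfolding c(2) by (simp add: algebra_simps)
    finally have "\<rho> * b = f * (\<alpha> * b + \<beta> * c)" .
    moreover have "\<alpha> * b + \<beta> * c \<in> ?T" using * ab c by simp
    ultimately have "divides_in ?T f (\<rho> * b)" unfolding divides_in_def by blast
    then show ?thesis using cancel[OF *(1,2) ab(2)] by blast
  qed
  then show ?thesis unfolding prime_in_def using f[unfolded irred_in_def] by blast
qed

text \<open>With no variables the Tate algebra is the field of constants, so the induction on m
  starts without any irreducible element.\<close>

lemma tate_0_unit: assumes f: "f \<in> tate 0 r" "f \<noteq> 0" shows "unit_in (tate 0 r) f"
proof (rule dominant_const_unit[OF f(1)])
  have z: "coef f \<gamma> = 0" if "\<gamma> \<noteq> 0" for \<gamma> using tate_keys[OF f(1), of \<gamma>] that by auto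
  show "coef f 0 \<noteq> 0"
  proof
    assume "coef f 0 = 0"
    then have "f = 0" using z by (intro mps_eqI) (metis coef_zero)
    then show False using f by simp
  qed
  then show "wt r f \<gamma> < absv (coef f 0)" if "\<gamma> \<noteq> 0" for \<gamma> using z[OF that] by (simp add: wt_def)
qed

theorem tate_irred_prime: "irred_in (tate m r) f \<Longrightarrow> prime_in (tate m r) f"
proof (induction m arbitrary: f)
  case 0
  then show ?case using tate_0_unit by (auto simp: irred_in_def)
next
  case (Suc n)
  have f: "f \<in> tate (Suc n) r" "f \<noteq> 0" using Suc.prems by (auto simp: irred_in_def)
  obtain \<sigma> \<tau> where \<sigma>: "tate_auto (Suc n) \<sigma> \<tau>" "distinguished n (\<sigma> f)"
    using exists_distinguishing_auto[OF f] by blast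
  have "prime_in (tate (Suc n) r) (\<sigma> f)"
    by (rule distinguished_prime[OF Suc.IH tate_auto_irred[OF \<sigma>(1) r_pos Suc.prems] \<sigma>(2)])
  then show ?case by (rule tate_auto_prime[OF \<sigma>(1) r_pos])
qed

end

context nonarch
begin

text \<open>f need not be distinguished at the smaller radius: monicity of a slice of
  \<open>u * f\<close> and the relation \<open>\<rho> = \<alpha> * f + \<beta> * g\<close> are
  identities between series and survive restriction.\<close>

lemma distinguished_coprime:
  assumes r: "0 < r1" "r1 \<le> r2" and f: "irred_in (tate (Suc n) r2) f"
    and dist: "nonarch_disc.distinguished absv r2 n f"
    and g: "g \<in> tate (Suc n) r2" "\<not> divides_in (tate (Suc n) r2) f g"
    and h: "h \<in> tate (Suc n) r1" "divides_in (tate (Suc n) r1) h f" "divides_in (tate (Suc n) r1) h g"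
  shows "unit_in (tate (Suc n) r1) h"
proof (rule ccontr)
  assume nu: "\<not> ?thesis"
  interpret D1: nonarch_disc absv r1 by unfold_locales (use r in simp)
  interpret D2: nonarch_disc absv r2 by unfold_locales (use r in linarith)
  let ?R = "tate n r1" and ?T = "tate (Suc n) r1" and ?T2 = "tate (Suc n) r2"
  interpret R: graded_domain ?R D1.\<delta> by (rule D1.graded_domain_tate)
  interpret T: graded_domain ?T D1.\<delta> by (rule D1.graded_domain_tate)
  have sub: "tate m r2 \<subseteq> tate m r1" for m by (rule tate_mono_radius[OF r])
  obtain u where u: "unit_in ?T2 u" "slice n (D2.\<delta> f) (u * f) = 1"
    using D2.weierstrass_preparation[OF dist] by blast
  have uT: "u \<in> ?T" using u sub by (auto simp: unit_in_def)
  have fT: "f \<in> ?T" "f \<noteq> 0" using f sub by (auto simp: irred_in_def)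
  obtain \<rho> \<alpha> \<beta> where *: "\<rho> \<in> tate n r2" "\<rho> \<noteq> 0" "\<alpha> \<in> ?T2" "\<beta> \<in> ?T2" "\<rho> = \<alpha> * f + \<beta> * g"
    using D2.irred_bezout[OF D2.tate_irred_prime f dist g] by blast
  have "h \<noteq> 0" using h(2) fT by (auto simp: divides_in_def)
  then obtain p where p: "irred_in ?T p" "divides_in ?T p h"
    using T.irred_divisor_exists[OF h(1) _ nu] by blast
  have pr: "prime_in ?T p" using D1.tate_irred_prime[OF p(1)] .
  have pT: "p \<in> ?T" "\<not> unit_in ?T p" using p(1) by (auto simp: irred_in_def)
  have pf: "divides_in ?T p f" and pg: "divides_in ?T p g" using T.divides_trans p(2) h(2,3) by blast+
  then obtain a b where ab: "a \<in> ?T" "b \<in> ?T" "f = p * a" "g = p * b" by (auto simp: divides_in_def)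
  have "\<rho> = p * (\<alpha> * a + \<beta> * b)" unfolding *(5) ab(3,4) by (simp add: algebra_simps)
  moreover have "\<alpha> \<in> ?T" "\<beta> \<in> ?T" using *(3,4) sub by blast+
  then have "\<alpha> * a + \<beta> * b \<in> ?T" using ab(1,2) by simp
  ultimately have p\<rho>: "divides_in ?T p \<rho>" unfolding divides_in_def by blast
  have \<rho>R: "\<rho> \<in> ?R" using * sub by auto
  \<comment> \<open>\<open>\<rho>\<close> is factored afresh at radius r1. A prime p dividing it is
    associated to one of its factors \<open>\<pi>\<close> from the smaller ring; then
    \<open>\<pi>\<close> divides f, against monicity.\<close>
  have "\<not> divides_in ?T p \<rho>"
    using \<rho>R \<open>\<rho> \<noteq> 0\<close>
  proof (induction rule: R.factor_induct)
    case (unit v)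
    then have "unit_in ?T v" by (rule unit_in_mono[OF tate_mono_var[OF le_SucI[OF le_refl]]])
    then show ?case using T.divides_unit pT by blast
  next
    case (irred \<pi> c)
    have \<pi>: "\<pi> \<in> ?R" "\<pi> \<noteq> 0" "\<not> unit_in ?R \<pi>" using irred.hyps by (auto simp: irred_in_def)
    have \<pi>T: "irred_in ?T \<pi>"
      using T.prime_imp_irred[OF D1.prime_tate_Suc[OF D1.tate_irred_prime[OF irred.hyps(1)]]] .
    show ?case
    proof
      assume "divides_in ?T p (\<pi> * c)"
      moreover have "\<pi> \<in> ?T" "c \<in> ?T" using \<pi>(1) irred.hyps(2) by simp_all
      ultimately have "divides_in ?T p \<pi>" using pr irred.IH unfolding prime_in_def by blast
      then obtain e where e: "e \<in> ?T" "\<pi> = p * e" by (auto simp: divides_in_def)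
      then have "unit_in ?T e" using \<pi>T pT by (auto simp: irred_in_def)
      then obtain w where w: "w \<in> ?T" "1 = e * w" by (auto simp: unit_in_def divides_in_def)
      have "p = \<pi> * w" using e(2) w(2) by (metis mult.assoc mult_1_right)
      then have "divides_in ?T \<pi> p" using w by (auto simp: divides_in_def)
      then have "divides_in ?T \<pi> f" using T.divides_trans pf by blast
      then show False using D1.not_divides_monic[OF \<pi> fT(1) uT u(2)] by blast
    qed
  qed
  then show False using p\<rho> by blast
qed

text \<open>The automorphism that makes f distinguished at r2 also maps the Tate algebra at r1 onto
  itself, so divisibility is transported at both radii.\<close>

lemma coprime_smaller_radius:
  assumes r: "0 < r1" "r1 \<le> r2" and f: "irred_in (tate m r2) f"
    and g: "g \<in> tate m r2" "\<not> divides_in (tate m r2) f g"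
    and h: "h \<in> tate m r1" "divides_in (tate m r1) h f" "divides_in (tate m r1) h g"
  shows "unit_in (tate m r1) h"
proof -
  interpret D2: nonarch_disc absv r2 by unfold_locales (use r in linarith)
  have f': "f \<in> tate m r2" "f \<noteq> 0" "\<not> unit_in (tate m r2) f" using f by (auto simp: irred_in_def)
  show ?thesis
  proof (cases m)
    case 0
    then show ?thesis using D2.tate_0_unit f' by auto
  next
    case (Suc n)
    have r2: "0 < r2" using r by simp
    obtain \<sigma> \<tau> where \<sigma>: "tate_auto m \<sigma> \<tau>" "D2.distinguished n (\<sigma> f)"
      using D2.exists_distinguishing_auto[of f n] f' Suc by blast
    have "unit_in (tate m r1) (\<sigma> h)"
      unfolding Suc
    proof (rule distinguished_coprime[OF r _ \<sigma>(2), of "\<sigma> g"])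
      show "irred_in (tate (Suc n) r2) (\<sigma> f)" using tate_auto_irred[OF \<sigma>(1) r2 f] Suc by simp
      show "\<sigma> g \<in> tate (Suc n) r2" using tate_auto_mem[OF \<sigma>(1) r2] g Suc by simp
      show "\<not> divides_in (tate (Suc n) r2) (\<sigma> f) (\<sigma> g)" using tate_auto_divides[OF \<sigma>(1) r2] g Suc by simp
      show "\<sigma> h \<in> tate (Suc n) r1" using tate_auto_mem[OF \<sigma>(1) r(1)] h Suc by simp
      show "divides_in (tate (Suc n) r1) (\<sigma> h) (\<sigma> f)" "divides_in (tate (Suc n) r1) (\<sigma> h) (\<sigma> g)"
        using tate_auto_divides[OF \<sigma>(1) r(1)] h Suc by simp_all
    qed
    then show ?thesis using tate_auto_unit[OF \<sigma>(1) r(1)] by simp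
  qed
qed

end

section \<open>Greatest common divisors and their behaviour under restriction\<close>

definition gcd_in :: "'b::comm_ring_1 set \<Rightarrow> 'b set \<Rightarrow> 'b \<Rightarrow> bool" where
  "gcd_in A F G \<longleftrightarrow> G \<in> A \<and> (\<forall>f\<in>F. divides_in A G f) \<and>
     (\<forall>D\<in>A. (\<forall>f\<in>F. divides_in A D f) \<longrightarrow> divides_in A D G)"

context graded_domain
begin

lemma gcd_assoc:
  assumes "gcd_in A F G" "G' \<in> A" "divides_in A G G'" "divides_in A G' G" shows "gcd_in A F G'"
  using assms divides_trans unfolding gcd_in_def by blast

lemma gcd_unit_multiple:
  assumes G: "gcd_in A F G" and u: "unit_in A u" shows "gcd_in A F (u * G)"
proof (rule gcd_assoc[OF G])
  obtain v where v: "v \<in> A" "1 = u * v" using u by (auto simp: unit_in_def divides_in_def)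
  have uG: "u \<in> A" "G \<in> A" using u G by (auto simp: unit_in_def gcd_in_def)
  then show "u * G \<in> A" by simp
  show "divides_in A G (u * G)" using uG divides_mult_left divides_refl by blast
  have "G = u * G * v" using v(2) by (metis mult.assoc mult.commute mult_1)
  then show "divides_in A (u * G) G" using v unfolding divides_in_def by blast
qed

lemma gcd_unique:
  assumes "gcd_in A F G" "gcd_in A F G'" "G \<noteq> 0" obtains u where "unit_in A u" "G' = u * G"
proof -
  have G: "G \<in> A" "G' \<in> A" "divides_in A G G'" "divides_in A G' G" using assms by (auto simp: gcd_in_def)
  then obtain u v where uv: "u \<in> A" "v \<in> A" "G' = G * u" "G = G' * v" by (auto simp: divides_in_def)
  have "G * 1 = G * u * v" unfolding uv(3)[symmetric] uv(4)[symmetric] by (rule mult_1_right)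
  then have "G * 1 = G * (u * v)" by (simp only: mult.assoc)
  then have "1 = u * v" using G(1) uv(1,2) assms(3) by (intro cancel[of G 1 "u * v"]) simp_all
  then have "unit_in A u" unfolding unit_in_def divides_in_def using uv(1,2) by blast
  moreover have "G' = u * G" using uv(3) by (simp only: mult.commute)
  ultimately show ?thesis by (rule that)
qed

end

context nonarch
begin

text \<open>G is a common divisor of largest \<open>\<delta>\<close> at r2, which exists since
  \<open>\<delta> f0\<close> is a bound; the cofactors \<open>q f\<close> then share only units
  there. A prime at r1 dividing all cofactors would divide some factor \<open>\<pi>\<close> of
  \<open>q f0\<close> irreducible at r2. But \<open>\<pi>\<close> does not divide every
  \<open>q f\<close>, and this coprimality persists at r1.\<close>

lemma gcd_all_smaller_radii:
  assumes r2: "0 < r2" and F: "F \<subseteq> tate m r2" and f0: "f0 \<in> F" "f0 \<noteq> 0"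
  shows "\<exists>G. \<forall>r1. 0 < r1 \<longrightarrow> r1 \<le> r2 \<longrightarrow> gcd_in (tate m r1) F G"
proof -
  interpret D2: nonarch_disc absv r2 by unfold_locales (use r2 in simp)
  let ?T2 = "tate m r2"
  interpret T2: graded_domain ?T2 D2.\<delta> by (rule D2.graded_domain_tate)
  define C where "C G \<longleftrightarrow> G \<in> ?T2 \<and> (\<forall>f\<in>F. divides_in ?T2 G f)" for G
  have "C 1" unfolding C_def divides_in_def using F by auto
  moreover have bound: "D2.\<delta> G \<le> D2.\<delta> f0" if CG: "C G" for G
  proof -
    obtain c where c: "c \<in> ?T2" "f0 = G * c" using CG f0(1) by (auto simp: C_def divides_in_def)
    then have "G \<noteq> 0" "c \<noteq> 0" using f0 by auto
    then show ?thesis using T2.\<delta>_mult[of G c] c CG by (simp add: C_def)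
  qed
  then have "\<forall>G. C G \<longrightarrow> D2.\<delta> G < Suc (D2.\<delta> f0)" by (simp add: less_Suc_eq_le)
  ultimately obtain G where G: "C G" "\<And>G'. C G' \<Longrightarrow> D2.\<delta> G' \<le> D2.\<delta> G"
    using ex_has_greatest_nat[of C 1 D2.\<delta>] by blast
  have GT: "G \<in> ?T2" using G(1) by (simp add: C_def)
  obtain q where q: "\<And>f. f \<in> F \<Longrightarrow> q f \<in> ?T2 \<and> f = G * q f"
    using G(1) unfolding C_def divides_in_def by metis
  have G0: "G \<noteq> 0" and q0: "q f0 \<noteq> 0" using q[OF f0(1)] f0(2) by auto
  have common_unit: "unit_in ?T2 e" if e: "e \<in> ?T2" "\<And>f. f \<in> F \<Longrightarrow> divides_in ?T2 e (q f)" for e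
  proof -
    have e0: "e \<noteq> 0" using e(2)[OF f0(1)] q0 by (auto simp: divides_in_def)
    have "divides_in ?T2 (G * e) f" if f: "f \<in> F" for f
    proof -
      obtain c where "c \<in> ?T2" "q f = e * c" using e(2)[OF f] by (auto simp: divides_in_def)
      then have "f = G * e * c" "c \<in> ?T2" using q[OF f] by (simp_all add: mult.assoc)
      then show ?thesis unfolding divides_in_def by blast
    qed
    then have "C (G * e)" using GT e by (simp add: C_def)
    then have "D2.\<delta> e = 0" using G(2) T2.\<delta>_mult[OF GT e(1) G0 e0] by force
    then show ?thesis using T2.\<delta>_eq_0[OF e(1) e0] by simp
  qed
  have "gcd_in (tate m r1) F G" if r: "0 < r1" "r1 \<le> r2" for r1
  proof -
    interpret D1: nonarch_disc absv r1 by unfold_locales (use r in simp)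
    let ?T = "tate m r1"
    interpret T: graded_domain ?T D1.\<delta> by (rule D1.graded_domain_tate)
    have sub: "?T2 \<subseteq> ?T" by (rule tate_mono_radius[OF r])
    have no_common_prime: "\<exists>f\<in>F. \<not> divides_in ?T p (q f)" if p: "prime_in ?T p" for p
    proof (rule ccontr)
      assume "\<not> ?thesis"
      then have all: "\<And>f. f \<in> F \<Longrightarrow> divides_in ?T p (q f)" by blast
      have pT: "p \<in> ?T" "\<not> unit_in ?T p" using p by (auto simp: prime_in_def)
      have "\<not> divides_in ?T p x" if "x \<in> ?T2" "x \<noteq> 0" for x
        using that
      proof (induction rule: T2.factor_induct)
        case (unit u)
        then show ?case using T.divides_unit[of p u] unit_in_mono[OF sub] pT by blast
      next
        case (irred \<pi> c)
        have \<pi>: "\<pi> \<in> ?T2" "\<not> unit_in ?T2 \<pi>" using irred.hyps by (auto simp: irred_in_def)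
        then obtain f where f: "f \<in> F" "\<not> divides_in ?T2 \<pi> (q f)" using common_unit by blast
        have "\<not> divides_in ?T p \<pi>"
          using coprime_smaller_radius[OF r irred.hyps(1) _ f(2) pT(1) _ all[OF f(1)]] q[OF f(1)] pT by blast
        then show ?case using p \<pi> irred sub unfolding prime_in_def by blast
      qed
      then show False using all[OF f0(1)] q[OF f0(1)] q0 by blast
    qed
    \<comment> \<open>The claim quantifies over G because stripping a prime from D strips it from G
      too, while the cofactors stay fixed.\<close>
    have main: "\<forall>G\<in>?T. (\<forall>f\<in>F. divides_in ?T D (G * q f)) \<longrightarrow> divides_in ?T D G" if "D \<in> ?T" "D \<noteq> 0" for D
      using that
    proof (induction rule: T.factor_induct)
      case (unit u)
      then show ?case using T.unit_divides by blast
    next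
      case (irred p D)
      have p: "p \<in> ?T" "p \<noteq> 0" using irred.hyps by (auto simp: irred_in_def)
      have pr: "prime_in ?T p" using D1.tate_irred_prime[OF irred.hyps(1)] .
      obtain f where f: "f \<in> F" "\<not> divides_in ?T p (q f)" using no_common_prime[OF pr] by blast
      show ?case
      proof (intro ballI impI)
        fix G assume GT: "G \<in> ?T" and all: "\<forall>f\<in>F. divides_in ?T (p * D) (G * q f)"
        have "divides_in ?T p (p * D)" using T.divides_mult_right[OF T.divides_refl] irred.hyps by blast
        then have "divides_in ?T p (G * q f)" using all f T.divides_trans by blast
        then have "divides_in ?T p G" using pr f GT q sub unfolding prime_in_def by blast
        then obtain G' where G': "G' \<in> ?T" "G = p * G'" by (auto simp: divides_in_def)
        have "divides_in ?T D (G' * q f)" if f: "f \<in> F" for f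
        proof -
          obtain c where c: "c \<in> ?T" "G * q f = p * D * c" using all f by (auto simp: divides_in_def)
          then have "p * (G' * q f) = p * (D * c)" using G' by (simp add: mult.assoc)
          moreover have "q f \<in> ?T" using q[OF f] sub by blast
          ultimately have "G' * q f = D * c" using T.cancel[of p "G' * q f" "D * c"] p G' c irred.hyps by simp
          then show ?thesis using c by (auto simp: divides_in_def)
        qed
        then obtain c where "c \<in> ?T" "G' = D * c" using irred.IH G' by (auto simp: divides_in_def)
        then show "divides_in ?T (p * D) G" using G' by (auto simp: divides_in_def mult.assoc)
      qed
    qed
    have "divides_in ?T G f" if "f \<in> F" for f
      using q[OF that] sub unfolding divides_in_def by blast
    moreover have "divides_in ?T D G" if D: "D \<in> ?T" "\<And>f. f \<in> F \<Longrightarrow> divides_in ?T D f" for D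
    proof -
      have "D \<noteq> 0" using D(2)[OF f0(1)] f0 by (auto simp: divides_in_def)
      moreover have "divides_in ?T D (G * q f)" if "f \<in> F" for f using D(2)[OF that] q[OF that] by simp
      ultimately show ?thesis using main[OF D(1)] GT sub by blast
    qed
    ultimately show ?thesis unfolding gcd_in_def using GT sub by blast
  qed
  then show ?thesis by blast
qed

end

subsection \<open>Entire functions\<close>

context nonarch
begin

text \<open>Gcds at different radii agree only up to units of the smaller polydisc, so they must be
  normalized before they can converge. The limit is then \<open>V * K n\<close> with V the infinite
  product of the units from n on; V is a unit at radius \<open>\<rho> n\<close>, and n is
  arbitrary.\<close>

lemma gcd_glue:
  assumes F: "\<And>r. 0 < r \<Longrightarrow> F \<subseteq> tate m r" and f0: "f0 \<in> F" "f0 \<noteq> 0"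
  shows "\<exists>G. \<forall>r>0. gcd_in (tate m r) F G"
proof -
  have disc: "nonarch_disc absv r" if "0 < r" for r using that by unfold_locales simp
  define \<rho> :: "nat \<Rightarrow> real" where "\<rho> k = 2 ^ k" for k
  have \<rho>: "0 < \<rho> k" "j \<le> k \<Longrightarrow> \<rho> j \<le> \<rho> k" for j k by (auto simp: \<rho>_def power_increasing)
  define P where "P k G \<longleftrightarrow> (\<forall>r. 0 < r \<longrightarrow> r \<le> \<rho> k \<longrightarrow> gcd_in (tate m r) F G)" for k G
  \<comment> \<open>Constant term 1 is the normalization under which the transition units tend to 1
    at each fixed radius.\<close>
  define Q where "Q k G G' \<longleftrightarrow> (\<exists>u. unit_in (tate m (\<rho> k)) u \<and> coef u 0 = 1 \<and> G' = u * G)" for k G G'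
  have nz: "G \<noteq> 0" if "gcd_in A F G" for A and G :: "'a mps"
    using that f0 by (auto simp: gcd_in_def divides_in_def)
  have gdom: "graded_domain (tate m r) (nonarch_disc.peak_deg absv r deg)" if "0 < r" for r
    by (rule nonarch_disc.graded_domain_tate[OF disc[OF that]])
  have ex: "\<exists>G. P k G" for k
    unfolding P_def using gcd_all_smaller_radii[OF \<rho>(1) F[OF \<rho>(1)] f0] .
  have "\<exists>K. \<forall>k. P k (K k) \<and> Q k (K k) (K (Suc k))"
  proof (rule dependent_nat_choice)
    show "\<exists>G. P 0 G" by (rule ex)
    fix G k assume PG: "P k G"
    interpret D: nonarch_disc absv "\<rho> k" by (rule disc[OF \<rho>(1)])
    interpret T: graded_domain "tate m (\<rho> k)" D.\<delta> by (rule D.graded_domain_tate)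
    obtain H where H: "P (Suc k) H" using ex by blast
    have G: "gcd_in (tate m (\<rho> k)) F G" using PG \<rho>(1) by (simp add: P_def)
    have H': "gcd_in (tate m (\<rho> k)) F H" using H \<rho> by (simp add: P_def)
    obtain v where v: "unit_in (tate m (\<rho> k)) v" "H = v * G" using T.gcd_unique[OF G H' nz[OF G]] .
    \<comment> \<open>Nonzero scalars are units at every radius, so dividing H by c keeps it a gcd
      up to the next radius while normalizing v.\<close>
    define c where "c = coef v 0"
    have c: "c \<noteq> 0" using D.unit_dominant_const(1)[OF v(1)] by (simp add: c_def)
    have cu: "unit_in (tate m r) (cst (1 / c))" if "0 < r" for r
    proof -
      have "1 = cst (1 / c) * cst c" using c by (simp add: cst_mult)
      then show ?thesis unfolding unit_in_def divides_in_def
        using nonarch_disc.tate_cst[OF disc[OF that]] by blast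
    qed
    have "P (Suc k) (cst (1 / c) * H)" unfolding P_def
    proof (intro allI impI)
      fix r assume r: "0 < r" "r \<le> \<rho> (Suc k)"
      show "gcd_in (tate m r) F (cst (1 / c) * H)"
        using graded_domain.gcd_unit_multiple[OF gdom[OF r(1)] _ cu[OF r(1)]] H r by (simp add: P_def)
    qed
    moreover have "Q k G (cst (1 / c) * H)"
    proof -
      have "unit_in (tate m (\<rho> k)) (cst (1 / c) * v)"
      proof -
        obtain w where w: "w \<in> tate m (\<rho> k)" "1 = v * w" using v(1) by (auto simp: unit_in_def divides_in_def)
        have "cst (1 / c) * v * (w * cst c) = (cst (1 / c) * cst c) * (v * w)" by (simp only: ac_simps)
        also have "\<dots> = 1" using c w(2) by (simp add: cst_mult)
        finally have "1 = cst (1 / c) * v * (w * cst c)" ..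
        moreover have "cst (1 / c) * v \<in> tate m (\<rho> k)" "w * cst c \<in> tate m (\<rho> k)"
          using v(1) w(1) by (simp_all add: unit_in_def)
        ultimately show ?thesis unfolding unit_in_def divides_in_def by blast
      qed
      moreover have "coef (cst (1 / c) * v) 0 = 1" using c by (simp add: c_def)
      moreover have "cst (1 / c) * H = cst (1 / c) * v * G" using v(2) by (simp add: mult.assoc)
      ultimately show ?thesis unfolding Q_def by blast
    qed
    ultimately show "\<exists>G'. P (Suc k) G' \<and> Q k G G'" by blast
  qed
  then obtain K where K: "\<And>k. P k (K k)" "\<And>k. Q k (K k) (K (Suc k))" by blast
  then obtain u where u: "\<And>k. unit_in (tate m (\<rho> k)) (u k)" "\<And>k. coef (u k) 0 = 1" "\<And>k. K (Suc k) = u k * K k"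
    unfolding Q_def by metis
  define b :: "nat \<Rightarrow> real" where "b k = (1 / 2) ^ k" for k
  have b: "decseq b" "b \<longlonglongrightarrow> 0" unfolding b_def
    by (auto simp: decseq_Suc_iff intro: LIMSEQ_power_zero)
  have KT: "K (n + k) \<in> tate m (\<rho> n)" for n k
    using K(1)[of "n + k"] \<rho>(2)[of n "n + k"] \<rho>(1)[of n] by (simp add: P_def gcd_in_def)
  have uT: "unit_in (tate m (\<rho> n)) (u (n + k))" for n k
    using unit_in_mono[OF tate_mono_radius[OF \<rho>(1) \<rho>(2)[of n "n + k"]] u(1)] by simp
  have un: "gn (\<rho> n) (u (n + k)) = 1" for n k
    using nonarch_disc.unit_dominant_const(2)[OF disc[OF \<rho>(1)] uT] u(2) by simp
  \<comment> \<open>At radius \<open>\<rho> (n + k)\<close> a nonconstant monomial of the unit has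
    weight below 1. Descending to \<open>\<rho> n\<close> divides that weight by
    \<open>(2 ^ k) ^ deg \<gamma>\<close>, which is at least \<open>2 ^ k\<close>; this is the
    origin of b.\<close>
  have u1: "gn (\<rho> n) (u (n + k) - 1) \<le> b k" for n k
  proof (rule nonarch_disc.gn_le[OF disc[OF \<rho>(1)]])
    fix \<gamma>
    show "wt (\<rho> n) (u (n + k) - 1) \<gamma> \<le> b k"
    proof (cases "\<gamma> = 0")
      case True
      then show ?thesis using u(2) by (simp add: wt_def coef_one b_def)
    next
      case False
      then have "deg \<gamma> \<noteq> 0" by (simp only: deg_eq_0_iff not_False_eq_True)
      have split: "\<rho> (n + k) ^ deg \<gamma> = \<rho> n ^ deg \<gamma> * (2 ^ k) ^ deg \<gamma>"
        by (simp add: \<rho>_def power_add power_mult_distrib)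
      have "wt (\<rho> (n + k)) (u (n + k)) \<gamma> < 1"
        using nonarch_disc.unit_dominant_const(3)[OF disc[OF \<rho>(1)] u(1) False] u(2) by simp
      then have "wt (\<rho> n) (u (n + k)) \<gamma> * (2 ^ k) ^ deg \<gamma> < 1"
        by (simp add: wt_def split mult.assoc)
      moreover have "(2 ^ k :: real) \<le> (2 ^ k) ^ deg \<gamma>"
        using \<open>deg \<gamma> \<noteq> 0\<close> by (intro self_le_power) (simp_all del: deg_eq_0_iff)
      then have "wt (\<rho> n) (u (n + k)) \<gamma> * 2 ^ k \<le> wt (\<rho> n) (u (n + k)) \<gamma> * (2 ^ k) ^ deg \<gamma>"
        by (rule mult_left_mono) (simp add: \<rho>(1))
      ultimately have "wt (\<rho> n) (u (n + k)) \<gamma> * 2 ^ k < 1" by linarith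
      moreover have "wt (\<rho> n) (u (n + k) - 1) \<gamma> = wt (\<rho> n) (u (n + k)) \<gamma>"
        using False by (simp add: wt_def coef_one)
      ultimately show ?thesis by (simp add: b_def field_simps)
    qed
  qed
  \<comment> \<open>The units have norm 1, so the norm of K stays constant and its differences decay
    as fast as the units approach 1.\<close>
  have step: "gn (\<rho> n) (K (n + Suc k) - K (n + k)) \<le> gn (\<rho> n) (K n) * b k" for n k
  proof -
    interpret D: nonarch_disc absv "\<rho> n" by (rule disc[OF \<rho>(1)])
    have uTm: "u (n + j) \<in> tate m (\<rho> n)" for j using uT by (simp add: unit_in_def)
    have const: "gn (\<rho> n) (K (n + j)) = gn (\<rho> n) (K n)" for j
    proof (induction j)
      case (Suc j)
      then show ?case using u(3)[of "n + j"] D.gn_mult[OF uTm[of j] KT] un by simp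
    qed simp
    have "K (n + Suc k) - K (n + k) = (u (n + k) - 1) * K (n + k)"
      using u(3)[of "n + k"] by (simp add: algebra_simps)
    then have "gn (\<rho> n) (K (n + Suc k) - K (n + k)) = gn (\<rho> n) (u (n + k) - 1) * gn (\<rho> n) (K n)"
      using D.gn_mult[of "u (n + k) - 1" m "K (n + k)"] uTm KT const by simp
    also have "\<dots> \<le> b k * gn (\<rho> n) (K n)"
      using u1 D.gn_nonneg[OF KT[of n 0]] by (intro mult_right_mono) auto
    finally show ?thesis by (simp add: mult.commute)
  qed
  define B where "B n k = gn (\<rho> n) (K n) * b k" for n k
  have B: "decseq (B n)" "B n \<longlonglongrightarrow> 0" for n
  proof -
    have "0 \<le> gn (\<rho> n) (K n)" using nonarch_disc.gn_nonneg[OF disc[OF \<rho>(1)] KT[of n 0]] by simp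
    then show "decseq (B n)" using b(1) unfolding B_def decseq_def by (auto intro: mult_left_mono)
    show "B n \<longlonglongrightarrow> 0" unfolding B_def
      using tendsto_mult[OF tendsto_const[of "gn (\<rho> n) (K n)"] b(2)] by simp
  qed
  obtain L where L: "coef_lim K L"
    using nonarch_disc.coef_lim_exists[OF disc[OF \<rho>(1)[of 0]], of K m "B 0"] KT[of 0] step[of 0] B[of 0]
    by (auto simp: B_def)
  have "gcd_in (tate m r) F L" if r: "0 < r" for r
  proof -
    obtain n where n: "r \<le> \<rho> n" unfolding \<rho>_def using real_arch_pow[of 2 r] by (auto intro: less_imp_le)
    interpret D: nonarch_disc absv "\<rho> n" by (rule disc[OF \<rho>(1)])
    let ?T = "tate m (\<rho> n)"
    define S where "S k = K (n + k)" for k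
    define U where "U k = (\<Prod>i<k. u (n + i))" for k
    have uTm: "u (n + j) \<in> ?T" for j using uT by (simp add: unit_in_def)
    have ST: "S k \<in> ?T" for k unfolding S_def by (rule KT)
    have UT: "U k \<in> ?T" for k by (induction k) (auto simp: U_def uTm)
    have Un: "gn (\<rho> n) (U k) = 1" for k
    proof (induction k)
      case (Suc k)
      have "U (Suc k) = U k * u (n + k)" by (simp add: U_def)
      then show ?case using Suc D.gn_mult[OF UT uTm] un by simp
    qed (simp add: U_def)
    have SU: "S k = U k * K n" for k
    proof (induction k)
      case (Suc k)
      have "S (Suc k) = u (n + k) * S k" using u(3)[of "n + k"] by (simp add: S_def)
      then show ?case using Suc by (simp add: U_def ac_simps)
    qed (simp add: S_def U_def)
    have dU: "gn (\<rho> n) (U (Suc k) - U k) \<le> b k" for k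
    proof -
      have "U (Suc k) - U k = U k * (u (n + k) - 1)" by (simp add: U_def algebra_simps)
      then show ?thesis using D.gn_mult[of "U k" m "u (n + k) - 1"] UT uTm Un u1 by simp
    qed
    obtain V where V: "coef_lim U V" using D.coef_lim_exists[of U, OF UT dU b] by blast
    have VT: "V \<in> ?T" and Vn: "gn (\<rho> n) (V - U k) \<le> b k" for k
      using D.coef_lim_tate[of U, OF UT dU b V] by auto
    have dS: "gn (\<rho> n) (S (Suc k) - S k) \<le> B n k" for k
      using step[of n k] by (simp add: S_def B_def)
    have LS: "coef_lim S L" unfolding S_def by (rule coef_lim_shift[OF L])
    have LT: "L \<in> ?T" and Ln: "gn (\<rho> n) (L - S k) \<le> B n k" for k
      using D.coef_lim_tate[of S, OF ST dS B LS] by auto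
    have KnT: "K n \<in> ?T" using KT[of n 0] by simp
    have bound: "gn (\<rho> n) (L - V * K n) \<le> B n k" for k
    proof -
      have e: "L - V * K n = (L - S k) - (V - U k) * K n" by (simp add: SU algebra_simps)
      have "gn (\<rho> n) (L - V * K n) \<le> max (gn (\<rho> n) (L - S k)) (gn (\<rho> n) ((V - U k) * K n))"
        unfolding e using LT ST VT UT KnT by (intro D.gn_diff[of _ m]) simp_all
      moreover have "gn (\<rho> n) ((V - U k) * K n) \<le> B n k"
        using D.gn_mult[of "V - U k" m "K n"] VT UT KnT mult_right_mono[OF Vn[of k] D.gn_nonneg[OF KnT]]
        by (simp add: B_def mult.commute)
      ultimately show ?thesis using Ln[of k] by simp
    qed
    have "gn (\<rho> n) (L - V * K n) \<le> 0"
      by (rule LIMSEQ_le_const[OF B(2)[of n]]) (use bound in blast)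
    moreover have "L - V * K n \<in> ?T" using LT VT KnT by simp
    ultimately have "L - V * K n = 0" using D.gn_nonneg D.gn_eq_0_iff by (metis antisym)
    then have LV: "L = V * K n" by simp
    \<comment> \<open>Since \<open>U 1 = u n\<close> and \<open>b 1 = 1 / 2\<close>, V is near
      enough to the unit \<open>u n\<close> to inherit its dominant constant term.\<close>
    have V1: "gn (\<rho> n) (V - u n) < 1" using Vn[of 1] by (simp add: U_def b_def)
    have near: "wt (\<rho> n) (V - u n) \<gamma> < 1" for \<gamma>
      using D.wt_le_gn[of "V - u n" m \<gamma>] V1 VT uTm[of 0] by simp
    have V0: "absv (coef V 0) = 1"
      using absv_add_eq[of "coef V 0 - 1" 1] near[of 0] u(2)[of n] by (simp add: wt_def)
    have "unit_in ?T V"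
    proof (rule D.dominant_const_unit[OF VT])
      show "coef V 0 \<noteq> 0" using V0 by auto
      fix \<gamma> :: mono assume "\<gamma> \<noteq> 0"
      then have "wt (\<rho> n) (u n) \<gamma> < 1"
        using D.unit_dominant_const(3)[OF u(1)] u(2) by simp
      then show "wt (\<rho> n) V \<gamma> < absv (coef V 0)"
        using wt_add[OF \<rho>(1), of n "V - u n" "u n" \<gamma>] near[of \<gamma>] V0 by simp
    qed
    then have "unit_in (tate m r) V" using unit_in_mono[OF tate_mono_radius[OF r n]] by blast
    moreover have "gcd_in (tate m r) F (K n)" using K(1)[of n] r n by (simp add: P_def)
    ultimately show ?thesis unfolding LV by (intro graded_domain.gcd_unit_multiple[OF gdom[OF r]])
  qed
  then show ?thesis by blast
qed

definition entire :: "nat \<Rightarrow> 'a mps set" where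
  "entire m = (\<Inter>r\<in>{0<..}. tate m r)"

text \<open>Quotients found at different radii agree, because a can be cancelled in the Tate algebra
  of the smaller polydisc. One quotient therefore converges at every radius.\<close>

lemma divides_entire_iff:
  assumes a: "a \<in> entire m" "a \<noteq> 0"
  shows "divides_in (entire m) a b \<longleftrightarrow> (\<forall>r>0. divides_in (tate m r) a b)"
proof
  assume "divides_in (entire m) a b"
  then show "\<forall>r>0. divides_in (tate m r) a b" by (auto simp: divides_in_def entire_def)
next
  assume all: "\<forall>r>0. divides_in (tate m r) a b"
  then have "divides_in (tate m 1) a b" by simp
  then obtain c where c: "c \<in> tate m 1" "b = a * c" by (auto simp: divides_in_def)
  have "c \<in> tate m r" if r: "0 < r" for r
  proof -
    obtain d where d: "d \<in> tate m r" "b = a * d" using all r by (auto simp: divides_in_def)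
    let ?s = "min r 1"
    have s: "0 < ?s" using r by simp
    interpret D: nonarch_disc absv ?s by unfold_locales (rule s)
    interpret T: graded_domain "tate m ?s" D.\<delta> by (rule D.graded_domain_tate)
    have "c \<in> tate m ?s" "d \<in> tate m ?s"
      using c d tate_mono_radius[OF s, of 1 m] tate_mono_radius[OF s, of r m] by auto
    moreover have "a \<in> tate m ?s" using a s by (auto simp: entire_def)
    ultimately have "c = d" using T.cancel[of a c d] a(2) c(2) d(2) by simp
    then show ?thesis using d by simp
  qed
  then have "c \<in> entire m" by (simp add: entire_def)
  then show "divides_in (entire m) a b" using c(2) by (auto simp: divides_in_def)
qed

text \<open>The glued series is a gcd at every radius, and divisibility by a nonzero entire function
  can be tested radius by radius. Any other entire gcd is associated to it already among entire
  functions and so inherits the property at each radius.\<close>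

theorem entire_gcd:
  assumes F: "F \<subseteq> entire m"
  shows "\<exists>G. gcd_in (entire m) F G"
    and "gcd_in (entire m) F G \<Longrightarrow> 0 < r \<Longrightarrow> gcd_in (tate m r) F G"
proof -
  have disc: "nonarch_disc absv r" if "0 < r" for r using that by unfold_locales simp
  have "(\<exists>G. gcd_in (entire m) F G) \<and> (\<forall>G r. gcd_in (entire m) F G \<longrightarrow> 0 < r \<longrightarrow> gcd_in (tate m r) F G)"
  \<comment> \<open>Gluing needs a nonzero member of F. Without one, 0 is the only gcd in each of
    the rings.\<close>
  proof (cases "F \<subseteq> {0}")
    case True
    have zero: "gcd_in A F G \<longleftrightarrow> G = 0" if "0 \<in> A" for A and G :: "'a mps"
    proof
      assume "gcd_in A F G"
      moreover have "\<forall>f\<in>F. divides_in A 0 f" using True that by (auto simp: divides_in_def)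
      ultimately have "divides_in A 0 G" using that by (auto simp: gcd_in_def)
      then show "G = 0" by (auto simp: divides_in_def)
    next
      assume "G = 0"
      moreover have "divides_in A D 0" for D unfolding divides_in_def by (rule bexI[OF _ that]) simp
      ultimately show "gcd_in A F G" using True that by (auto simp: gcd_in_def)
    qed
    have 0: "0 \<in> tate m r" if "0 < r" for r using nonarch_disc.tate_zero[OF disc[OF that]] .
    then have "0 \<in> entire m" by (simp add: entire_def)
    then show ?thesis using zero 0 by auto
  next
    case False
    then obtain f0 where f0: "f0 \<in> F" "f0 \<noteq> 0" by auto
    have "F \<subseteq> tate m r" if "0 < r" for r using F that by (auto simp: entire_def)
    then obtain L where L: "\<And>r. 0 < r \<Longrightarrow> gcd_in (tate m r) F L" using gcd_glue[OF _ f0] by blast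
    have LE: "L \<in> entire m" using L by (auto simp: entire_def gcd_in_def)
    have nz: "D \<noteq> 0" if "divides_in A D f0" for A and D :: "'a mps" using that f0 by (auto simp: divides_in_def)
    have Ldiv: "divides_in (tate m r) L f" if "0 < r" "f \<in> F" for r f using L that by (auto simp: gcd_in_def)
    have "L \<noteq> 0" using nz[OF Ldiv[of 1 f0]] f0 by simp
    have gL: "gcd_in (entire m) F L"
      unfolding gcd_in_def
    proof (intro conjI ballI impI)
      show "L \<in> entire m" by (rule LE)
      show "divides_in (entire m) L f" if "f \<in> F" for f
        using divides_entire_iff[OF LE \<open>L \<noteq> 0\<close>] Ldiv that by blast
      fix D assume D: "D \<in> entire m" "\<forall>f\<in>F. divides_in (entire m) D f"
      have D0: "D \<noteq> 0" using nz D(2) f0 by blast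
      have "divides_in (tate m r) D L" if r: "0 < r" for r
      proof -
        have "\<forall>f\<in>F. divides_in (tate m r) D f" using D divides_entire_iff[OF D(1) D0] r by blast
        moreover have "D \<in> tate m r" using D(1) r by (simp add: entire_def)
        ultimately show ?thesis using L[OF r] by (auto simp: gcd_in_def)
      qed
      then show "divides_in (entire m) D L" using divides_entire_iff[OF D(1) D0] by blast
    qed
    moreover have "gcd_in (tate m r) F G" if G: "gcd_in (entire m) F G" and r: "0 < r" for G r
    proof (rule graded_domain.gcd_assoc[OF nonarch_disc.graded_domain_tate[OF disc[OF r]] L[OF r]])
      have sub: "entire m \<subseteq> tate m r" using r by (auto simp: entire_def)
      have "divides_in (entire m) L G" "divides_in (entire m) G L" "G \<in> entire m"
        using gL G by (auto simp: gcd_in_def)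
      then show "G \<in> tate m r" "divides_in (tate m r) L G" "divides_in (tate m r) G L"
        using sub divides_in_mono[OF sub] by blast+
    qed
    ultimately show ?thesis by blast
  qed
  then show "\<exists>G. gcd_in (entire m) F G"
    and "gcd_in (entire m) F G \<Longrightarrow> 0 < r \<Longrightarrow> gcd_in (tate m r) F G" by blast+
qed

end

section \<open>Transfer to coefficient functions on multi-indices\<close>

definition mps_of :: "((nat \<Rightarrow> nat) \<Rightarrow> 'a) \<Rightarrow> 'a mps" where
  "mps_of F = mps (\<lambda>\<gamma>. F (lookup \<gamma>))"

definition fun_of :: "nat \<Rightarrow> 'a::zero mps \<Rightarrow> (nat \<Rightarrow> nat) \<Rightarrow> 'a" where
  "fun_of m f \<gamma> = (if \<gamma> \<in> multi_idx m then coef f (Abs_poly_mapping \<gamma>) else 0)"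

lemma coef_mps_of [simp]: "coef (mps_of F) \<gamma> = F (lookup \<gamma>)"
  by (simp add: mps_of_def)

lemma multi_idx_lookup: assumes "\<gamma> \<in> multi_idx m" shows "lookup (Abs_poly_mapping \<gamma>) = \<gamma>"
proof -
  have "i < m" if "\<gamma> i \<noteq> 0" for i using assms that by (cases "m \<le> i") (auto simp: multi_idx_def)
  then have "{i. \<gamma> i \<noteq> 0} \<subseteq> {..<m}" by blast
  then have "finite {i. \<gamma> i \<noteq> 0}" by (rule finite_subset) simp
  then show ?thesis by simp
qed

lemma lookup_in_multi_idx: "lookup \<gamma> \<in> multi_idx m \<longleftrightarrow> keys \<gamma> \<subseteq> {..<m}"
  unfolding multi_idx_def subset_iff in_keys_iff lessThan_iff mem_Collect_eq by (meson not_le)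

lemma mdeg_lookup: "keys \<gamma> \<subseteq> {..<m} \<Longrightarrow> mdeg m (lookup \<gamma>) = deg \<gamma>"
  using deg_eq_sum[of "{..<m}" \<gamma>] by (simp add: mdeg_def)

lemma fun_of_fps [simp]: "fun_of m f \<in> fps_m m"
  by (simp add: fun_of_def fps_m_def)

lemma fun_of_mps_of: "F \<in> fps_m m \<Longrightarrow> fun_of m (mps_of F) = F"
  by (rule ext) (simp add: fun_of_def fps_m_def multi_idx_lookup)

lemma mps_of_fun_of:
  assumes "\<And>\<gamma>. coef f \<gamma> \<noteq> 0 \<Longrightarrow> keys \<gamma> \<subseteq> {..<m}" shows "mps_of (fun_of m f) = f"
  by (rule mps_eqI) (use assms in \<open>auto simp: fun_of_def lookup_in_multi_idx lookup_inverse\<close>)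

lemma mps_of_inj: "F \<in> fps_m m \<Longrightarrow> G \<in> fps_m m \<Longrightarrow> mps_of F = mps_of G \<longleftrightarrow> F = G"
  using fun_of_mps_of by metis

lemma ps_mult_fps: assumes "F \<in> fps_m m" "G \<in> fps_m m" shows "ps_mult F G \<in> fps_m m"
proof -
  have "ps_mult F G \<gamma> = 0" if "\<gamma> \<notin> multi_idx m" for \<gamma>
  proof -
    obtain i where i: "i \<ge> m" "\<gamma> i \<noteq> 0" using \<open>\<gamma> \<notin> multi_idx m\<close> by (auto simp: multi_idx_def)
    have "F \<alpha> * G (\<lambda>i. \<gamma> i - \<alpha> i) = 0" for \<alpha>
    proof (cases "\<alpha> i = 0")
      case True
      then have "(\<lambda>i. \<gamma> i - \<alpha> i) \<notin> multi_idx m" using i by (auto simp: multi_idx_def)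
      then show ?thesis using assms by (simp add: fps_m_def)
    next
      case False
      then have "\<alpha> \<notin> multi_idx m" using i by (auto simp: multi_idx_def)
      then show ?thesis using assms by (simp add: fps_m_def)
    qed
    then show ?thesis unfolding ps_mult_def by (rule sum.neutral[OF ballI])
  qed
  then show ?thesis by (simp add: fps_m_def)
qed

lemma mps_of_mult: "mps_of (ps_mult F G) = mps_of F * mps_of G"
proof (rule mps_eqI)
  fix \<gamma> :: mono
  have fin: "finite {i. \<alpha> i \<noteq> 0}" if "\<forall>i. \<alpha> i \<le> lookup \<gamma> i" for \<alpha> :: "nat \<Rightarrow> nat"
  proof (rule finite_subset)
    show "{i. \<alpha> i \<noteq> 0} \<subseteq> keys \<gamma>"
    proof
      fix i assume "i \<in> {i. \<alpha> i \<noteq> 0}"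
      then show "i \<in> keys \<gamma>" using that[rule_format, of i] in_keys_iff[of i \<gamma>] by simp
    qed
  qed simp
  have look: "lookup (Abs_poly_mapping \<alpha>) = \<alpha>" if "\<forall>i. \<alpha> i \<le> lookup \<gamma> i" for \<alpha> :: "nat \<Rightarrow> nat"
    using fin[OF that] by simp
  have "(\<Sum>\<alpha>\<in>{\<alpha>. \<forall>i. \<alpha> i \<le> lookup \<gamma> i}. F \<alpha> * G (\<lambda>i. lookup \<gamma> i - \<alpha> i)) =
      (\<Sum>(\<alpha>, \<beta>)\<in>dec \<gamma>. F (lookup \<alpha>) * G (lookup \<beta>))"
  proof (rule sum.reindex_bij_witness[where i = "\<lambda>p. lookup (fst p)"
        and j = "\<lambda>\<alpha>. (Abs_poly_mapping \<alpha>, \<gamma> - Abs_poly_mapping \<alpha>)"])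
    fix \<alpha> assume "\<alpha> \<in> {\<alpha>. \<forall>i. \<alpha> i \<le> lookup \<gamma> i}"
    then have le: "\<forall>i. \<alpha> i \<le> lookup \<gamma> i" by simp
    note l = look[OF le]
    show "lookup (fst (Abs_poly_mapping \<alpha>, \<gamma> - Abs_poly_mapping \<alpha>)) = \<alpha>" by (simp add: l)
    have "Abs_poly_mapping \<alpha> + (\<gamma> - Abs_poly_mapping \<alpha>) = \<gamma>"
      by (rule poly_mapping_eqI) (simp add: lookup_add lookup_minus l le)
    then show "(Abs_poly_mapping \<alpha>, \<gamma> - Abs_poly_mapping \<alpha>) \<in> dec \<gamma>" by simp
    have "lookup (\<gamma> - Abs_poly_mapping \<alpha>) = (\<lambda>i. lookup \<gamma> i - \<alpha> i)"
      by (rule ext) (simp add: lookup_minus l)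
    then show "(case (Abs_poly_mapping \<alpha>, \<gamma> - Abs_poly_mapping \<alpha>) of (\<alpha>, \<beta>) \<Rightarrow> F (lookup \<alpha>) * G (lookup \<beta>)) =
        F \<alpha> * G (\<lambda>i. lookup \<gamma> i - \<alpha> i)" by (simp add: l)
  next
    fix p assume "p \<in> dec \<gamma>"
    then obtain \<alpha> \<beta> where p: "p = (\<alpha>, \<beta>)" "\<alpha> + \<beta> = \<gamma>" by (cases p) auto
    have "\<gamma> - \<alpha> = \<beta>" unfolding p(2)[symmetric] by simp
    then show "(Abs_poly_mapping (lookup (fst p)), \<gamma> - Abs_poly_mapping (lookup (fst p))) = p"
      unfolding p(1) fst_conv lookup_inverse by (rule arg_cong)
    show "lookup (fst p) \<in> {\<alpha>. \<forall>i. \<alpha> i \<le> lookup \<gamma> i}"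
      unfolding p(1) p(2)[symmetric] by (simp add: lookup_add)
  qed
  then show "coef (mps_of (ps_mult F G)) \<gamma> = coef (mps_of F * mps_of G) \<gamma>"
    by (simp add: coef_mult ps_mult_def)
qed

text \<open>Stated for any set A of series in the first m variables, so that one transfer covers the
  entire functions and every Tate algebra.\<close>

lemma is_gcd_in_iff:
  assumes A: "\<And>f \<gamma>. f \<in> A \<Longrightarrow> coef f \<gamma> \<noteq> 0 \<Longrightarrow> keys \<gamma> \<subseteq> {..<m}" and fs: "set fs \<subseteq> fps_m m"
  shows "is_gcd_in {F \<in> fps_m m. mps_of F \<in> A} fs G \<longleftrightarrow> G \<in> fps_m m \<and> gcd_in A (mps_of ` set fs) (mps_of G)"
proof -
  let ?R = "{F \<in> fps_m m. mps_of F \<in> A}"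
  have surj: "\<exists>F\<in>?R. mps_of F = f" if "f \<in> A" for f
    using mps_of_fun_of[of f m] A that by (intro bexI[of _ "fun_of m f"]) auto
  have dvd: "dvd_in ?R F H \<longleftrightarrow> divides_in A (mps_of F) (mps_of H)" if FH: "F \<in> fps_m m" "H \<in> fps_m m" for F H
  proof
    assume "dvd_in ?R F H"
    then show "divides_in A (mps_of F) (mps_of H)" by (auto simp: dvd_in_def divides_in_def mps_of_mult)
  next
    assume "divides_in A (mps_of F) (mps_of H)"
    then obtain c where c: "c \<in> A" "mps_of H = mps_of F * c" by (auto simp: divides_in_def)
    obtain C where "C \<in> ?R" "mps_of C = c" using surj[OF c(1)] by blast
    then have C: "C \<in> ?R" "mps_of H = mps_of F * mps_of C" using c(2) by blast+
    have "mps_of H = mps_of (ps_mult F C)" using C(2) by (simp only: mps_of_mult)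
    moreover have "ps_mult F C \<in> fps_m m" using C(1) by (intro ps_mult_fps FH(1)) simp
    ultimately have "H = ps_mult F C" using mps_of_inj[OF FH(2)] by simp
    then show "dvd_in ?R F H" using C by (auto simp: dvd_in_def)
  qed
  have fsm: "f \<in> fps_m m" if "f \<in> set fs" for f using fs that by blast
  show ?thesis
  proof
    assume g: "is_gcd_in ?R fs G"
    then have G: "G \<in> fps_m m" "mps_of G \<in> A" by (auto simp: is_gcd_in_def)
    have "divides_in A D (mps_of G)" if D: "D \<in> A" "\<forall>f\<in>mps_of ` set fs. divides_in A D f" for D
    proof -
      obtain E where E: "E \<in> ?R" "mps_of E = D" using surj D by blast
      then have "\<forall>f\<in>set fs. dvd_in ?R E f" using D dvd fsm by auto
      then have "dvd_in ?R E G" using g E by (auto simp: is_gcd_in_def)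
      then show ?thesis using dvd E G by auto
    qed
    moreover have "\<forall>f\<in>set fs. divides_in A (mps_of G) (mps_of f)"
      using g dvd[OF G(1) fsm] by (auto simp: is_gcd_in_def)
    ultimately show "G \<in> fps_m m \<and> gcd_in A (mps_of ` set fs) (mps_of G)"
      using G by (auto simp: gcd_in_def)
  next
    assume g: "G \<in> fps_m m \<and> gcd_in A (mps_of ` set fs) (mps_of G)"
    then have G: "G \<in> fps_m m" "mps_of G \<in> A" by (auto simp: gcd_in_def)
    have "dvd_in ?R D G" if D: "D \<in> ?R" "\<forall>f\<in>set fs. dvd_in ?R D f" for D
    proof -
      have "\<forall>f\<in>mps_of ` set fs. divides_in A (mps_of D) f" using D dvd fsm by auto
      then have "divides_in A (mps_of D) (mps_of G)" using g D by (auto simp: gcd_in_def)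
      then show ?thesis using dvd D G by auto
    qed
    moreover have "\<forall>f\<in>set fs. dvd_in ?R G f" using g dvd[OF G(1) fsm] by (auto simp: gcd_in_def)
    ultimately show "is_gcd_in ?R fs G" using G by (auto simp: is_gcd_in_def)
  qed
qed

context nonarch
begin

text \<open>In m variables only finitely many monomials have bounded degree, so tending to 0 along
  the degree is the same as having finitely many weights above each e.\<close>

lemma analytic_ring_eq:
  assumes r: "0 < r" shows "analytic_ring absv m r = {F \<in> fps_m m. mps_of F \<in> tate m r}"
proof -
  interpret D: nonarch_disc absv r by unfold_locales (rule r)
  have "(\<forall>e>0. \<exists>N. \<forall>\<gamma>\<in>multi_idx m. N \<le> mdeg m \<gamma> \<longrightarrow> absv (F \<gamma>) * r ^ mdeg m \<gamma> < e) \<longleftrightarrow> mps_of F \<in> tate m r"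
    if F: "F \<in> fps_m m" for F
  proof
    assume lim: "\<forall>e>0. \<exists>N. \<forall>\<gamma>\<in>multi_idx m. N \<le> mdeg m \<gamma> \<longrightarrow> absv (F \<gamma>) * r ^ mdeg m \<gamma> < e"
    have keys: "keys \<gamma> \<subseteq> {..<m}" if "coef (mps_of F) \<gamma> \<noteq> 0" for \<gamma>
      using that F lookup_in_multi_idx[of \<gamma> m] by (auto simp: fps_m_def)
    have "finite {\<gamma>. e \<le> wt r (mps_of F) \<gamma>}" if e: "e > 0" for e
    proof -
      obtain N where N: "\<And>\<gamma>. \<gamma> \<in> multi_idx m \<Longrightarrow> N \<le> mdeg m \<gamma> \<Longrightarrow> absv (F \<gamma>) * r ^ mdeg m \<gamma> < e"
        using lim e by blast
      \<comment> \<open>The box of exponents up to N encloses all monomials of degree below N in m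
        variables.\<close>
      define \<beta> :: mono where "\<beta> = (\<Sum>i<m. single i N)"
      have l\<beta>: "lookup \<beta> i = (if i < m then N else 0)" for i
        unfolding \<beta>_def lookup_sum by (simp add: lookup_single when_def)
      have "\<forall>i. lookup \<gamma> i \<le> lookup \<beta> i" if le: "e \<le> wt r (mps_of F) \<gamma>" for \<gamma>
      proof
        fix i
        have "wt r (mps_of F) \<gamma> \<noteq> 0" using le e by linarith
        then have "coef (mps_of F) \<gamma> \<noteq> 0" by (auto simp: wt_def)
        then have k: "keys \<gamma> \<subseteq> {..<m}" by (rule keys)
        then have "\<not> N \<le> deg \<gamma>"
          using N[of "lookup \<gamma>"] le mdeg_lookup[OF k] by (auto simp: lookup_in_multi_idx wt_def)
        then have "lookup \<gamma> i \<le> N" using lookup_le_deg[of \<gamma> i] by linarith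
        moreover have "lookup \<gamma> i = 0" if "\<not> i < m"
        proof (rule ccontr)
          assume "lookup \<gamma> i \<noteq> 0"
          then have "i \<in> keys \<gamma>" by (simp add: in_keys_iff)
          then show False using k that by blast
        qed
        ultimately show "lookup \<gamma> i \<le> lookup \<beta> i" by (simp add: l\<beta>)
      qed
      then have "{\<gamma>. e \<le> wt r (mps_of F) \<gamma>} \<subseteq> {\<gamma>. \<forall>i. lookup \<gamma> i \<le> lookup \<beta> i}" by (rule Collect_mono[OF impI])
      then show ?thesis using finite_mono_bounded finite_subset by blast
    qed
    then show "mps_of F \<in> tate m r" unfolding tate_def using keys by blast
  next
    assume T: "mps_of F \<in> tate m r"
    show "\<forall>e>0. \<exists>N. \<forall>\<gamma>\<in>multi_idx m. N \<le> mdeg m \<gamma> \<longrightarrow> absv (F \<gamma>) * r ^ mdeg m \<gamma> < e"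
    proof (intro allI impI)
      fix e :: real assume "e > 0"
      then have "finite (deg ` {\<gamma>. e \<le> wt r (mps_of F) \<gamma>})" using tate_finite[OF T] by blast
      then obtain N where N: "deg ` {\<gamma>. e \<le> wt r (mps_of F) \<gamma>} \<subseteq> {..<N}"
        unfolding finite_nat_iff_bounded by blast
      have "absv (F \<gamma>) * r ^ mdeg m \<gamma> < e" if \<gamma>: "\<gamma> \<in> multi_idx m" "N \<le> mdeg m \<gamma>" for \<gamma>
      proof -
        let ?g = "Abs_poly_mapping \<gamma>"
        have l: "lookup ?g = \<gamma>" by (rule multi_idx_lookup[OF \<gamma>(1)])
        have k: "keys ?g \<subseteq> {..<m}" using lookup_in_multi_idx[of ?g m] \<gamma>(1) l by simp
        have d: "mdeg m \<gamma> = deg ?g" using mdeg_lookup[OF k] l by simp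
        have "\<not> e \<le> wt r (mps_of F) ?g" using N \<gamma>(2) d by force
        then show ?thesis by (simp add: wt_def l d)
      qed
      then show "\<exists>N. \<forall>\<gamma>\<in>multi_idx m. N \<le> mdeg m \<gamma> \<longrightarrow> absv (F \<gamma>) * r ^ mdeg m \<gamma> < e" by blast
    qed
  qed
  then show ?thesis unfolding analytic_ring_def by blast
qed

lemma value_group_pos: "r \<in> value_group absv \<Longrightarrow> 0 < r"
  by (auto simp: value_group_def)

text \<open>Nontriviality supplies a scalar of absolute value above 1, possibly as an inverse, and
  its powers exceed every bound. For entire functions, radii in the value group therefore say as
  much as all positive radii.\<close>

lemma value_group_unbounded: "\<exists>r\<in>value_group absv. s \<le> r"
proof -
  obtain x where x: "x \<noteq> 0" "absv x \<noteq> 1"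
    using nonarch_field by (auto simp: nonarch_field_def nontrivial_abs_def)
  obtain y where y: "y \<noteq> 0" "absv y > 1"
  proof (cases "absv x > 1")
    case False
    then have "absv x < 1" "absv x > 0" using x by auto
    then have "absv (inverse x) > 1" by (simp add: absv_inverse one_less_inverse)
    then show ?thesis using that[of "inverse x"] x by simp
  qed (use that x in blast)
  obtain k where "s < absv y ^ k" using real_arch_pow[OF y(2)] by blast
  then have "s \<le> absv (y ^ k)" by (simp add: absv_power)
  moreover have "absv (y ^ k) \<in> value_group absv" using y by (auto simp: value_group_def)
  ultimately show ?thesis by blast
qed

lemma entire_ring_eq: "entire_ring absv m = {F \<in> fps_m m. mps_of F \<in> entire m}"
proof -
  have "(\<forall>r\<in>value_group absv. F \<in> analytic_ring absv m r) \<longleftrightarrow> mps_of F \<in> entire m" if F: "F \<in> fps_m m" for F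
  proof
    assume all: "\<forall>r\<in>value_group absv. F \<in> analytic_ring absv m r"
    have "mps_of F \<in> tate m s" if s: "0 < s" for s
    proof -
      obtain r where r: "r \<in> value_group absv" "s \<le> r" using value_group_unbounded by blast
      then have "mps_of F \<in> tate m r" using all analytic_ring_eq[OF value_group_pos] by auto
      then show ?thesis using tate_mono_radius[OF s r(2)] by blast
    qed
    then show "mps_of F \<in> entire m" by (simp add: entire_def)
  next
    assume "mps_of F \<in> entire m"
    then show "\<forall>r\<in>value_group absv. F \<in> analytic_ring absv m r"
      using F analytic_ring_eq value_group_pos by (auto simp: entire_def)
  qed
  then show ?thesis unfolding entire_ring_def by blast
qed

end

theorem mainTheorem1:
  fixes absv :: "'a::field \<Rightarrow> real" and m :: nat
    and fs :: "((nat \<Rightarrow> nat) \<Rightarrow> 'a) list"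
  assumes "nonarch_field absv"
    and "set fs \<subseteq> entire_ring absv m"
  shows "(\<exists>G. is_gcd_in (entire_ring absv m) fs G) \<and>
         (\<forall>G. is_gcd_in (entire_ring absv m) fs G \<longrightarrow>
              (\<forall>r\<in>value_group absv. is_gcd_in (analytic_ring absv m r) fs G))"
proof -
  interpret nonarch absv by unfold_locales (rule assms(1))
  let ?F = "mps_of ` set fs"
  have fs: "set fs \<subseteq> fps_m m" "?F \<subseteq> entire m" using assms(2) unfolding entire_ring_eq by auto
  have entire_keys: "keys \<gamma> \<subseteq> {..<m}" if "f \<in> entire m" "coef f \<gamma> \<noteq> 0" for f \<gamma>
    using that tate_keys[of f m 1 \<gamma>] by (auto simp: entire_def)
  have E: "is_gcd_in (entire_ring absv m) fs G \<longleftrightarrow> G \<in> fps_m m \<and> gcd_in (entire m) ?F (mps_of G)" for G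
    unfolding entire_ring_eq by (rule is_gcd_in_iff[OF entire_keys fs(1)])
  have A: "is_gcd_in (analytic_ring absv m r) fs G \<longleftrightarrow> G \<in> fps_m m \<and> gcd_in (tate m r) ?F (mps_of G)"
    if "0 < r" for r G
    unfolding analytic_ring_eq[OF that] by (rule is_gcd_in_iff[OF tate_keys fs(1)])
  obtain G where G: "gcd_in (entire m) ?F G" using entire_gcd(1)[OF fs(2)] by blast
  have "mps_of (fun_of m G) = G"
    using mps_of_fun_of[of G m] entire_keys[of G] G by (auto simp: gcd_in_def)
  then have "is_gcd_in (entire_ring absv m) fs (fun_of m G)" unfolding E using G by simp
  moreover have "is_gcd_in (analytic_ring absv m r) fs G"
    if "is_gcd_in (entire_ring absv m) fs G" "r \<in> value_group absv" for G r
    using that entire_gcd(2)[OF fs(2), of "mps_of G" r] value_group_pos[of r] by (simp add: E A)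
  ultimately show ?thesis by blast
qed

end
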